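(* Consider an internally consistent internal stage predictor-corrector MRI-GARK (IPC-MRI-GARK) method with $s$-stage slow base Runge--Kutta method $(A,b,c)$, satisfying the self-consistency conditions $T=E\bar\Gamma$ and $D=E\bar\Psi$. Write $\zeta_k=\frac1{(k+1)(k+2)}$, $\omega_k=\frac1{(k+1)(k+3)}$, $\xi_k=\frac1{(k+1)(k+2)(k+3)}$. The method has order four if and only if the slow base method has order at least four and the following coupling conditions hold: $$\tfrac16=\Delta c^T\Big(LA+\sum_{k\ge0}\zeta_k(\Psi^k+\Gamma^k)\Big)c,$$ $$\tfrac16=e_s^T\Big(DAc+\tfrac12Tc^{\times2}\Big),$$ $$\tfrac18=(\Delta c\times Lc)^T\Big(LA+\sum_{k\ge0}\zeta_k(\Psi^k+\Gamma^k)\Big)c+(\Delta c^{\times2})^T\Big(\tfrac12LA+\sum_{k\ge0}\omega_k(\Psi^k+\Gamma^k)\Big)c,$$ $$\tfrac18=(e_s^TD\times c^T)Ac+\tfrac12(e_s^TT\times c^T)c^{\times2},$$ $$\tfrac1{12}=\Delta c^T\Big(LA+\sum_{k\ge0}\zeta_k(\Psi^k+\Gamma^k)\Big)c^{\times2},$$ $$\tfrac1{12}=e_s^T\Big(DAc^{\times2}+\tfrac13Tc^{\times3}\Big),$$ $$\tfrac1{24}=\Delta c^TL\,\Delta C\Big(LA+\sum_{k\ge0}\zeta_k(\Psi^k+\Gamma^k)\Big)c+(\Delta c^{\times2})^T\Big(\tfrac12LA+\sum_{k\ge0}\xi_k(\Psi^k+\Gamma^k)\Big)c,$$ $$\tfrac1{24}=\Delta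 c^T\Big(LD+\sum_{k\ge0}\zeta_k\Psi^k\Big)Ac+\tfrac12\Delta c^T\Big(LT+\sum_{k\ge0}\zeta_k\Gamma^k\Big)c^{\times2},$$ $$\tfrac1{24}=\Delta c^T\Big(LA+\sum_{k\ge0}\zeta_k(\Psi^k+\Gamma^k)\Big)Ac,$$ $$\tfrac1{24}=e_s^TA\Big(DAc+\tfrac12Tc^{\times2}\Big),$$ $$\tfrac1{24}=e_s^TDAAc+e_s^TT\,\Delta C\Big(LA+\sum_{k\ge0}\zeta_k(\Psi^k+\Gamma^k)\Big)c.$$
   Context: The ODE is $y'=f(t,y)=f^{F}(t,y)+f^{S}(t,y)$, $y(t_0)=y_0\in\mathbb R^d$ ($F$ = fast, $S$ = slow). The slow base method $(A,b,c)$ is an $s$-stage Runge--Kutta method with $A=(a_{i,j})$ lower triangular (diagonally implicit), $c=A\mathbf 1_s$ ($\mathbf 1_s$ is the vector of ones), $0\le c_1\le\dots\le c_s\le1$, and stiffly accurate: $b^T=e_s^TA$ and $c_s=1$, where $e_s$ is the last standard basis vector of $\mathbb R^s$. Put $c_0=0$, $\Delta c=(c_1,c_2-c_1,\dots,c_s-c_{s-1})^T$, $T_j=t_n+c_jH$. One step of size $H$ of the IPC-MRI-GARK method is: $Y_0=y_n$; for $i=1,\dots,s$, $$Y_i^*=y_n+H\sum_{j=1}^{i-1}a_{i,j}f_j+Ha_{i,i}f_i^*,\qquad v_i(0)=Y_{i-1},$$ $$v_i'(\theta)=\Delta c_i\,f^F(T_{i-1}+\Delta c_i\theta,v_i)+\sum_{j=1}^{i-1}\gamma_{i,j}(\theta/H)f^S_j+\sum_{j=1}^{i}\psi_{i,j}(\theta/H)f_j^{S*},\quad\theta\in[0,H],\qquad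 Y_i=v_i(H);$$ and $y_{n+1}=Y_s$. Here $f_j=f(T_j,Y_j)$, $f_j^*=f(T_j,Y_j^* )$, $f_j^S=f^S(T_j,Y_j)$, $f_j^{S*}=f^S(T_j,Y_j^* )$; the ODEs for $v_i$ are solved exactly (equivalently, by an arbitrarily accurate Runge--Kutta method). The coefficients $\gamma_{i,j}(t)=\sum_{k\ge0}\gamma^k_{i,j}t^k$, $\psi_{i,j}(t)=\sum_{k\ge0}\psi^k_{i,j}t^k$ are polynomials with $\gamma_{i,j}=0$ for $j\ge i$ and $\psi_{i,j}=0$ for $j>i$; $\Gamma^k=(\gamma^k_{i,j})$, $\Psi^k=(\psi^k_{i,j})\in\mathbb R^{s\times s}$; all sums over $k$ are finite. $D$ is the diagonal part and $T$ (the matrix, not to be confused with the times $T_j$ or transposition) the strictly lower triangular part of $A$. $E\in\mathbb R^{s\times s}$ is the lower triangular matrix with all entries on and below the diagonal equal to $1$; $\bar\Gamma=\sum_k\Gamma^k/(k+1)$, $\bar\Psi=\sum_k\Psi^k/(k+1)$. $L\in\mathbb R^{s\times s}$ is the lower shift matrix ($L_{i,j}=1$ if $i=j+1$, else $0$), and $\Delta C\in\mathbb R^{s\times s}$ is the lower triangular matrix with $\Delta C_{i,j}=\Delta c_j$ for $j\le i$. The symbol $\times$ between vectors is the elementwise product, and $x^{\times k}$ is the elementwise $k$-th power. The method is internally consistent when $(\Psi^0+\Gamma^0)\mathbf 1_s=\Delta c$ and $(\Psi^k+\Gamma^k)\mathbf 1_s=0$ for all $k\ge1$. "Order four" means order at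 least four in the usual sense: for all sufficiently smooth $f^F,f^S$, the local error of one step is $O(H^5)$ as $H\to0$. *)

theory Defs
  imports
    "HOL-Analysis.Analysis"
    "HOL-Computational_Algebra.Polynomial"
    "Jordan_Normal_Form.Matrix"
begin

unbundle no vec_syntax
unbundle no inner_syntax

text \<open>
  The notion of order quantifies over the dimension \<open>d\<close> of the system, so \<open>d\<close> cannot be a type;
  \<open>\<real>\<^sup>d\<close> is the carrier of \<open>Euclidean_space d\<close>, i.e. the functions on \<open>nat\<close> vanishing from \<open>d\<close> on.
  Coefficients are matrices and vectors with entries numbered from 0: entry \<open>(i, j)\<close> below is
  \<open>a\<^bsub>i+1,j+1\<^esub>\<close>.  Stages, abscissae \<open>c\<^sub>0, \<dots>, c\<^sub>s\<close> and times keep their usual numbering, so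
  \<open>A $$ (i, j)\<close> goes with the stages \<open>Suc i\<close> and \<open>Suc j\<close>.
\<close>

section \<open>Initial value problems\<close>

type_synonym state = "nat \<Rightarrow> real"
type_synonym vfield = "real \<Rightarrow> state \<Rightarrow> state"

abbreviation R :: "nat \<Rightarrow> state set" where
  "R d \<equiv> topspace (Euclidean_space d)"

abbreviation norm_R :: "nat \<Rightarrow> state \<Rightarrow> real" where
  "norm_R d x \<equiv> L2_set x {..<d}"

text \<open>\<open>q\<close> times continuously differentiable scalar functions on \<open>\<real> \<times> \<real>\<^sup>d\<close>, by iterated partial
  derivatives in the time and in the \<open>d\<close> space variables.\<close>

primrec C_k :: "nat \<Rightarrow> nat \<Rightarrow> (real \<Rightarrow> state \<Rightarrow> real) \<Rightarrow> bool" where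
  "C_k d 0 g \<longleftrightarrow>
     continuous_map (prod_topology euclideanreal (Euclidean_space d)) euclideanreal (\<lambda>(t, x). g t x)"
| "C_k d (Suc q) g \<longleftrightarrow>
     continuous_map (prod_topology euclideanreal (Euclidean_space d)) euclideanreal (\<lambda>(t, x). g t x) \<and>
     (\<exists>g'. C_k d q g' \<and>
        (\<forall>t. \<forall>x\<in>R d. ((\<lambda>\<tau>. g \<tau> x) has_real_derivative g' t x) (at t))) \<and>
     (\<forall>m<d. \<exists>g'. C_k d q g' \<and>
        (\<forall>t. \<forall>x\<in>R d. ((\<lambda>u. g t (x(m := u))) has_real_derivative g' t x) (at (x m))))"

definition smooth_field :: "nat \<Rightarrow> nat \<Rightarrow> vfield \<Rightarrow> bool" where
  "smooth_field d q f \<longleftrightarrow>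
     (\<forall>t. \<forall>x\<in>R d. f t x \<in> R d) \<and> (\<forall>m<d. C_k d q (\<lambda>t x. f t x m))"

definition solves_on :: "nat \<Rightarrow> vfield \<Rightarrow> (real \<Rightarrow> state) \<Rightarrow> real \<Rightarrow> real \<Rightarrow> bool" where
  "solves_on d f y a b \<longleftrightarrow>
     (\<forall>t\<in>{a..b}. y t \<in> R d \<and>
        (\<forall>m. ((\<lambda>\<tau>. y \<tau> m) has_real_derivative f t (y t) m) (at t within {a..b})))"

section \<open>Coefficient matrices\<close>

definition ones :: "nat \<Rightarrow> real vec" where
  "ones s = vec s (\<lambda>_. 1)"

definition cwise_mult :: "real vec \<Rightarrow> real vec \<Rightarrow> real vec" (infixl "\<times>\<^sub>v" 75) where
  "u \<times>\<^sub>v v = vec (dim_vec u) (\<lambda>i. u $ i * v $ i)"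

definition cwise_power :: "real vec \<Rightarrow> nat \<Rightarrow> real vec" (infixr "^\<^sub>v" 80) where
  "u ^\<^sub>v k = map_vec (\<lambda>x. x ^ k) u"

definition diag_part :: "real mat \<Rightarrow> real mat" where
  "diag_part A = mat (dim_row A) (dim_col A) (\<lambda>(i, j). if i = j then A $$ (i, j) else 0)"

definition strict_lower_part :: "real mat \<Rightarrow> real mat" where
  "strict_lower_part A = mat (dim_row A) (dim_col A) (\<lambda>(i, j). if j < i then A $$ (i, j) else 0)"

definition lower_ones :: "nat \<Rightarrow> real mat" where
  "lower_ones s = mat s s (\<lambda>(i, j). if j \<le> i then 1 else 0)"

definition lower_shift :: "nat \<Rightarrow> real mat" where
  "lower_shift s = mat s s (\<lambda>(i, j). if i = j + 1 then 1 else 0)"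

text \<open>\<open>node c i\<close> is \<open>c\<^sub>i\<close> for \<open>0 \<le> i \<le> s\<close>, with \<open>c\<^sub>0 = 0\<close>.\<close>

definition node :: "real vec \<Rightarrow> nat \<Rightarrow> real" where
  "node c i = (case i of 0 \<Rightarrow> 0 | Suc j \<Rightarrow> c $ j)"

definition delta :: "real vec \<Rightarrow> real vec" where
  "delta c = vec (dim_vec c) (\<lambda>i. node c (Suc i) - node c i)"

definition delta_mat :: "real vec \<Rightarrow> real mat" where
  "delta_mat c = mat (dim_vec c) (dim_vec c) (\<lambda>(i, j). if j \<le> i then delta c $ j else 0)"

text \<open>\<open>\<Gamma>\<^sup>k\<close> and \<open>\<Psi>\<^sup>k\<close> as coefficients of matrices of polynomials.\<close>

definition coeff_mat :: "real poly mat \<Rightarrow> nat \<Rightarrow> real mat" where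
  "coeff_mat P k = map_mat (\<lambda>p. coeff p k) P"

text \<open>The \<open>s \<times> s\<close> matrix \<open>\<Sum>\<^sub>k w\<^sub>k M\<^sub>k\<close> for a family \<open>M\<close> with only finitely many nonzero members.\<close>

definition weighted_sum :: "nat \<Rightarrow> (nat \<Rightarrow> real) \<Rightarrow> (nat \<Rightarrow> real mat) \<Rightarrow> real mat" where
  "weighted_sum s w M =
     mat s s (\<lambda>(i, j). \<Sum>k | M k $$ (i, j) \<noteq> 0. w k * M k $$ (i, j))"

section \<open>Runge--Kutta methods\<close>

definition slow_base_method :: "nat \<Rightarrow> real mat \<Rightarrow> real vec \<Rightarrow> real vec \<Rightarrow> bool" where
  "slow_base_method s A b c \<longleftrightarrow>
     0 < s \<and> A \<in> carrier_mat s s \<and> b \<in> carrier_vec s \<and> c \<in> carrier_vec s \<and>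
     (\<forall>i<s. \<forall>j<s. i < j \<longrightarrow> A $$ (i, j) = 0) \<and>
     c = A *\<^sub>v ones s \<and>
     (\<forall>i<s. 0 \<le> c $ i \<and> c $ i \<le> 1) \<and> (\<forall>i j. i \<le> j \<and> j < s \<longrightarrow> c $ i \<le> c $ j) \<and>
     b = transpose_mat A *\<^sub>v unit_vec s (s - 1) \<and> c $ (s - 1) = 1"

text \<open>One step of size \<open>H\<close> from \<open>(t, y0)\<close> to \<open>y1\<close>, with stage values \<open>Y 1, \<dots>, Y s\<close>.\<close>

definition rk_step :: "nat \<Rightarrow> nat \<Rightarrow> real mat \<Rightarrow> real vec \<Rightarrow> real vec \<Rightarrow> vfield \<Rightarrow>
    real \<Rightarrow> real \<Rightarrow> state \<Rightarrow> (nat \<Rightarrow> state) \<Rightarrow> state \<Rightarrow> bool" where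
  "rk_step d s A b c f t H y0 Y y1 \<longleftrightarrow>
     (\<forall>i<s. Y (Suc i) \<in> R d \<and>
        (\<forall>m. Y (Suc i) m =
           y0 m + H * (\<Sum>j<s. A $$ (i, j) * f (t + c $ j * H) (Y (Suc j)) m))) \<and>
     (\<forall>m. y1 m = y0 m + H * (\<Sum>j<s. b $ j * f (t + c $ j * H) (Y (Suc j)) m))"

text \<open>
  Order at least \<open>p\<close>: for all sufficiently smooth right-hand sides, of any dimension, the local
  error is \<open>O(H\<^bsup>p+1\<^esup>)\<close>.  The stage equations are implicit and for small \<open>H\<close> may also have spurious
  solutions that are unbounded as \<open>H\<close> tends to 0; the radius \<open>r\<close> selects the solutions near \<open>y t0\<close>.
  For smooth \<open>f\<close> and small \<open>H\<close> such a solution exists by the implicit function theorem, so order is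
  stated only as a bound on every such step; the same applies to the IPC-MRI-GARK step below.
\<close>

definition rk_order_at_least :: "nat \<Rightarrow> real mat \<Rightarrow> real vec \<Rightarrow> real vec \<Rightarrow> nat \<Rightarrow> bool" where
  "rk_order_at_least s A b c p \<longleftrightarrow>
     (\<exists>q. \<forall>d f. smooth_field d q f \<longrightarrow>
        (\<forall>t0 h y. 0 < h \<and> solves_on d f y t0 (t0 + h) \<longrightarrow>
           (\<exists>r>0. \<exists>C. \<forall>\<^sub>F H in at_right 0. \<forall>Y y1.
              rk_step d s A b c f t0 H (y t0) Y y1 \<and>
              (\<forall>i\<in>{1..s}. norm_R d (\<lambda>m. Y i m - y t0 m) \<le> r) \<longrightarrow>
              norm_R d (\<lambda>m. y1 m - y (t0 + H) m) \<le> C * H ^ (p + 1))))"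

section \<open>IPC-MRI-GARK methods\<close>

definition coupling_coeffs :: "nat \<Rightarrow> real poly mat \<Rightarrow> real poly mat \<Rightarrow> bool" where
  "coupling_coeffs s \<gamma> \<psi> \<longleftrightarrow>
     \<gamma> \<in> carrier_mat s s \<and> \<psi> \<in> carrier_mat s s \<and>
     (\<forall>i<s. \<forall>j<s. (i \<le> j \<longrightarrow> \<gamma> $$ (i, j) = 0) \<and> (i < j \<longrightarrow> \<psi> $$ (i, j) = 0))"

definition internally_consistent ::
    "nat \<Rightarrow> real vec \<Rightarrow> real poly mat \<Rightarrow> real poly mat \<Rightarrow> bool" where
  "internally_consistent s c \<gamma> \<psi> \<longleftrightarrow>
     (coeff_mat \<psi> 0 + coeff_mat \<gamma> 0) *\<^sub>v ones s = delta c \<and>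
     (\<forall>k\<ge>1. (coeff_mat \<psi> k + coeff_mat \<gamma> k) *\<^sub>v ones s = 0\<^sub>v s)"

definition self_consistent ::
    "nat \<Rightarrow> real mat \<Rightarrow> real poly mat \<Rightarrow> real poly mat \<Rightarrow> bool" where
  "self_consistent s A \<gamma> \<psi> \<longleftrightarrow>
     strict_lower_part A =
       lower_ones s * weighted_sum s (\<lambda>k. 1 / (real k + 1)) (coeff_mat \<gamma>) \<and>
     diag_part A =
       lower_ones s * weighted_sum s (\<lambda>k. 1 / (real k + 1)) (coeff_mat \<psi>)"

text \<open>
  One step of size \<open>H\<close> from \<open>(t, y0)\<close>, with predictor stages \<open>Ystar 1, \<dots>, Ystar s\<close>, stages
  \<open>Y 0, \<dots>, Y s\<close> and exact solutions \<open>v 1, \<dots>, v s\<close> of the modified fast problems; the result of the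
  step is \<open>Y s\<close>.
\<close>

definition ipc_step :: "nat \<Rightarrow> nat \<Rightarrow> real mat \<Rightarrow> real vec \<Rightarrow> real poly mat \<Rightarrow> real poly mat \<Rightarrow>
    vfield \<Rightarrow> vfield \<Rightarrow> real \<Rightarrow> real \<Rightarrow> state \<Rightarrow>
    (nat \<Rightarrow> state) \<Rightarrow> (nat \<Rightarrow> state) \<Rightarrow> (nat \<Rightarrow> real \<Rightarrow> state) \<Rightarrow> bool" where
  "ipc_step d s A c \<gamma> \<psi> fF fS t H y0 Ystar Y v \<longleftrightarrow>
     (let T = (\<lambda>i. t + node c i * H);
          f = (\<lambda>\<tau> x m. fF \<tau> x m + fS \<tau> x m) in
      Y 0 = y0 \<and>
      (\<forall>i<s.
         Ystar (Suc i) \<in> R d \<and>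
         (\<forall>m. Ystar (Suc i) m =
            y0 m + H * (\<Sum>j<i. A $$ (i, j) * f (T (Suc j)) (Y (Suc j)) m)
                 + H * A $$ (i, i) * f (T (Suc i)) (Ystar (Suc i)) m) \<and>
         v (Suc i) 0 = Y i \<and>
         solves_on d
           (\<lambda>\<theta> x m. delta c $ i * fF (T i + delta c $ i * \<theta>) x m
              + (\<Sum>j<i. poly (\<gamma> $$ (i, j)) (\<theta> / H) * fS (T (Suc j)) (Y (Suc j)) m)
              + (\<Sum>j\<le>i. poly (\<psi> $$ (i, j)) (\<theta> / H) * fS (T (Suc j)) (Ystar (Suc j)) m))
           (v (Suc i)) 0 H \<and>
         Y (Suc i) = v (Suc i) H))"

definition ipc_order_at_least ::
    "nat \<Rightarrow> real mat \<Rightarrow> real vec \<Rightarrow> real poly mat \<Rightarrow> real poly mat \<Rightarrow> nat \<Rightarrow> bool" where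
  "ipc_order_at_least s A c \<gamma> \<psi> p \<longleftrightarrow>
     (\<exists>q. \<forall>d fF fS. smooth_field d q fF \<and> smooth_field d q fS \<longrightarrow>
        (\<forall>t0 h y. 0 < h \<and> solves_on d (\<lambda>t x m. fF t x m + fS t x m) y t0 (t0 + h) \<longrightarrow>
           (\<exists>r>0. \<exists>C. \<forall>\<^sub>F H in at_right 0. \<forall>Ystar Y v.
              ipc_step d s A c \<gamma> \<psi> fF fS t0 H (y t0) Ystar Y v \<and>
              (\<forall>i\<in>{1..s}. norm_R d (\<lambda>m. Ystar i m - y t0 m) \<le> r) \<longrightarrow>
              norm_R d (\<lambda>m. Y s m - y (t0 + H) m) \<le> C * H ^ (p + 1))))"

end

theory Submission
  imports Defs "HOL-Library.Landau_Symbols"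
begin

text \<open>
  Order conditions are tested on chains: words \<open>w\<close> whose letters \<open>(\<kappa>, p)\<close> stand for an equation
  \<open>x' = t\<^sup>p z\<close>, put into the fast or into the slow part according to \<open>\<kappa>\<close>, where \<open>z\<close> is the
  unknown of the rest of the word and \<open>z = 1\<close> for the empty word.  These systems are linear with
  monomial coefficients, so a step of the method from \<open>0\<close> can be written down exactly: the unknown of
  the whole word becomes \<open>H\<^bsup>|w|\<^esup>\<close> times a number, the weight of \<open>w\<close>, while the exact solution
  gives \<open>H\<^bsup>|w|\<^esup>\<close> times \<open>exact_weight w\<close>.  Order \<open>p\<close> therefore forces both numbers to agree for all
  chains with \<open>|w| \<le> p\<close> (\<open>ipc_order_imp_weights\<close>).

  Up to order four these conditions are also sufficient (\<open>weights_imp_ipc_order\<close>).  By internal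
  consistency every stage value is within \<open>O(H\<^sup>2)\<close> of the exact solution.  Replacing the two vector
  fields by their linearisations along the exact solution hence changes their values by \<open>O(H\<^sup>4)\<close> and
  the result of the step by \<open>O(H\<^sup>5)\<close>, and it does not change the exact solution at all.  In terms of
  rooted trees: up to order four a vertex carries at most one branch that is not a leaf, and a leaf is
  as good as a power of the time.  For the linearised problem, with its coefficients replaced by Taylor
  polynomials in time, Picard iteration expands both the numerical and the exact solution into sums
  over chains of \<open>H\<^bsup>|w|\<^esup>\<close>, the respective weight, and one common elementary vector (\<open>expands_Suc\<close>,
  \<open>exact_expansion\<close>); so the two agree up to \<open>O(H\<^sup>5)\<close> when the weights do.

  It remains to find the independent conditions among the chains of order at most four
  (\<open>chain_conditions_reduce\<close>).  A last letter with exponent 0 can be absorbed by increasing the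
  exponent before it.  Chains of fast letters are integrated exactly.  Chains of slow letters have
  the weights of the base method, because without a fast part self-consistency turns the step into a
  step of the base method.  The mixed chains that are left are the eleven coupling conditions, one
  for each chain, and the chain slow-fast-fast, whose condition follows from the quadrature
  conditions of the base method.
\<close>

section \<open>Antiderivatives of polynomials\<close>

text \<open>
  The antiderivative that vanishes at 0.
\<close>

definition antideriv :: "real poly \<Rightarrow> real poly" where
  "antideriv p = (\<Sum>k\<le>degree p. monom (coeff p k / (real k + 1)) (Suc k))"

lemma coeff_antideriv_0 [simp]: "coeff (antideriv p) 0 = 0"
  by (simp add: antideriv_def coeff_sum)

lemma coeff_antideriv_Suc [simp]: "coeff (antideriv p) (Suc k) = coeff p k / (real k + 1)"
proof -
  have "coeff (antideriv p) (Suc k) = (\<Sum>l\<le>degree p. if l = k then coeff p k / (real k + 1) else 0)"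
    unfolding antideriv_def coeff_sum by (intro sum.cong) auto
  also have "\<dots> = coeff p k / (real k + 1)"
    by (auto simp: coeff_eq_0)
  finally show ?thesis .
qed

lemma pderiv_antideriv [simp]: "pderiv (antideriv p) = p"
  by (rule poly_eqI) (simp add: coeff_pderiv field_simps)

lemma poly_antideriv_0 [simp]: "poly (antideriv p) 0 = 0"
  by (simp add: poly_0_coeff_0)

text \<open>
  Linearity and the closed forms below come from this characterisation.
\<close>

lemma antideriv_eqI: "pderiv q = p \<Longrightarrow> poly q 0 = 0 \<Longrightarrow> antideriv p = q"
proof (rule poly_eqI)
  fix n assume "pderiv q = p" "poly q 0 = 0"
  then show "coeff (antideriv p) n = coeff q n"
    by (cases n) (auto simp: coeff_pderiv poly_0_coeff_0 field_simps)
qed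

lemma antideriv_add: "antideriv (p + q) = antideriv p + antideriv q"
  by (rule antideriv_eqI) (simp_all add: pderiv_add)

lemma antideriv_smult: "antideriv (Polynomial.smult a p) = Polynomial.smult a (antideriv p)"
  by (rule antideriv_eqI) (simp_all add: pderiv_smult)

lemma antideriv_0 [simp]: "antideriv 0 = 0"
  by (rule antideriv_eqI) simp_all

lemma antideriv_sum: "antideriv (\<Sum>i\<in>I. f i) = (\<Sum>i\<in>I. antideriv (f i))"
  by (induction I rule: infinite_finite_induct) (simp_all add: antideriv_add)

lemma has_derivative_poly_scaled:
  assumes "H > 0"
  shows "((\<lambda>\<theta>. poly p (\<theta> / H)) has_real_derivative poly (pderiv p) (\<theta> / H) / H) (at \<theta> within S)"
  using assms by (auto intro!: derivative_eq_intros DERIV_chain2[OF poly_DERIV])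

lemma poly_1_eq_sum:
  fixes p :: "real poly"
  assumes "degree p \<le> N"
  shows "poly p 1 = (\<Sum>k\<le>N. coeff p k)"
  unfolding Polynomial.poly_altdef using assms
  by (auto intro!: sum.mono_neutral_left simp: coeff_eq_0 le_degree)

lemma degree_antideriv: "degree (antideriv p) \<le> Suc (degree p)"
proof (rule degree_le, intro allI impI)
  fix i assume "Suc (degree p) < i"
  then show "coeff (antideriv p) i = 0"
    by (cases i) (auto simp: coeff_eq_0)
qed

lemma poly_antideriv_1:
  assumes "degree p \<le> N"
  shows "poly (antideriv p) 1 = (\<Sum>k\<le>N. coeff p k / (real k + 1))"
proof -
  have "poly (antideriv p) 1 = (\<Sum>k\<le>Suc N. coeff (antideriv p) k)"
    using degree_antideriv[of p] assms by (intro poly_1_eq_sum) linarith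
  also have "\<dots> = (\<Sum>k\<le>N. coeff p k / (real k + 1))"
    by (subst sum.atMost_Suc_shift) simp
  finally show ?thesis .
qed

section \<open>Chains and their weights\<close>

datatype part = Fast | Slow

text \<open>
  The head of a chain belongs to the last unknown, its last letter to the unknown that is driven by the
  time alone.
\<close>

type_synonym chain = "(part \<times> nat) list"

definition chain_order :: "chain \<Rightarrow> nat" where
  "chain_order w = (\<Sum>a\<leftarrow>w. Suc (snd a))"

lemma chain_order_simps [simp]:
  "chain_order [] = 0" "chain_order (a # w) = Suc (snd a) + chain_order w"
  by (simp_all add: chain_order_def)

primrec exact_weight :: "chain \<Rightarrow> real" where
  "exact_weight [] = 1"
| "exact_weight (a # w) = exact_weight w / chain_order (a # w)"

locale ipc_method =
  fixes s :: nat and A :: "real mat" and b c :: "real vec" and \<gamma> \<psi> :: "real poly mat"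
  assumes base: "slow_base_method s A b c"
    and coeffs: "coupling_coeffs s \<gamma> \<psi>"
    and internal: "internally_consistent s c \<gamma> \<psi>"
    and self: "self_consistent s A \<gamma> \<psi>"
begin

text \<open>
  The right-hand side of the modified fast problem of stage \<open>Suc i\<close> for a new letter \<open>(\<kappa>, p)\<close>, in the
  scaled variable \<open>\<theta> / H\<close> and with all powers of \<open>H\<close> removed.  \<open>P\<close> and \<open>Q\<close> are the inner
  solutions and predictor stages of the remaining unknown.
\<close>

definition rate :: "part \<Rightarrow> nat \<Rightarrow> (nat \<Rightarrow> real poly) \<Rightarrow> (nat \<Rightarrow> real) \<Rightarrow> nat \<Rightarrow> real poly" where
  "rate \<kappa> p P Q i = (case \<kappa> of
     Fast \<Rightarrow> Polynomial.smult (delta c $ i) ([:node c i, delta c $ i:] ^ p * P i)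
   | Slow \<Rightarrow> (\<Sum>j<s. Polynomial.smult (c $ j ^ p * poly (P j) 1) (\<gamma> $$ (i, j)) + Polynomial.smult (c $ j ^ p * Q j) (\<psi> $$ (i, j))))"

text \<open>
  The pair of the inner solutions \<open>v\<^bsub>i+1\<^esub>\<close>, as polynomials in \<open>\<theta> / H\<close>, and of the predictor stages
  of the test problem, again without powers of \<open>H\<close>.  The value of the first component at 1 is a stage
  value; at the last stage it is the weight of the chain.
\<close>

primrec weights :: "chain \<Rightarrow> (nat \<Rightarrow> real poly) \<times> (nat \<Rightarrow> real)" where
  "weights [] = (\<lambda>i. 1, \<lambda>i. 1)"
| "weights (a # w) = (let V = fst (weights w); U = snd (weights w); R = rate (fst a) (snd a) V U in
     (\<lambda>i. [:\<Sum>l<i. poly (antideriv (R l)) 1:] + antideriv (R i),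
      \<lambda>i. (\<Sum>j<i. A $$ (i, j) * c $ j ^ snd a * poly (V j) 1) + A $$ (i, i) * c $ i ^ snd a * U i))"

abbreviation inner_weight ("V") where "V w \<equiv> fst (weights w)"
abbreviation pred_weight ("U") where "U w \<equiv> snd (weights w)"

lemma V_Cons: "V ((\<kappa>, p) # w) i =
  [:\<Sum>l<i. poly (antideriv (rate \<kappa> p (V w) (U w) l)) 1:] + antideriv (rate \<kappa> p (V w) (U w) i)"
  by (simp add: Let_def)

lemma U_Cons: "U ((\<kappa>, p) # w) i =
  (\<Sum>j<i. A $$ (i, j) * c $ j ^ p * poly (V w j) 1) + A $$ (i, i) * c $ i ^ p * U w i"
  by (simp add: Let_def)

lemma weights_Nil [simp]: "V [] i = 1" "U [] i = 1" by simp_all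

declare weights.simps [simp del]

lemma V_Cons_0: "poly (V ((\<kappa>, p) # w) i) 0 = (\<Sum>l<i. poly (antideriv (rate \<kappa> p (V w) (U w) l)) 1)"
  by (simp add: V_Cons)

lemma V_Cons_1: "poly (V ((\<kappa>, p) # w) i) 1 = (\<Sum>l<Suc i. poly (antideriv (rate \<kappa> p (V w) (U w) l)) 1)"
  by (simp add: V_Cons)

lemma pderiv_V_Cons: "pderiv (V ((\<kappa>, p) # w) i) = rate \<kappa> p (V w) (U w) i"
  by (simp add: V_Cons pderiv_add pderiv_pCons)

lemma s_pos: "0 < s" and A_dim: "A \<in> carrier_mat s s" and c_dim: "c \<in> carrier_vec s"
  and b_dim: "b \<in> carrier_vec s" and c_last: "c $ (s - 1) = 1"
  using base by (auto simp: slow_base_method_def)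

lemma dims [simp]: "dim_row A = s" "dim_col A = s" "dim_vec c = s" "dim_vec b = s"
  using A_dim c_dim b_dim by auto

lemma A_upper: "i < j \<Longrightarrow> j < s \<Longrightarrow> A $$ (i, j) = 0"
  using base by (auto simp: slow_base_method_def)

lemma c_bounds: "i < s \<Longrightarrow> 0 \<le> c $ i" "i < s \<Longrightarrow> c $ i \<le> 1"
  using base by (auto simp: slow_base_method_def)

lemma c_mono: "i \<le> j \<Longrightarrow> j < s \<Longrightarrow> c $ i \<le> c $ j"
  using base unfolding slow_base_method_def by blast

lemma b_eq: "j < s \<Longrightarrow> b $ j = A $$ (s - 1, j)"
proof -
  assume j: "j < s"
  have "b = transpose_mat A *\<^sub>v unit_vec s (s - 1)" using base by (auto simp: slow_base_method_def)
  then have "b $ j = (transpose_mat A *\<^sub>v unit_vec s (s - 1)) $ j" by simp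
  then show ?thesis using j s_pos A_dim by (simp add: scalar_prod_right_unit)
qed

lemma \<gamma>_dim [simp]: "dim_row \<gamma> = s" "dim_col \<gamma> = s" and \<psi>_dim [simp]: "dim_row \<psi> = s" "dim_col \<psi> = s"
  using coeffs by (auto simp: coupling_coeffs_def)

lemma \<gamma>_upper: "i \<le> j \<Longrightarrow> j < s \<Longrightarrow> \<gamma> $$ (i, j) = 0"
  and \<psi>_upper: "i < j \<Longrightarrow> j < s \<Longrightarrow> \<psi> $$ (i, j) = 0"
  using coeffs by (auto simp: coupling_coeffs_def)

lemma node_simps [simp]: "node c 0 = 0" "node c (Suc i) = c $ i"
  by (simp_all add: node_def)

lemma delta_eq: "i < s \<Longrightarrow> delta c $ i = c $ i - node c i"
  by (simp add: delta_def)

lemma node_bounds: "i < s \<Longrightarrow> 0 \<le> node c i" "i < s \<Longrightarrow> node c i \<le> c $ i"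
  by (cases i; simp add: c_bounds c_mono)+

text \<open>
  Internal consistency for all powers of \<open>\<theta>\<close> at once: constant slow forcing acts as constant fast
  forcing would.
\<close>

lemma coupling_row_sum:
  assumes "i < s"
  shows "(\<Sum>j<s. \<gamma> $$ (i, j) + \<psi> $$ (i, j)) = [:delta c $ i:]"
proof (rule poly_eqI)
  fix k
  have *: "((coeff_mat \<psi> k + coeff_mat \<gamma> k) *\<^sub>v ones s) $ i = (\<Sum>j<s. coeff (\<gamma> $$ (i, j)) k + coeff (\<psi> $$ (i, j)) k)"
    using assms by (simp add: scalar_prod_def coeff_mat_def ones_def lessThan_atLeast0 add.commute)
  show "coeff (\<Sum>j<s. \<gamma> $$ (i, j) + \<psi> $$ (i, j)) k = coeff [:delta c $ i:] k"
    using internal assms * unfolding internally_consistent_def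
    by (cases k) (auto simp: coeff_sum)
qed

lemma sum_nonzero_coeffs:
  fixes f :: "nat \<Rightarrow> real"
  assumes "degree p \<le> N"
  shows "(\<Sum>k | coeff p k \<noteq> 0. f k * coeff p k) = (\<Sum>k\<le>N. f k * coeff p k)"
  by (rule sum.mono_neutral_left) (use assms le_degree in \<open>force+\<close>)

lemma antideriv_weighted:
  "(\<Sum>k | coeff p k \<noteq> 0. 1 / (real k + 1) * coeff p k) = poly (antideriv p) 1"
  by (subst sum_nonzero_coeffs[OF order_refl]) (simp add: poly_antideriv_1[OF order_refl])

lemma self_entry:
  assumes "P \<in> carrier_mat s s" "i < s" "j < s"
  shows "(lower_ones s * weighted_sum s (\<lambda>k. 1 / (real k + 1)) (coeff_mat P)) $$ (i, j) =
    (\<Sum>l<Suc i. poly (antideriv (P $$ (l, j))) 1)"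
proof -
  have "(lower_ones s * weighted_sum s (\<lambda>k. 1 / (real k + 1)) (coeff_mat P)) $$ (i, j) =
    (\<Sum>l<s. (if l \<le> i then 1 else 0) * poly (antideriv (P $$ (l, j))) 1)"
    using assms by (auto simp: scalar_prod_def lower_ones_def weighted_sum_def coeff_mat_def
       lessThan_atLeast0 antideriv_weighted[simplified] intro!: sum.cong)
  also have "\<dots> = (\<Sum>l<Suc i. poly (antideriv (P $$ (l, j))) 1)"
    using assms by (intro sum.mono_neutral_cong_right) auto
  finally show ?thesis .
qed

lemma \<gamma>_self: "i < s \<Longrightarrow> j < s \<Longrightarrow>
    (\<Sum>l<Suc i. poly (antideriv (\<gamma> $$ (l, j))) 1) = (if j < i then A $$ (i, j) else 0)"
  and \<psi>_self: "i < s \<Longrightarrow> j < s \<Longrightarrow>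
    (\<Sum>l<Suc i. poly (antideriv (\<psi> $$ (l, j))) 1) = (if i = j then A $$ (i, j) else 0)"
proof -
  assume *: "i < s" "j < s"
  have c: "\<gamma> \<in> carrier_mat s s" "\<psi> \<in> carrier_mat s s"
    using coeffs by (auto simp: coupling_coeffs_def)
  have "strict_lower_part A $$ (i, j) =
      (lower_ones s * weighted_sum s (\<lambda>k. 1 / (real k + 1)) (coeff_mat \<gamma>)) $$ (i, j)"
    "diag_part A $$ (i, j) =
      (lower_ones s * weighted_sum s (\<lambda>k. 1 / (real k + 1)) (coeff_mat \<psi>)) $$ (i, j)"
    using self by (simp_all only: self_consistent_def)
  then show "(\<Sum>l<Suc i. poly (antideriv (\<gamma> $$ (l, j))) 1) = (if j < i then A $$ (i, j) else 0)"
    "(\<Sum>l<Suc i. poly (antideriv (\<psi> $$ (l, j))) 1) = (if i = j then A $$ (i, j) else 0)"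
    unfolding self_entry[OF c(1) *] self_entry[OF c(2) *] using *
    by (simp_all only: strict_lower_part_def diag_part_def dims index_mat split_conv)
qed

lemma A_row_split: "i < s \<Longrightarrow> (\<Sum>j<s. A $$ (i, j) * f j) = (\<Sum>j<i. A $$ (i, j) * f j) + A $$ (i, i) * f i"
  for f :: "nat \<Rightarrow> real"
proof -
  assume "i < s"
  then have "(\<Sum>j<s. A $$ (i, j) * f j) = (\<Sum>j<Suc i. A $$ (i, j) * f j)"
    by (intro sum.mono_neutral_right) (auto simp: A_upper)
  then show ?thesis by simp
qed

text \<open>
  Self-consistency in the form in which it is used: accumulated over the stages, the couplings integrate
  to the row of the base method, with the predictor value on the diagonal.
\<close>

lemma slow_row_sum:
  assumes "i < s"
  shows "(\<Sum>l<Suc i. \<Sum>j<s. poly (antideriv (\<gamma> $$ (l, j))) 1 * f j + poly (antideriv (\<psi> $$ (l, j))) 1 * g j)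
    = (\<Sum>j<i. A $$ (i, j) * f j) + A $$ (i, i) * g i"
proof -
  have "(\<Sum>l<Suc i. \<Sum>j<s. poly (antideriv (\<gamma> $$ (l, j))) 1 * f j + poly (antideriv (\<psi> $$ (l, j))) 1 * g j)
    = (\<Sum>j<s. (\<Sum>l<Suc i. poly (antideriv (\<gamma> $$ (l, j))) 1) * f j + (\<Sum>l<Suc i. poly (antideriv (\<psi> $$ (l, j))) 1) * g j)"
    by (subst sum.swap) (simp only: sum.distrib sum_distrib_right)
  also have "\<dots> = (\<Sum>j<s. (if j < i then A $$ (i, j) else 0) * f j + (if i = j then A $$ (i, j) else 0) * g j)"
    by (intro sum.cong refl) (use assms in \<open>simp only: \<gamma>_self \<psi>_self lessThan_iff\<close>)
  also have "\<dots> = (\<Sum>j<s. if j < i then A $$ (i, j) * f j else 0) + (\<Sum>j<s. if i = j then A $$ (i, j) * g j else 0)"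
    unfolding sum.distrib[symmetric] by (intro sum.cong) auto
  also have "(\<Sum>j<s. if j < i then A $$ (i, j) * f j else 0) = (\<Sum>j<i. A $$ (i, j) * f j)"
    using assms by (intro sum.mono_neutral_cong_right) auto
  also have "(\<Sum>j<s. if i = j then A $$ (i, j) * g j else 0) = A $$ (i, i) * g i"
    using assms by simp
  finally show ?thesis .
qed

lemma poly_antideriv_rate_Slow: "poly (antideriv (rate Slow p P Q l)) t =
  (\<Sum>j<s. poly (antideriv (\<gamma> $$ (l, j))) t * (c $ j ^ p * poly (P j) 1) +
    poly (antideriv (\<psi> $$ (l, j))) t * (c $ j ^ p * Q j))"
  by (simp add: rate_def antideriv_sum antideriv_add antideriv_smult poly_sum mult.commute)

text \<open>
  Both sides are the same combination of stage values, so a predictor stage carries a letter of either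
  colour in the way in which a stage carries a slow one.
\<close>

lemma V_Slow_1:
  assumes "i < s"
  shows "poly (V ((Slow, p) # w) i) 1 = U ((\<kappa>, p) # w) i"
  using slow_row_sum[OF assms]
  by (simp only: V_Cons_1 poly_antideriv_rate_Slow U_Cons mult.assoc)

end

section \<open>Necessity of the chain conditions\<close>

lemma topspace_R: "R d = {x. \<forall>m\<ge>d. x m = 0}"
  by (rule topspace_Euclidean_space)

abbreviation time_space :: "nat \<Rightarrow> (real \<times> state) topology" where
  "time_space d \<equiv> prod_topology euclideanreal (Euclidean_space d)"

lemma continuous_map_coordinate:
  assumes "l < d"
  shows "continuous_map (time_space d) euclideanreal (\<lambda>(t, x). x l)"
proof -
  have "continuous_map (Euclidean_space d) euclideanreal (\<lambda>x. x l)"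
    unfolding Euclidean_space_def
    by (intro continuous_map_from_subtopology continuous_map_product_projection) simp
  then have "continuous_map (time_space d) euclideanreal ((\<lambda>x. x l) \<circ> snd)"
    by (rule continuous_map_compose[OF continuous_map_snd])
  then show ?thesis by (simp add: comp_def case_prod_unfold)
qed

text \<open>
  The fields of the test problems have components \<open>t\<^sup>p\<close> and \<open>t\<^sup>p x\<^sub>l\<close>, and these two families
  are closed under partial derivatives.
\<close>

lemma C_k_monomial:
  "C_k d q (\<lambda>t x. a * t ^ p)"
proof (induction q arbitrary: a p)
  case 0
  show ?case
    by (simp add: case_prod_unfold)
      (intro continuous_intros continuous_map_fst[of euclideanreal "Euclidean_space d"])
next
  case (Suc q)
  have "continuous_map (time_space d) euclideanreal (\<lambda>(t, x). a * t ^ p)"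
    by (simp add: case_prod_unfold)
      (intro continuous_intros continuous_map_fst[of euclideanreal "Euclidean_space d"])
  moreover have "((\<lambda>\<tau>. a * \<tau> ^ p) has_real_derivative (a * real p) * t ^ (p - 1)) (at t)" for t
    by (auto intro!: derivative_eq_intros)
  moreover have "C_k d q (\<lambda>t x. (a * real p) * t ^ (p - 1))" by (rule Suc)
  moreover have "C_k d q (\<lambda>t x. 0 * t ^ 0)" by (rule Suc)
  ultimately show ?case
    by (auto intro!: exI[where P = "\<lambda>g. C_k d q g \<and> (\<forall>t. \<forall>x\<in>R d. (_ has_real_derivative g t x) (at t))", of "\<lambda>t x. (a * real p) * t ^ (p - 1)"]
        exI[where P = "\<lambda>g. C_k d q g \<and> (\<forall>t. \<forall>x\<in>R d. (_ has_real_derivative g t x) (at (x _)))", of "\<lambda>t x. 0"])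
qed

lemma C_k_monomial_coordinate:
  assumes "l < d"
  shows "C_k d q (\<lambda>t x. a * t ^ p * x l)"
proof (induction q arbitrary: a p)
  case 0
  show ?case
    using continuous_map_coordinate[OF assms]
    by (simp add: case_prod_unfold)
      (intro continuous_intros continuous_map_fst[of euclideanreal "Euclidean_space d"])
next
  case (Suc q)
  have "continuous_map (time_space d) euclideanreal (\<lambda>(t, x). a * t ^ p * x l)"
    using continuous_map_coordinate[OF assms]
    by (simp add: case_prod_unfold)
      (intro continuous_intros continuous_map_fst[of euclideanreal "Euclidean_space d"])
  moreover have "((\<lambda>\<tau>. a * \<tau> ^ p * x l) has_real_derivative (a * real p) * t ^ (p - 1) * x l) (at t)" for t x
    by (auto intro!: derivative_eq_intros)
  moreover have "C_k d q (\<lambda>t x. (a * real p) * t ^ (p - 1) * x l)" by (rule Suc)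
  moreover have "\<exists>g'. C_k d q g' \<and> (\<forall>t. \<forall>x\<in>R d.
    ((\<lambda>u. a * t ^ p * (x(m := u)) l) has_real_derivative g' t x) (at (x m)))" if "m < d" for m
  proof (cases "m = l")
    case True
    then show ?thesis using C_k_monomial[of d q a p]
      by (intro exI[of _ "\<lambda>t x. a * t ^ p"]) (auto intro!: derivative_eq_intros)
  next
    case False
    then show ?thesis using C_k_monomial[of d q 0 0]
      by (intro exI[of _ "\<lambda>t x. 0"]) (auto intro!: derivative_eq_intros)
  qed
  ultimately show ?case
    by (auto intro!: exI[of _ "\<lambda>t x. (a * real p) * t ^ (p - 1) * x l"])
qed

text \<open>
  Component \<open>m\<close> of the test problem belongs to the suffix of length \<open>m + 1\<close>, so that each component
  is driven by its predecessor.
\<close>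

definition suffix_of :: "chain \<Rightarrow> nat \<Rightarrow> chain" where
  "suffix_of w m = rev (take m (rev w))"

lemma suffix_of_simps [simp]:
  "suffix_of w 0 = []"
  "m < length w \<Longrightarrow> suffix_of w (Suc m) = rev w ! m # suffix_of w m"
  "suffix_of w (length w) = w"
  by (simp_all add: suffix_of_def take_Suc_conv_app_nth)

text \<open>
  The predicate selects the colours, so that this is the fast, the slow, or the complete right-hand side.
\<close>

definition chain_field :: "chain \<Rightarrow> (part \<Rightarrow> bool) \<Rightarrow> vfield" where
  "chain_field w P t x m =
     (if m < length w \<and> P (fst (rev w ! m))
      then t ^ snd (rev w ! m) * (if m = 0 then 1 else x (m - 1)) else 0)"

lemma smooth_chain_field: "smooth_field (length w) q (chain_field w P)"
  unfolding smooth_field_def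
proof (intro conjI allI ballI impI)
  fix t x show "chain_field w P t x \<in> R (length w)"
    by (auto simp: topspace_R chain_field_def)
next
  fix m assume "m < length w"
  then show "C_k (length w) q (\<lambda>t x. chain_field w P t x m)"
    using C_k_monomial[of "length w" q 0 0] C_k_monomial[of "length w" q 1 "snd (rev w ! m)"]
      C_k_monomial_coordinate[of "m - 1" "length w" q 1 "snd (rev w ! m)"]
    by (cases "P (fst (rev w ! m))"; cases "m = 0") (auto simp: chain_field_def)
qed

text \<open>
  With the exact weights for \<open>\<Phi>\<close> this is the exact solution, with the weights of a stage it is the stage
  value.
\<close>

definition chain_state :: "chain \<Rightarrow> (chain \<Rightarrow> real) \<Rightarrow> real \<Rightarrow> state" where
  "chain_state w \<Phi> H m =
     (if m < length w then H ^ chain_order (suffix_of w (Suc m)) * \<Phi> (suffix_of w (Suc m)) else 0)"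

lemma chain_state_R [simp]: "chain_state w \<Phi> H \<in> R (length w)"
  by (simp add: topspace_R chain_state_def)

lemma chain_state_0: "chain_state w \<Phi> 0 m = 0"
  by (simp add: chain_state_def)

lemma chain_field_state:
  assumes "\<Phi> [] = 1" "m < length w"
  shows "chain_field w P t (chain_state w \<Phi> H) m =
    (if P (fst (rev w ! m)) then t ^ snd (rev w ! m) * (H ^ chain_order (suffix_of w m) * \<Phi> (suffix_of w m)) else 0)"
  using assms by (cases m) (auto simp: chain_field_def chain_state_def)

lemma tendsto_norm_chain_state:
  "((\<lambda>H. norm_R (length w) (chain_state w \<Phi> H)) \<longlongrightarrow> 0) (at_right 0)"
proof -
  have "((\<lambda>H. chain_state w \<Phi> H m) \<longlongrightarrow> 0) (at_right 0)" for m
  proof (cases "m < length w")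
    case True
    have "((\<lambda>H::real. H ^ chain_order (suffix_of w (Suc m)) * \<Phi> (suffix_of w (Suc m))) \<longlongrightarrow> 0 ^ chain_order (suffix_of w (Suc m)) * \<Phi> (suffix_of w (Suc m))) (at_right 0)"
      by (intro tendsto_intros)
    then show ?thesis using True by (simp add: chain_state_def)
  qed (simp add: chain_state_def)
  then have "((\<lambda>H. norm_R (length w) (chain_state w \<Phi> H)) \<longlongrightarrow> sqrt (\<Sum>m<length w. 0\<^sup>2)) (at_right 0)"
    unfolding L2_set_def by (intro tendsto_intros)
  then show ?thesis by simp
qed

lemma solves_chain:
  "solves_on (length w) (chain_field w (\<lambda>_. True)) (chain_state w exact_weight) a a'"
  unfolding solves_on_def
proof (intro ballI conjI allI)
  fix t m
  show "((\<lambda>\<tau>. chain_state w exact_weight \<tau> m) has_real_derivative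
          chain_field w (\<lambda>_. True) t (chain_state w exact_weight t) m) (at t within {a..a'})"
  proof (cases "m < length w")
    case True
    define p where "p = snd (rev w ! m)"
    define u where "u = suffix_of w m"
    have "((\<lambda>\<tau>. \<tau> ^ (Suc (p + chain_order u)) * (exact_weight u / (Suc (p + chain_order u)))) has_real_derivative
        t ^ p * (t ^ chain_order u * exact_weight u)) (at t within {a..a'})"
      by (rule derivative_eq_intros refl)+ (simp add: power_add)
    then show ?thesis
      using True by (simp add: chain_field_state chain_state_def p_def u_def)
  qed (simp add: chain_field_def chain_state_def)
qed simp

lemma abs_le_norm_R: "m < d \<Longrightarrow> \<bar>x m\<bar> \<le> norm_R d x"
proof -
  assume "m < d"
  then have "x m \<le> norm_R d x" "- x m \<le> norm_R d (\<lambda>m. - x m)"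
    by (auto intro: member_le_L2_set)
  moreover have "norm_R d (\<lambda>m. - x m) = norm_R d x" by (simp add: L2_set_def)
  ultimately show ?thesis by linarith
qed

text \<open>
  Dividing by \<open>H\<^sup>N\<close> leaves a constant that is \<open>O(H)\<close>.
\<close>

lemma order_coefficient_zero:
  assumes ev: "\<forall>\<^sub>F H in at_right (0::real). \<bar>H ^ N * a\<bar> \<le> C * H ^ (p + 1)" and "N \<le> p"
  shows "a = 0"
proof -
  have "\<forall>\<^sub>F H in at_right (0::real). \<bar>a\<bar> \<le> \<bar>C\<bar> * H"
    using ev eventually_at_right_less[of 0] eventually_at_right_real[of 0 1, simplified]
  proof eventually_elim
    case (elim H)
    then have H: "0 < H" "H < 1" by auto
    have "H ^ N * \<bar>a\<bar> \<le> C * H ^ (p + 1)" using elim H by (simp add: abs_mult)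
    also have "\<dots> \<le> \<bar>C\<bar> * H ^ (p + 1)" using H by (intro mult_right_mono) auto
    also have "\<dots> \<le> \<bar>C\<bar> * H ^ (N + 1)" using H assms(2) by (intro mult_left_mono power_decreasing) auto
    finally show ?case using H by (simp add: mult.commute mult.left_commute)
  qed
  moreover have "((\<lambda>H. \<bar>C\<bar> * H) \<longlongrightarrow> \<bar>C\<bar> * 0) (at_right 0)" by (intro tendsto_intros)
  ultimately have "\<bar>a\<bar> \<le> \<bar>C\<bar> * 0"
    by (intro tendsto_le[OF _ _ tendsto_const]) auto
  then show ?thesis by simp
qed

text \<open>
  The radius in the notions of order does not exclude the steps constructed for the test problems.
\<close>

lemma eventually_chain_states_small:
  assumes "r > 0" and "finite I"
  shows "\<forall>\<^sub>F H in at_right 0. \<forall>i\<in>I. norm_R (length w) (\<lambda>m. chain_state w (\<Phi> i) H m - chain_state w \<Phi>' 0 m) \<le> r"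
  using assms(2)
proof (rule eventually_ball_finite, intro ballI)
  fix i
  have "\<forall>\<^sub>F H in at_right 0. norm_R (length w) (chain_state w (\<Phi> i) H) < r"
    using order_tendstoD(2)[OF tendsto_norm_chain_state assms(1)] .
  then show "\<forall>\<^sub>F H in at_right 0. norm_R (length w) (\<lambda>m. chain_state w (\<Phi> i) H m - chain_state w \<Phi>' 0 m) \<le> r"
    by eventually_elim (simp add: chain_state_0 less_imp_le)
qed

lemma chain_state_error:
  assumes "w \<noteq> []" "norm_R (length w) (\<lambda>m. chain_state w \<Phi> H m - chain_state w \<Phi>' H m) \<le> e"
  shows "\<bar>H ^ chain_order w * (\<Phi> w - \<Phi>' w)\<bar> \<le> e"
proof -
  have "Suc (length w - 1) = length w" using assms(1) by (cases w) auto
  then show ?thesis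
    using order_trans[OF abs_le_norm_R assms(2), of "length w - 1"] assms(1)
    unfolding chain_state_def by (simp add: right_diff_distrib del: suffix_of_simps(2))
qed

context ipc_method
begin

lemma slow_forcing_sum:
  assumes "i < s"
  shows "(\<Sum>j<i. poly (\<gamma> $$ (i, j)) t * f j) + (\<Sum>j\<le>i. poly (\<psi> $$ (i, j)) t * g j)
    = (\<Sum>j<s. poly (\<gamma> $$ (i, j)) t * f j + poly (\<psi> $$ (i, j)) t * g j)"
  unfolding sum.distrib using assms
  by (intro arg_cong2[of _ _ _ _ "(+)"] sum.mono_neutral_left) (auto simp: \<gamma>_upper \<psi>_upper)

text \<open>
  Without a fast part the inner problems are quadratures.  By self-consistency they reproduce the
  stages of the base method, and the predictor equations are then satisfied by the same stages.
\<close>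

lemma rk_step_imp_ipc_step:
  assumes step: "rk_step d s A b c f t0 H y0 Y y1" and H: "0 < H" and y0: "y0 \<in> R d"
    and f: "\<And>t x. x \<in> R d \<Longrightarrow> f t x \<in> R d"
  shows "\<exists>v. ipc_step d s A c \<gamma> \<psi> (\<lambda>_ _ _. 0) f t0 H y0 Y (Y(0 := y0)) v \<and> Y s = y1"
proof -
  define Y' where "Y' = Y(0 := y0)"
  define g where "g j m = f (t0 + c $ j * H) (Y (Suc j)) m" for j m
  \<comment> \<open>The inner problem has a right-hand side that depends on time only; this is its antiderivative.\<close>
  define v where "v k \<theta> m = (case k of 0 \<Rightarrow> 0 | Suc i \<Rightarrow> Y' i m + H * (\<Sum>j<s.
      poly (antideriv (\<gamma> $$ (i, j))) (\<theta> / H) * g j m + poly (antideriv (\<psi> $$ (i, j))) (\<theta> / H) * g j m))" for k \<theta> m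
  have YR: "Y (Suc i) \<in> R d" if "i < s" for i
    using step that by (auto simp: rk_step_def)
  have gR: "g j m = 0" if "j < s" "m \<ge> d" for j m
    using f[OF YR[OF that(1)]] that by (auto simp: topspace_R g_def)
  have Y: "Y (Suc i) m = y0 m + H * ((\<Sum>j<i. A $$ (i, j) * g j m) + A $$ (i, i) * g i m)" if "i < s" for i m
    using step that by (simp add: rk_step_def g_def A_row_split)
  have Y': "Y' i m = y0 m + H * (\<Sum>l<i. \<Sum>j<s. poly (antideriv (\<gamma> $$ (l, j))) 1 * g j m +
      poly (antideriv (\<psi> $$ (l, j))) 1 * g j m)" if "i \<le> s" for i m
  proof (cases i)
    case (Suc k)
    then have k: "k < s" using that by simp
    show ?thesis unfolding Suc slow_row_sum[OF k] using Y[OF k] by (simp add: Y'_def)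
  qed (simp add: Y'_def)
  have Y'R: "Y' i \<in> R d" if "i \<le> s" for i
    using YR y0 that by (cases i) (auto simp: Y'_def)
  have vR: "v (Suc i) \<theta> \<in> R d" if "i < s" for i \<theta>
    using Y'R[of i] gR that unfolding v_def topspace_R by simp
  have vd: "((\<lambda>\<theta>. v (Suc i) \<theta> m) has_real_derivative
      (\<Sum>j<s. poly (\<gamma> $$ (i, j)) (\<theta> / H) * g j m + poly (\<psi> $$ (i, j)) (\<theta> / H) * g j m)) (at \<theta> within S)"
    for i m \<theta> S
  proof -
    have D: "((\<lambda>\<theta>. poly (antideriv p) (\<theta> / H)) has_real_derivative poly p (\<theta> / H) / H) (at \<theta> within S)" for p
      using has_derivative_poly_scaled[OF H, of "antideriv p"] by simp
    have "((\<lambda>\<theta>. Y' i m + H * (\<Sum>j<s. poly (antideriv (\<gamma> $$ (i, j))) (\<theta> / H) * g j m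
        + poly (antideriv (\<psi> $$ (i, j))) (\<theta> / H) * g j m)) has_real_derivative
        0 + H * (\<Sum>j<s. poly (\<gamma> $$ (i, j)) (\<theta> / H) / H * g j m + poly (\<psi> $$ (i, j)) (\<theta> / H) / H * g j m))
        (at \<theta> within S)"
      by (intro DERIV_add DERIV_const DERIV_cmult DERIV_sum DERIV_cmult_right D)
    then show ?thesis
      using H by (simp add: v_def sum_distrib_left distrib_left)
  qed
  have vH: "v (Suc i) H = Y' (Suc i)" if "i < s" for i
  proof
    fix m show "v (Suc i) H m = Y' (Suc i) m"
      using Y'[of i m] Y'[of "Suc i" m] H that by (simp add: v_def algebra_simps)
  qed
  have "ipc_step d s A c \<gamma> \<psi> (\<lambda>_ _ _. 0) f t0 H y0 Y Y' v"
    unfolding ipc_step_def Let_def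
  proof (intro conjI allI impI)
    show "Y' 0 = y0" by (simp add: Y'_def)
  next
    fix i m assume i: "i < s"
    show "Y (Suc i) \<in> R d" by (rule YR[OF i])
    show "Y (Suc i) m = y0 m + H * (\<Sum>j<i. A $$ (i, j) * (0 + f (t0 + node c (Suc j) * H) (Y' (Suc j)) m))
       + H * A $$ (i, i) * (0 + f (t0 + node c (Suc i) * H) (Y (Suc i)) m)"
      using Y[OF i] by (simp add: g_def Y'_def algebra_simps)
    show "v (Suc i) 0 = Y' i" by (rule ext) (simp add: v_def)
    show "Y' (Suc i) = v (Suc i) H" using vH[OF i] by simp
    have rhs: "(\<lambda>\<theta> x m. delta c $ i * 0 +
         (\<Sum>j<i. poly (\<gamma> $$ (i, j)) (\<theta> / H) * f (t0 + node c (Suc j) * H) (Y' (Suc j)) m) +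
         (\<Sum>j\<le>i. poly (\<psi> $$ (i, j)) (\<theta> / H) * f (t0 + node c (Suc j) * H) (Y (Suc j)) m)) =
      (\<lambda>\<theta> x m. \<Sum>j<s. poly (\<gamma> $$ (i, j)) (\<theta> / H) * g j m + poly (\<psi> $$ (i, j)) (\<theta> / H) * g j m)"
      by (simp add: slow_forcing_sum[OF i] g_def Y'_def)
    show "solves_on d (\<lambda>\<theta> x m. delta c $ i * 0 +
         (\<Sum>j<i. poly (\<gamma> $$ (i, j)) (\<theta> / H) * f (t0 + node c (Suc j) * H) (Y' (Suc j)) m) +
         (\<Sum>j\<le>i. poly (\<psi> $$ (i, j)) (\<theta> / H) * f (t0 + node c (Suc j) * H) (Y (Suc j)) m)) (v (Suc i)) 0 H"
      unfolding rhs solves_on_def using vR[OF i] vd by blast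
  qed
  moreover have "Y s m = y1 m" for m
  proof -
    have "y1 m = y0 m + H * (\<Sum>j<s. A $$ (s - 1, j) * g j m)"
      using step by (simp add: rk_step_def g_def b_eq)
    moreover have "Y (Suc (s - 1)) m = y0 m + H * (\<Sum>j<s. A $$ (s - 1, j) * g j m)"
    proof -
      have "s - 1 < s" using s_pos by simp
      then show ?thesis using step unfolding rk_step_def g_def by blast
    qed
    ultimately show ?thesis using s_pos by simp
  qed
  ultimately show ?thesis unfolding Y'_def by blast
qed

definition ipc_error where
  "ipc_error d fF fS t0 y p \<longleftrightarrow> (\<exists>r>0. \<exists>C. \<forall>\<^sub>F H in at_right 0. \<forall>Ystar Y v.
      ipc_step d s A c \<gamma> \<psi> fF fS t0 H (y t0) Ystar Y v \<and>
      (\<forall>i\<in>{1..s}. norm_R d (\<lambda>m. Ystar i m - y t0 m) \<le> r) \<longrightarrow>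
      norm_R d (\<lambda>m. Y s m - y (t0 + H) m) \<le> C * H ^ (p + 1))"

definition rk_error where
  "rk_error d f t0 y p \<longleftrightarrow> (\<exists>r>0. \<exists>C. \<forall>\<^sub>F H in at_right 0. \<forall>Y y1.
      rk_step d s A b c f t0 H (y t0) Y y1 \<and>
      (\<forall>i\<in>{1..s}. norm_R d (\<lambda>m. Y i m - y t0 m) \<le> r) \<longrightarrow>
      norm_R d (\<lambda>m. y1 m - y (t0 + H) m) \<le> C * H ^ (p + 1))"

lemma ipc_orderE:
  assumes "ipc_order_at_least s A c \<gamma> \<psi> p"
  obtains q where "\<And>d fF fS t0 h y. smooth_field d q fF \<Longrightarrow> smooth_field d q fS \<Longrightarrow> 0 < h \<Longrightarrow>
    solves_on d (\<lambda>t x m. fF t x m + fS t x m) y t0 (t0 + h) \<Longrightarrow> ipc_error d fF fS t0 y p"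
  using assms unfolding ipc_order_at_least_def ipc_error_def[symmetric] by blast

lemma rk_orderE:
  assumes "rk_order_at_least s A b c p"
  obtains q where "\<And>d f t0 h y. smooth_field d q f \<Longrightarrow> 0 < h \<Longrightarrow> solves_on d f y t0 (t0 + h) \<Longrightarrow>
    rk_error d f t0 y p"
  using assms unfolding rk_order_at_least_def rk_error_def[symmetric] by blast

text \<open>
  This is the case \<open>f\<^sup>F = 0\<close>.
\<close>

lemma ipc_order_imp_rk_order:
  assumes "ipc_order_at_least s A c \<gamma> \<psi> p"
  shows "rk_order_at_least s A b c p"
proof -
  obtain q where q: "\<And>d fF fS t0 h y. smooth_field d q fF \<Longrightarrow> smooth_field d q fS \<Longrightarrow> 0 < h \<Longrightarrow>
      solves_on d (\<lambda>t x m. fF t x m + fS t x m) y t0 (t0 + h) \<Longrightarrow> ipc_error d fF fS t0 y p"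
    using assms by (rule ipc_orderE) blast
  have "rk_error d f t0 y p"
    if f: "smooth_field d q f" and h: "0 < h" and sol: "solves_on d f y t0 (t0 + h)" for d f t0 h y
  proof -
    have smooth0: "smooth_field d q (\<lambda>_ _ _. 0)"
      using C_k_monomial[of d q 0 0] by (simp add: smooth_field_def topspace_R)
    have "ipc_error d (\<lambda>_ _ _. 0) f t0 y p"
      using q[OF smooth0 f h, of y t0, simplified add_0] sol by blast
    then obtain r C where r: "r > 0" and C: "\<forall>\<^sub>F H in at_right 0. \<forall>Ystar Y v.
        ipc_step d s A c \<gamma> \<psi> (\<lambda>_ _ _. 0) f t0 H (y t0) Ystar Y v \<and>
        (\<forall>i\<in>{1..s}. norm_R d (\<lambda>m. Ystar i m - y t0 m) \<le> r) \<longrightarrow>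
        norm_R d (\<lambda>m. Y s m - y (t0 + H) m) \<le> C * H ^ (p + 1)"
      unfolding ipc_error_def by blast
    have y0: "y t0 \<in> R d" using sol h by (auto simp: solves_on_def)
    have "\<forall>\<^sub>F H in at_right 0. \<forall>Y y1. rk_step d s A b c f t0 H (y t0) Y y1 \<and>
        (\<forall>i\<in>{1..s}. norm_R d (\<lambda>m. Y i m - y t0 m) \<le> r) \<longrightarrow>
        norm_R d (\<lambda>m. y1 m - y (t0 + H) m) \<le> C * H ^ (p + 1)"
      using C eventually_at_right_less[of 0]
    proof eventually_elim
      case (elim H)
      show ?case
      proof (intro allI impI)
        fix Y y1 assume *: "rk_step d s A b c f t0 H (y t0) Y y1 \<and> (\<forall>i\<in>{1..s}. norm_R d (\<lambda>m. Y i m - y t0 m) \<le> r)"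
        obtain v where v: "ipc_step d s A c \<gamma> \<psi> (\<lambda>_ _ _. 0) f t0 H (y t0) Y (Y(0 := y t0)) v" "Y s = y1"
          using rk_step_imp_ipc_step[OF conjunct1[OF *] elim(2) y0] f by (auto simp: smooth_field_def)
        have "(Y(0 := y t0)) s = y1" using v(2) s_pos by simp
        then show "norm_R d (\<lambda>m. y1 m - y (t0 + H) m) \<le> C * H ^ (p + 1)"
          using mp[OF spec[OF spec[OF spec[OF elim(1)]]], OF conjI[OF v(1) conjunct2[OF *]]] by simp
      qed
    qed
    then show ?thesis unfolding rk_error_def using r by blast
  qed
  then show ?thesis unfolding rk_order_at_least_def rk_error_def[symmetric] by blast
qed

text \<open>
  The recursion of the weights is the step itself after cancelling powers of \<open>H\<close>: the letter
  \<open>(\<kappa>, p)\<close> contributes \<open>H\<^sup>p\<close> through \<open>t\<^sup>p\<close> and one more factor by integration.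
\<close>

lemma chain_ipc_step:
  assumes H: "0 < H"
  shows "\<exists>v. ipc_step (length w) s A c \<gamma> \<psi> (chain_field w (\<lambda>\<kappa>. \<kappa> = Fast)) (chain_field w (\<lambda>\<kappa>. \<kappa> = Slow)) 0 H
    (chain_state w exact_weight 0)
    (\<lambda>k. chain_state w (\<lambda>u. U u (k - 1)) H)
    (\<lambda>k. case k of 0 \<Rightarrow> chain_state w exact_weight 0 | Suc i \<Rightarrow> chain_state w (\<lambda>u. poly (V u i) 1) H) v"
proof -
  define Y where "Y = (\<lambda>k. case k of 0 \<Rightarrow> chain_state w exact_weight 0 | Suc i \<Rightarrow> chain_state w (\<lambda>u. poly (V u i) 1) H)"
  define v where "v k \<theta> = (case k of 0 \<Rightarrow> (\<lambda>_. 0) | Suc i \<Rightarrow> chain_state w (\<lambda>u. poly (V u i) (\<theta> / H)) H)" for k \<theta>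
  let ?F = "chain_field w (\<lambda>\<kappa>. \<kappa> = Fast)" and ?S = "chain_field w (\<lambda>\<kappa>. \<kappa> = Slow)"
  have sum_field: "?F t x m + ?S t x m = chain_field w (\<lambda>_. True) t x m" for t x m
    by (cases "fst (rev w ! m)") (auto simp: chain_field_def)
  have v0: "v (Suc i) 0 = Y i" for i
  proof
    fix m show "v (Suc i) 0 m = Y i m"
    proof (cases "m < length w")
      case True
      obtain \<kappa> p where "rev w ! m = (\<kappa>, p)" by force
      then show ?thesis using True
        by (cases i) (auto simp: v_def Y_def chain_state_def V_Cons_0 V_Cons_1 chain_state_0)
    qed (auto simp: v_def Y_def chain_state_def split: nat.split)
  qed
  have vd: "((\<lambda>\<theta>. v (Suc i) \<theta> m) has_real_derivative delta c $ i * ?F (0 + node c i * H + delta c $ i * \<theta>) (v (Suc i) \<theta>) m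
      + (\<Sum>j<i. poly (\<gamma> $$ (i, j)) (\<theta> / H) * ?S (0 + node c (Suc j) * H) (Y (Suc j)) m)
      + (\<Sum>j\<le>i. poly (\<psi> $$ (i, j)) (\<theta> / H) * ?S (0 + node c (Suc j) * H) (chain_state w (\<lambda>u. U u (Suc j - 1)) H) m))
     (at \<theta> within {0..H})" (is "(_ has_real_derivative ?D) _") if i: "i < s" for i \<theta> m
  proof (cases "m < length w")
    case True
    obtain \<kappa> p where a: "rev w ! m = (\<kappa>, p)" by force
    define u where "u = suffix_of w m"
    have Suc: "suffix_of w (Suc m) = (\<kappa>, p) # u" using True a by (simp add: u_def)
    have "((\<lambda>\<theta>. H ^ Suc (p + chain_order u) * poly (V ((\<kappa>, p) # u) i) (\<theta> / H)) has_real_derivative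
       H ^ Suc (p + chain_order u) * (poly (rate \<kappa> p (V u) (U u) i) (\<theta> / H) / H)) (at \<theta> within {0..H})"
      by (rule derivative_eq_intros has_derivative_poly_scaled[OF H, of "V ((\<kappa>, p) # u) i", unfolded pderiv_V_Cons] refl)+ simp
    also have "H ^ Suc (p + chain_order u) * (poly (rate \<kappa> p (V u) (U u) i) (\<theta> / H) / H) =
       H ^ (p + chain_order u) * poly (rate \<kappa> p (V u) (U u) i) (\<theta> / H)"
      using H by simp
    also have "\<dots> = ?D"
    proof (cases \<kappa>)
      case Fast
      have "(H * node c i + \<theta> * delta c $ i) = H * (node c i + delta c $ i * \<theta> / H)"
        using H by (simp add: field_simps)
      then show ?thesis using True a Fast H
        by (simp add: slow_forcing_sum[OF i] v_def Y_def chain_field_state u_def rate_def power_add poly_power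
          power_mult_distrib mult_ac)
    next
      case Slow
      show ?thesis using True a Slow H
        by (simp add: slow_forcing_sum[OF i] v_def Y_def chain_field_state u_def rate_def power_add poly_sum
            power_mult_distrib sum_distrib_left)
          (simp add: distrib_left mult_ac)
    qed
    finally show ?thesis using True Suc by (simp add: v_def chain_state_def)
  qed (simp add: v_def chain_state_def chain_field_def)
  have "ipc_step (length w) s A c \<gamma> \<psi> ?F ?S 0 H (chain_state w exact_weight 0)
    (\<lambda>k. chain_state w (\<lambda>u. U u (k - 1)) H) Y v"
    unfolding ipc_step_def Let_def sum_field
  proof (intro conjI allI impI)
    show "Y 0 = chain_state w exact_weight 0" by (simp add: Y_def)
  next
    fix i m assume i: "i < s"
    show "chain_state w (\<lambda>u. U u (Suc i - 1)) H \<in> R (length w)" by simp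
    show "chain_state w (\<lambda>u. U u (Suc i - 1)) H m = chain_state w exact_weight 0 m
      + H * (\<Sum>j<i. A $$ (i, j) * chain_field w (\<lambda>_. True) (0 + node c (Suc j) * H) (Y (Suc j)) m)
      + H * A $$ (i, i) * chain_field w (\<lambda>_. True) (0 + node c (Suc i) * H) (chain_state w (\<lambda>u. U u (Suc i - 1)) H) m"
    proof (cases "m < length w")
      case True
      obtain \<kappa> p where a: "rev w ! m = (\<kappa>, p)" by force
      then show ?thesis using True
        by (simp add: chain_state_0 chain_field_state Y_def U_Cons sum_distrib_left
          chain_state_def[of w "\<lambda>u. U u i"] power_add power_mult_distrib algebra_simps)
    qed (simp add: chain_state_def chain_field_def)
    show "v (Suc i) 0 = Y i" by (rule v0)
    show "Y (Suc i) = v (Suc i) H" using H by (simp add: Y_def v_def)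
    show "solves_on (length w) (\<lambda>\<theta> x m. delta c $ i * ?F (0 + node c i * H + delta c $ i * \<theta>) x m +
         (\<Sum>j<i. poly (\<gamma> $$ (i, j)) (\<theta> / H) * ?S (0 + node c (Suc j) * H) (Y (Suc j)) m) +
         (\<Sum>j\<le>i. poly (\<psi> $$ (i, j)) (\<theta> / H) * ?S (0 + node c (Suc j) * H) (chain_state w (\<lambda>u. U u (Suc j - 1)) H) m)) (v (Suc i)) 0 H"
      unfolding solves_on_def using vd[OF i] by (simp add: v_def)
  qed
  then show ?thesis unfolding Y_def by blast
qed

text \<open>
  The local error of the test problem is \<open>H\<^bsup>|w|\<^esup>\<close> times the difference of the two weights.
\<close>

theorem ipc_order_imp_weights:
  assumes order: "ipc_order_at_least s A c \<gamma> \<psi> p" and w: "w \<noteq> []" "chain_order w \<le> p"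
  shows "poly (V w (s - 1)) 1 = exact_weight w"
proof -
  let ?F = "chain_field w (\<lambda>\<kappa>. \<kappa> = Fast)" and ?S = "chain_field w (\<lambda>\<kappa>. \<kappa> = Slow)"
  let ?y = "chain_state w exact_weight"
  have sum_field: "(\<lambda>t x m. ?F t x m + ?S t x m) = chain_field w (\<lambda>_. True)"
  proof (intro ext)
    fix t x m show "?F t x m + ?S t x m = chain_field w (\<lambda>_. True) t x m"
      by (cases "fst (rev w ! m)") (auto simp: chain_field_def)
  qed
  obtain q where q: "\<And>d fF fS t0 h y. smooth_field d q fF \<Longrightarrow> smooth_field d q fS \<Longrightarrow> 0 < h \<Longrightarrow>
      solves_on d (\<lambda>t x m. fF t x m + fS t x m) y t0 (t0 + h) \<Longrightarrow> ipc_error d fF fS t0 y p"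
    using order by (rule ipc_orderE) blast
  have "(0::real) < 1" by simp
  from q[OF smooth_chain_field smooth_chain_field this, of w "\<lambda>\<kappa>. \<kappa> = Fast" "\<lambda>\<kappa>. \<kappa> = Slow" ?y 0,
      unfolded sum_field, OF solves_chain]
  obtain r C where r: "r > 0" and C: "\<forall>\<^sub>F H in at_right 0. \<forall>Ystar Y v.
      ipc_step (length w) s A c \<gamma> \<psi> ?F ?S 0 H (?y 0) Ystar Y v \<and>
      (\<forall>i\<in>{1..s}. norm_R (length w) (\<lambda>m. Ystar i m - ?y 0 m) \<le> r) \<longrightarrow>
      norm_R (length w) (\<lambda>m. Y s m - ?y (0 + H) m) \<le> C * H ^ (p + 1)"
    unfolding ipc_error_def by blast
  have "\<forall>\<^sub>F H in at_right 0. \<bar>H ^ chain_order w * (poly (V w (s - 1)) 1 - exact_weight w)\<bar> \<le> C * H ^ (p + 1)"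
    using C eventually_at_right_less[of 0]
      eventually_chain_states_small[OF r, of "{1..s}" w "\<lambda>k u. U u (k - 1)" exact_weight, OF finite_atLeastAtMost]
  proof eventually_elim
    case (elim H)
    obtain i where i: "s = Suc i" using s_pos by (cases s) auto
    have "norm_R (length w) (\<lambda>m. chain_state w (\<lambda>u. poly (V u (s - 1)) 1) H m - ?y H m) \<le> C * H ^ (p + 1)"
    proof -
      obtain v where v: "ipc_step (length w) s A c \<gamma> \<psi> ?F ?S 0 H (?y 0) (\<lambda>k. chain_state w (\<lambda>u. U u (k - 1)) H)
          (\<lambda>k. case k of 0 \<Rightarrow> ?y 0 | Suc i \<Rightarrow> chain_state w (\<lambda>u. poly (V u i) 1) H) v"
        using chain_ipc_step[OF elim(2)] by blast
      show ?thesis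
        using mp[OF spec[OF spec[OF spec[OF elim(1)]]], OF conjI[OF v elim(3)]] by (simp add: i)
    qed
    from chain_state_error[OF w(1) this] show ?case .
  qed
  from order_coefficient_zero[OF this w(2)] show ?thesis by simp
qed

text \<open>
  The weights of the base method, for which colours make no difference.
\<close>

primrec rk_weight :: "chain \<Rightarrow> nat \<Rightarrow> real" where
  "rk_weight [] i = 1"
| "rk_weight (a # w) i = (\<Sum>j<s. A $$ (i, j) * (c $ j ^ snd a * rk_weight w j))"

text \<open>
  For slow chains stage and predictor stage coincide by induction, and both then satisfy the recursion of
  the base method.
\<close>

lemma slow_weights:
  assumes "\<forall>a\<in>set w. fst a = Slow" "i < s"
  shows "poly (V w i) 1 = rk_weight w i \<and> U w i = rk_weight w i"
  using assms
proof (induction w arbitrary: i)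
  case (Cons a w)
  obtain p where a: "a = (Slow, p)" using Cons.prems by (cases a) auto
  have "U (a # w) i = rk_weight (a # w) i"
    using Cons by (simp add: a U_Cons A_row_split mult.assoc)
  then show ?case using V_Slow_1[OF Cons.prems(2), of p w Slow] a by simp
qed simp

lemma chain_rk_step:
  shows "rk_step (length w) s A b c (chain_field w (\<lambda>_. True)) 0 H (chain_state w exact_weight 0)
    (\<lambda>k. chain_state w (\<lambda>u. rk_weight u (k - 1)) H) (chain_state w (\<lambda>u. rk_weight u (s - 1)) H)"
proof -
  have *: "chain_state w (\<lambda>u. rk_weight u i) H m =
    H * (\<Sum>j<s. A $$ (i, j) * chain_field w (\<lambda>_. True) (0 + c $ j * H) (chain_state w (\<lambda>u. rk_weight u j) H) m)" for i m
    by (cases "m < length w")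
      (simp_all add: chain_field_state chain_state_def[of w "\<lambda>u. rk_weight u i"] sum_distrib_left
        power_add power_mult_distrib algebra_simps, simp_all add: chain_field_def)
  show ?thesis
    unfolding rk_step_def chain_state_0 add_0_left
  proof (intro conjI allI impI)
    fix i m
    show "chain_state w (\<lambda>u. rk_weight u (Suc i - 1)) H \<in> R (length w)" by simp
    show "chain_state w (\<lambda>u. rk_weight u (Suc i - 1)) H m = H * (\<Sum>j<s. A $$ (i, j) *
        chain_field w (\<lambda>_. True) (c $ j * H) (chain_state w (\<lambda>u. rk_weight u (Suc j - 1)) H) m)"
      using *[of i m] by simp
    show "chain_state w (\<lambda>u. rk_weight u (s - 1)) H m = H * (\<Sum>j<s. b $ j *
        chain_field w (\<lambda>_. True) (c $ j * H) (chain_state w (\<lambda>u. rk_weight u (Suc j - 1)) H) m)"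
      using *[of "s - 1" m] by (simp add: b_eq)
  qed
qed

theorem rk_order_imp_weights:
  assumes order: "rk_order_at_least s A b c p" and w: "w \<noteq> []" "chain_order w \<le> p"
  shows "rk_weight w (s - 1) = exact_weight w"
proof -
  let ?f = "chain_field w (\<lambda>_. True)" and ?y = "chain_state w exact_weight"
  obtain q where q: "\<And>d f t0 h y. smooth_field d q f \<Longrightarrow> 0 < h \<Longrightarrow> solves_on d f y t0 (t0 + h) \<Longrightarrow> rk_error d f t0 y p"
    using order by (rule rk_orderE) blast
  have "(0::real) < 1" by simp
  from q[OF smooth_chain_field this solves_chain, of w 0]
  obtain r C where r: "r > 0" and C: "\<forall>\<^sub>F H in at_right 0. \<forall>Y y1.
      rk_step (length w) s A b c ?f 0 H (?y 0) Y y1 \<and>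
      (\<forall>i\<in>{1..s}. norm_R (length w) (\<lambda>m. Y i m - ?y 0 m) \<le> r) \<longrightarrow>
      norm_R (length w) (\<lambda>m. y1 m - ?y (0 + H) m) \<le> C * H ^ (p + 1)"
    unfolding rk_error_def by blast
  have "\<forall>\<^sub>F H in at_right 0. \<bar>H ^ chain_order w * (rk_weight w (s - 1) - exact_weight w)\<bar> \<le> C * H ^ (p + 1)"
    using C eventually_chain_states_small[OF r, of "{1..s}" w "\<lambda>k u. rk_weight u (k - 1)" exact_weight, OF finite_atLeastAtMost]
  proof eventually_elim
    case (elim H)
    have "norm_R (length w) (\<lambda>m. chain_state w (\<lambda>u. rk_weight u (s - 1)) H m - ?y H m) \<le> C * H ^ (p + 1)"
      using mp[OF spec[OF spec[OF elim(1)]], OF conjI[OF chain_rk_step elim(2)]] by simp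
    from chain_state_error[OF w(1) this] show ?case .
  qed
  from order_coefficient_zero[OF this w(2)] show ?thesis by simp
qed

lemma rate_Nil: "i < s \<Longrightarrow> rate \<kappa> 0 (V []) (U []) i = [:delta c $ i:]"
  using coupling_row_sum[of i] by (cases \<kappa>) (simp_all add: rate_def)

lemma antideriv_const: "antideriv [:a:] = [:0, a:]"
  by (rule antideriv_eqI) (simp_all add: pderiv_pCons)

lemma sum_delta: "i \<le> s \<Longrightarrow> (\<Sum>l<i. delta c $ l) = node c i"
  by (induction i) (auto simp: delta_eq)

text \<open>
  By internal consistency a last letter with exponent 0 acts as the time itself, for either colour.
\<close>

lemma V_leaf:
  assumes "i < s"
  shows "V [(\<kappa>, 0)] i = [:node c i, delta c $ i:]"
proof -
  have "(\<Sum>l<i. poly (antideriv (rate \<kappa> 0 (V []) (U []) l)) 1) = (\<Sum>l<i. delta c $ l)"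
    using assms by (intro sum.cong) (auto simp: rate_Nil antideriv_const simp del: weights_Nil)
  then show ?thesis
    using assms by (simp add: V_Cons rate_Nil antideriv_const sum_delta del: weights_Nil)
qed

lemma U_leaf: "i < s \<Longrightarrow> U [(\<kappa>, 0)] i = c $ i"
  using V_Slow_1[of i 0 "[]" \<kappa>] by (simp add: V_leaf delta_eq)

end

section \<open>Calculus along a solution\<close>

lemma C_k_continuous:
  "C_k d q g \<Longrightarrow> continuous_map (time_space d) euclideanreal (\<lambda>(t, x). g t x)"
  by (cases q) auto

lemma C_k_SucE:
  assumes "C_k d (Suc q) g"
  obtains g' where "C_k d q g'" "\<And>t x. x \<in> R d \<Longrightarrow> ((\<lambda>\<tau>. g \<tau> x) has_real_derivative g' t x) (at t)"
  using assms by auto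

lemma C_k_Suc_partialsE:
  assumes "C_k d (Suc q) g"
  obtains D where "\<And>m. m < d \<Longrightarrow> C_k d q (D m)"
    "\<And>m t x. m < d \<Longrightarrow> x \<in> R d \<Longrightarrow> ((\<lambda>u. g t (x(m := u))) has_real_derivative D m t x) (at (x m))"
proof -
  have "\<forall>m<d. \<exists>g'. C_k d q g' \<and>
        (\<forall>t. \<forall>x\<in>R d. ((\<lambda>u. g t (x(m := u))) has_real_derivative g' t x) (at (x m)))"
    using assms by simp
  then have "\<forall>m. \<exists>g'. m < d \<longrightarrow> C_k d q g' \<and>
        (\<forall>t. \<forall>x\<in>R d. ((\<lambda>u. g t (x(m := u))) has_real_derivative g' t x) (at (x m)))"
    by blast
  from choice[OF this] show ?thesis using that by blast
qed

lemma C_k_SucI: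
  assumes "C_k d q g" "C_k d q g'" "\<And>t x. x \<in> R d \<Longrightarrow> ((\<lambda>\<tau>. g \<tau> x) has_real_derivative g' t x) (at t)"
    "\<And>m. m < d \<Longrightarrow> C_k d q (D m)"
    "\<And>m t x. m < d \<Longrightarrow> x \<in> R d \<Longrightarrow> ((\<lambda>u. g t (x(m := u))) has_real_derivative D m t x) (at (x m))"
  shows "C_k d (Suc q) g"
  using C_k_continuous[OF assms(1)] assms(2-) by (simp only: C_k.simps) blast

lemma C_k_SucD: "C_k d (Suc q) g \<Longrightarrow> C_k d q g"
proof (induction q arbitrary: g)
  case (Suc q)
  obtain g' where g': "C_k d (Suc q) g'" "\<And>t x. x \<in> R d \<Longrightarrow> ((\<lambda>\<tau>. g \<tau> x) has_real_derivative g' t x) (at t)"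
    using Suc.prems by (rule C_k_SucE) blast
  obtain D where D: "\<And>m. m < d \<Longrightarrow> C_k d (Suc q) (D m)"
    "\<And>m t x. m < d \<Longrightarrow> x \<in> R d \<Longrightarrow> ((\<lambda>u. g t (x(m := u))) has_real_derivative D m t x) (at (x m))"
    using Suc.prems by (rule C_k_Suc_partialsE) blast
  show ?case
    unfolding C_k.simps(2)[of d q g]
    using C_k_continuous[OF Suc.prems] Suc.IH[OF g'(1)] g'(2) Suc.IH[OF D(1)] D(2) by blast
qed simp

lemma C_k_le: "C_k d q g \<Longrightarrow> q' \<le> q \<Longrightarrow> C_k d q' g"
  by (induction q) (auto simp: le_Suc_eq simp del: C_k.simps dest: C_k_SucD)

lemma C_k_const [intro]: "C_k d q (\<lambda>_ _. a)"
  using C_k_monomial[of d q a 0] by simp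

lemma C_k_coord: "l < d \<Longrightarrow> C_k d q (\<lambda>t x. x l)"
  using C_k_monomial_coordinate[of l d q 1 0] by simp

lemma C_k_add: "C_k d q g \<Longrightarrow> C_k d q k \<Longrightarrow> C_k d q (\<lambda>t x. g t x + k t x)"
proof (induction q arbitrary: g k)
  case 0
  then have "continuous_map (time_space d) euclideanreal (\<lambda>z. (case z of (t, x) \<Rightarrow> g t x) + (case z of (t, x) \<Rightarrow> k t x))"
    by (intro continuous_map_add) auto
  then show ?case by (simp add: case_prod_unfold)
next
  case (Suc q)
  obtain g' where g': "C_k d q g'" "\<And>t x. x \<in> R d \<Longrightarrow> ((\<lambda>\<tau>. g \<tau> x) has_real_derivative g' t x) (at t)"
    using Suc.prems(1) by (rule C_k_SucE) blast
  obtain D where D: "\<And>m. m < d \<Longrightarrow> C_k d q (D m)"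
    "\<And>m t x. m < d \<Longrightarrow> x \<in> R d \<Longrightarrow> ((\<lambda>u. g t (x(m := u))) has_real_derivative D m t x) (at (x m))"
    using Suc.prems(1) by (rule C_k_Suc_partialsE) blast
  obtain k' where k': "C_k d q k'" "\<And>t x. x \<in> R d \<Longrightarrow> ((\<lambda>\<tau>. k \<tau> x) has_real_derivative k' t x) (at t)"
    using Suc.prems(2) by (rule C_k_SucE) blast
  obtain E where E: "\<And>m. m < d \<Longrightarrow> C_k d q (E m)"
    "\<And>m t x. m < d \<Longrightarrow> x \<in> R d \<Longrightarrow> ((\<lambda>u. k t (x(m := u))) has_real_derivative E m t x) (at (x m))"
    using Suc.prems(2) by (rule C_k_Suc_partialsE) blast
  show ?case
    by (rule C_k_SucI[where g' = "\<lambda>t x. g' t x + k' t x" and D = "\<lambda>m t x. D m t x + E m t x"])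
      (auto intro!: Suc.IH DERIV_add g' k' D E C_k_SucD[OF Suc.prems(1)] C_k_SucD[OF Suc.prems(2)]
        simp del: fun_upd_apply)
qed

lemma C_k_mult: "C_k d q g \<Longrightarrow> C_k d q k \<Longrightarrow> C_k d q (\<lambda>t x. g t x * k t x)"
proof (induction q arbitrary: g k)
  case 0
  then have "continuous_map (time_space d) euclideanreal (\<lambda>z. (case z of (t, x) \<Rightarrow> g t x) * (case z of (t, x) \<Rightarrow> k t x))"
    by (intro continuous_map_real_mult) auto
  then show ?case by (simp add: case_prod_unfold)
next
  case (Suc q)
  obtain g' where g': "C_k d q g'" "\<And>t x. x \<in> R d \<Longrightarrow> ((\<lambda>\<tau>. g \<tau> x) has_real_derivative g' t x) (at t)"
    using Suc.prems(1) by (rule C_k_SucE) blast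
  obtain D where D: "\<And>m. m < d \<Longrightarrow> C_k d q (D m)"
    "\<And>m t x. m < d \<Longrightarrow> x \<in> R d \<Longrightarrow> ((\<lambda>u. g t (x(m := u))) has_real_derivative D m t x) (at (x m))"
    using Suc.prems(1) by (rule C_k_Suc_partialsE) blast
  obtain k' where k': "C_k d q k'" "\<And>t x. x \<in> R d \<Longrightarrow> ((\<lambda>\<tau>. k \<tau> x) has_real_derivative k' t x) (at t)"
    using Suc.prems(2) by (rule C_k_SucE) blast
  obtain E where E: "\<And>m. m < d \<Longrightarrow> C_k d q (E m)"
    "\<And>m t x. m < d \<Longrightarrow> x \<in> R d \<Longrightarrow> ((\<lambda>u. k t (x(m := u))) has_real_derivative E m t x) (at (x m))"
    using Suc.prems(2) by (rule C_k_Suc_partialsE) blast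
  note g = C_k_SucD[OF Suc.prems(1)] and k = C_k_SucD[OF Suc.prems(2)]
  show ?case
  proof (rule C_k_SucI[where g' = "\<lambda>t x. g' t x * k t x + k' t x * g t x"
        and D = "\<lambda>m t x. D m t x * k t x + E m t x * g t x"])
    fix m t x assume m: "m < d" and x: "x \<in> R d"
    show "((\<lambda>u. g t (x(m := u)) * k t (x(m := u))) has_real_derivative
        D m t x * k t x + E m t x * g t x) (at (x m))"
      using DERIV_mult[OF D(2)[OF m x] E(2)[OF m x], of t t] by simp
  qed (auto intro!: Suc.IH C_k_add DERIV_mult g' k' D E g k)
qed

lemma C_k_sum: "(\<And>i. i \<in> I \<Longrightarrow> C_k d q (g i)) \<Longrightarrow> C_k d q (\<lambda>t x. \<Sum>i\<in>I. g i t x)"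
  by (induction I rule: infinite_finite_induct) (auto intro!: C_k_add)

lemma C_k_minus: "C_k d q g \<Longrightarrow> C_k d q k \<Longrightarrow> C_k d q (\<lambda>t x. g t x - k t x)"
  using C_k_add[OF _ C_k_mult[OF C_k_const[of d q "-1"]], of g k] by simp

text \<open>
  A neighbourhood in the product topology restricts finitely many coordinates only; the coordinates from
  \<open>d\<close> on vanish, so it contains a cube in the remaining ones.
\<close>

lemma R_Euclidean_delta:
  assumes cont: "continuous_map (time_space d) euclideanreal (\<lambda>(t, x). g t x)"
    and x0: "x0 \<in> R d" and e: "e > 0"
  obtains \<delta> where "\<delta> > 0" "\<And>t x. \<bar>t - t0\<bar> < \<delta> \<Longrightarrow> x \<in> R d \<Longrightarrow> (\<And>m. m < d \<Longrightarrow> \<bar>x m - x0 m\<bar> < \<delta>) \<Longrightarrow>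
    \<bar>g t x - g t0 x0\<bar> < e"
proof -
  define W where "W = {z \<in> topspace (time_space d). (case z of (t, x) \<Rightarrow> g t x) \<in> ball (g t0 x0) e}"
  have "openin (time_space d) W"
    unfolding W_def by (rule openin_continuous_map_preimage[OF cont]) simp
  moreover have "(t0, x0) \<in> W" using x0 e by (simp add: W_def)
  ultimately obtain T0 V where T0: "open T0" "t0 \<in> T0" and V: "openin (Euclidean_space d) V" "x0 \<in> V" and sub: "T0 \<times> V \<subseteq> W"
    unfolding openin_prod_topology_alt by force
  obtain V' where V': "openin (powertop_real UNIV) V'" "V = V' \<inter> {x. \<forall>i\<ge>d. x i = 0}"
    using V(1) unfolding Euclidean_space_def openin_subtopology by blast
  obtain B where B: "\<And>i. openin euclideanreal (B i)" "x0 \<in> Pi\<^sub>E UNIV B" "Pi\<^sub>E UNIV B \<subseteq> V'"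
    using V'(1) V(2) V'(2) unfolding openin_product_topology_alt by (metis IntD1 UNIV_I)
  have "\<forall>i. \<exists>\<delta>>0. \<forall>u. \<bar>u - x0 i\<bar> < \<delta> \<longrightarrow> u \<in> B i"
  proof
    fix i
    have "open (B i)" "x0 i \<in> B i" using B by auto
    then show "\<exists>\<delta>>0. \<forall>u. \<bar>u - x0 i\<bar> < \<delta> \<longrightarrow> u \<in> B i"
      unfolding open_dist dist_real_def by blast
  qed
  then obtain \<Delta> where \<Delta>: "\<And>i. \<Delta> i > 0" "\<And>i u. \<bar>u - x0 i\<bar> < \<Delta> i \<Longrightarrow> u \<in> B i" by metis
  obtain \<delta>0 where \<delta>0: "\<delta>0 > 0" "\<And>t. \<bar>t - t0\<bar> < \<delta>0 \<Longrightarrow> t \<in> T0"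
    using T0 unfolding open_dist dist_real_def by blast
  define \<delta> where "\<delta> = Min (insert \<delta>0 (\<Delta> ` {..<d}))"
  have \<delta>: "\<delta> \<le> \<delta>0" "\<And>m. m < d \<Longrightarrow> \<delta> \<le> \<Delta> m" "\<delta> > 0"
    using \<delta>0(1) \<Delta>(1) unfolding \<delta>_def by (auto simp: Min_le_iff)
  show ?thesis
  proof (rule that[OF \<delta>(3)])
    fix t x assume *: "\<bar>t - t0\<bar> < \<delta>" "x \<in> R d" "\<And>m. m < d \<Longrightarrow> \<bar>x m - x0 m\<bar> < \<delta>"
    have "x i \<in> B i" for i
    proof (cases "i < d")
      case True
      then show ?thesis using \<Delta>(2)[of "x i" i] *(3)[of i] \<delta>(2)[of i] by linarith
    next
      case False
      then have "x i = x0 i" using *(2) x0 by (simp add: topspace_R)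
      then show ?thesis using \<Delta>(1)[of i] \<Delta>(2)[of "x i" i] by simp
    qed
    then have "x \<in> V" using B(3) *(2) unfolding V'(2) by (auto simp: topspace_R)
    moreover have "t \<in> T0" using \<delta>0(2) *(1) \<delta>(1) by simp
    ultimately have "(t, x) \<in> W" using sub by blast
    then show "\<bar>g t x - g t0 x0\<bar> < e" by (simp add: W_def dist_real_def abs_minus_commute)
  qed
qed

lemma C_k_tendsto:
  assumes g: "C_k d q g" and x0: "x0 \<in> R d" and T: "(T \<longlongrightarrow> t0) F"
    and X: "\<And>m. m < d \<Longrightarrow> ((\<lambda>\<omega>. X \<omega> m) \<longlongrightarrow> x0 m) F" and XR: "\<forall>\<^sub>F \<omega> in F. X \<omega> \<in> R d"
  shows "((\<lambda>\<omega>. g (T \<omega>) (X \<omega>)) \<longlongrightarrow> g t0 x0) F"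
proof (rule tendstoI)
  fix e :: real assume "e > 0"
  then obtain \<delta> where \<delta>: "\<delta> > 0" "\<And>t x. \<bar>t - t0\<bar> < \<delta> \<Longrightarrow> x \<in> R d \<Longrightarrow> (\<And>m. m < d \<Longrightarrow> \<bar>x m - x0 m\<bar> < \<delta>) \<Longrightarrow>
    \<bar>g t x - g t0 x0\<bar> < e"
    using R_Euclidean_delta[OF C_k_continuous[OF g] x0] by blast
  have "\<forall>\<^sub>F \<omega> in F. \<forall>m\<in>{..<d}. dist (X \<omega> m) (x0 m) < \<delta>"
    using X \<delta>(1) by (intro eventually_ball_finite ballI tendstoD) auto
  with tendstoD[OF T \<delta>(1)] XR show "\<forall>\<^sub>F \<omega> in F. dist (g (T \<omega>) (X \<omega>)) (g t0 x0) < e"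
    by eventually_elim (auto simp: dist_real_def intro!: \<delta>(2))
qed

lemma mvt_symmetric:
  fixes \<phi> :: "real \<Rightarrow> real"
  assumes "\<And>u. (\<phi> has_real_derivative \<phi>' u) (at u)"
  shows "\<exists>\<eta>. \<bar>\<eta> - a\<bar> \<le> \<bar>b - a\<bar> \<and> \<phi> b - \<phi> a = (b - a) * \<phi>' \<eta>"
proof (cases a b rule: linorder_cases)
  case less
  from MVT2[OF this assms] obtain z where "a < z" "z < b" "\<phi> b - \<phi> a = (b - a) * \<phi>' z" by auto
  then show ?thesis by (intro exI[of _ z]) auto
next
  case greater
  from MVT2[OF this assms] obtain z where "b < z" "z < a" "\<phi> a - \<phi> b = (a - b) * \<phi>' z" by auto
  then show ?thesis by (intro exI[of _ z]) (auto simp: algebra_simps)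
qed auto

lemma R_upd: "x \<in> R d \<Longrightarrow> m < d \<Longrightarrow> x(m := u) \<in> R d"
  by (auto simp: topspace_R)

text \<open>
  Changing one coordinate after the other reduces the increment to one-dimensional mean values.
\<close>

lemma mvt_space:
  assumes D: "\<And>m t x. m < d \<Longrightarrow> x \<in> R d \<Longrightarrow> ((\<lambda>u. g t (x(m := u))) has_real_derivative D m t x) (at (x m))"
    and x: "x \<in> R d" "x' \<in> R d"
  shows "\<exists>z. (\<forall>m<d. z m \<in> R d \<and> (\<forall>n. \<bar>z m n - x n\<bar> \<le> \<bar>x' n - x n\<bar>)) \<and>
     g t x' - g t x = (\<Sum>m<d. (x' m - x m) * D m t (z m))"
proof -
  define p where "p k n = (if n < k then x' n else x n)" for k n
  have p0: "p 0 = x" by (simp add: p_def fun_eq_iff)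
  have pd: "p d = x'" using x by (auto simp: p_def fun_eq_iff topspace_R)
  have pR: "p k \<in> R d" for k using x by (simp add: p_def topspace_R)
  have pS: "p (Suc m) = (p m)(m := x' m)" for m by (auto simp: p_def fun_eq_iff)
  have "\<exists>z. z \<in> R d \<and> (\<forall>n. \<bar>z n - x n\<bar> \<le> \<bar>x' n - x n\<bar>) \<and> g t (p (Suc m)) - g t (p m) = (x' m - x m) * D m t z"
    if m: "m < d" for m
  proof -
    have "((\<lambda>u. g t ((p m)(m := u))) has_real_derivative D m t ((p m)(m := u))) (at u)" for u
      using D[OF m R_upd[OF pR m], of t m u] by simp
    from mvt_symmetric[OF this, of "x m" "x' m"] obtain \<eta> where
      \<eta>: "\<bar>\<eta> - x m\<bar> \<le> \<bar>x' m - x m\<bar>" "g t ((p m)(m := x' m)) - g t ((p m)(m := x m)) = (x' m - x m) * D m t ((p m)(m := \<eta>))"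
      by blast
    have "(p m)(m := x m) = p m" by (auto simp: p_def)
    then show ?thesis using \<eta> R_upd[OF pR m, of m \<eta>] unfolding pS
      by (intro exI[of _ "(p m)(m := \<eta>)"]) (auto simp: p_def)
  qed
  then obtain z where z: "\<And>m. m < d \<Longrightarrow> z m \<in> R d \<and> (\<forall>n. \<bar>z m n - x n\<bar> \<le> \<bar>x' n - x n\<bar>) \<and>
      g t (p (Suc m)) - g t (p m) = (x' m - x m) * D m t (z m)"
    by metis
  have "g t x' - g t x = (\<Sum>m<d. g t (p (Suc m)) - g t (p m))"
    by (subst sum_lessThan_telescope) (simp add: p0 pd)
  also have "\<dots> = (\<Sum>m<d. (x' m - x m) * D m t (z m))"
    using z by (intro sum.cong) auto
  finally show ?thesis using z by (intro exI[of _ z]) blast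
qed

lemma tendsto_within_bound:
  fixes f :: "'a \<Rightarrow> real"
  assumes "(g \<longlongrightarrow> a) F" "\<forall>\<^sub>F x in F. \<bar>f x - a\<bar> \<le> \<bar>g x - a\<bar>"
  shows "(f \<longlongrightarrow> a) F"
proof -
  have "((\<lambda>x. f x - a) \<longlongrightarrow> 0) F"
    by (rule Lim_null_comparison[of _ "\<lambda>x. \<bar>g x - a\<bar>"])
      (use assms in \<open>auto intro!: tendsto_rabs_zero simp: LIM_zero_iff\<close>)
  then show ?thesis by (simp add: LIM_zero_iff)
qed

text \<open>
  Mean values in time and in each coordinate write the difference quotient with intermediate points, at
  which the partial derivatives converge by continuity.
\<close>

lemma chain_rule:
  assumes gt: "C_k d 0 g'" "\<And>t x. x \<in> R d \<Longrightarrow> ((\<lambda>\<tau>. g \<tau> x) has_real_derivative g' t x) (at t)"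
    and D: "\<And>m. m < d \<Longrightarrow> C_k d 0 (D m)"
      "\<And>m t x. m < d \<Longrightarrow> x \<in> R d \<Longrightarrow> ((\<lambda>u. g t (x(m := u))) has_real_derivative D m t x) (at (x m))"
    and t: "t \<in> S" and yR: "\<And>\<tau>. \<tau> \<in> S \<Longrightarrow> y \<tau> \<in> R d"
    and dy: "\<And>m. m < d \<Longrightarrow> ((\<lambda>\<tau>. y \<tau> m) has_real_derivative y' m) (at t within S)"
  shows "((\<lambda>\<tau>. g \<tau> (y \<tau>)) has_real_derivative g' t (y t) + (\<Sum>m<d. y' m * D m t (y t))) (at t within S)"
proof -
  have "\<forall>\<tau>\<in>S. \<exists>\<xi>. \<bar>\<xi> - t\<bar> \<le> \<bar>\<tau> - t\<bar> \<and> g \<tau> (y \<tau>) - g t (y \<tau>) = (\<tau> - t) * g' \<xi> (y \<tau>)"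
    using mvt_symmetric[OF gt(2)[OF yR]] by blast
  then obtain \<xi> where \<xi>: "\<And>\<tau>. \<tau> \<in> S \<Longrightarrow> \<bar>\<xi> \<tau> - t\<bar> \<le> \<bar>\<tau> - t\<bar>"
    "\<And>\<tau>. \<tau> \<in> S \<Longrightarrow> g \<tau> (y \<tau>) - g t (y \<tau>) = (\<tau> - t) * g' (\<xi> \<tau>) (y \<tau>)" by metis
  have "\<forall>\<tau>\<in>S. \<exists>z. (\<forall>m<d. z m \<in> R d \<and> (\<forall>n. \<bar>z m n - y t n\<bar> \<le> \<bar>y \<tau> n - y t n\<bar>)) \<and>
     g t (y \<tau>) - g t (y t) = (\<Sum>m<d. (y \<tau> m - y t m) * D m t (z m))"
    using mvt_space[where g = g and D = D, OF D(2) yR[OF t] yR] by blast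
  from bchoice[OF this] obtain z where z: "\<And>\<tau> m. \<tau> \<in> S \<Longrightarrow> m < d \<Longrightarrow> z \<tau> m \<in> R d"
    "\<And>\<tau> m n. \<tau> \<in> S \<Longrightarrow> m < d \<Longrightarrow> \<bar>z \<tau> m n - y t n\<bar> \<le> \<bar>y \<tau> n - y t n\<bar>"
    "\<And>\<tau>. \<tau> \<in> S \<Longrightarrow> g t (y \<tau>) - g t (y t) = (\<Sum>m<d. (y \<tau> m - y t m) * D m t (z \<tau> m))" by blast
  have S: "\<forall>\<^sub>F \<tau> in at t within S. \<tau> \<in> S \<and> \<tau> \<noteq> t"
    by (simp add: eventually_at_filter)
  have ty: "((\<lambda>\<tau>. y \<tau> m) \<longlongrightarrow> y t m) (at t within S)" if "m < d" for m
    using DERIV_continuous[OF dy[OF that]] by (simp add: continuous_within)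
  have "((\<lambda>\<tau>. g' (\<xi> \<tau>) (y \<tau>)) \<longlongrightarrow> g' t (y t)) (at t within S)"
  proof (rule C_k_tendsto[OF gt(1) yR[OF t]])
    show "(\<xi> \<longlongrightarrow> t) (at t within S)"
      by (rule tendsto_within_bound[OF tendsto_ident_at]) (use S \<xi> in \<open>auto elim: eventually_mono\<close>)
  qed (use ty S yR in \<open>auto elim: eventually_mono\<close>)
  moreover have "((\<lambda>\<tau>. D m t (z \<tau> m)) \<longlongrightarrow> D m t (y t)) (at t within S)" if "m < d" for m
  proof (rule C_k_tendsto[OF D(1)[OF that] yR[OF t] tendsto_const])
    fix n assume "n < d"
    from ty[OF this] show "((\<lambda>\<tau>. z \<tau> m n) \<longlongrightarrow> y t n) (at t within S)"
      by (rule tendsto_within_bound) (use S z that in \<open>auto elim: eventually_mono\<close>)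
  qed (use S z that in \<open>auto elim: eventually_mono\<close>)
  moreover have "((\<lambda>\<tau>. (y \<tau> m - y t m) / (\<tau> - t)) \<longlongrightarrow> y' m) (at t within S)" if "m < d" for m
    using dy[OF that] by (simp add: has_field_derivative_iff)
  ultimately have "((\<lambda>\<tau>. g' (\<xi> \<tau>) (y \<tau>) + (\<Sum>m<d. (y \<tau> m - y t m) / (\<tau> - t) * D m t (z \<tau> m))) \<longlongrightarrow>
      g' t (y t) + (\<Sum>m<d. y' m * D m t (y t))) (at t within S)"
    by (intro tendsto_add tendsto_sum tendsto_mult) auto
  then show ?thesis
    unfolding has_field_derivative_iff
  proof (rule Lim_transform_eventually)
    show "\<forall>\<^sub>F \<tau> in at t within S. g' (\<xi> \<tau>) (y \<tau>) + (\<Sum>m<d. (y \<tau> m - y t m) / (\<tau> - t) * D m t (z \<tau> m)) =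
       (g \<tau> (y \<tau>) - g t (y t)) / (\<tau> - t)"
      using S
    proof eventually_elim
      case (elim \<tau>)
      have "g \<tau> (y \<tau>) - g t (y t) = (\<tau> - t) * g' (\<xi> \<tau>) (y \<tau>) + (\<Sum>m<d. (y \<tau> m - y t m) * D m t (z \<tau> m))"
        using \<xi>(2)[of \<tau>] z(3)[of \<tau>] elim by linarith
      then show ?case using elim by (simp add: add_divide_distrib sum_divide_distrib)
    qed
  qed
qed

subsection \<open>Taylor expansion\<close>

text \<open>
  Unlike \<^term>\<open>at_right (0::real)\<close> this filter contains the point 0 itself, where a stage with
  \<open>c\<^sub>i = 0\<close> sits for every step size.
\<close>

definition at_0_nonneg :: "real filter" where
  "at_0_nonneg = inf (nhds 0) (principal {0..})"

lemma eventually_at_0_nonneg: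
  "eventually P at_0_nonneg \<longleftrightarrow> (\<exists>\<delta>>0. \<forall>\<sigma>. 0 \<le> \<sigma> \<and> \<sigma> < \<delta> \<longrightarrow> P \<sigma>)"
  unfolding at_0_nonneg_def eventually_inf_principal eventually_nhds_metric dist_real_def
  by (rule ex_cong) auto

lemma mean_value_bound:
  fixes \<phi> :: "real \<Rightarrow> real"
  assumes "0 \<le> \<sigma>" "\<sigma> \<le> h" and "\<And>\<tau>. \<tau> \<in> {0..h} \<Longrightarrow> (\<phi> has_real_derivative \<phi>' \<tau>) (at \<tau> within {0..h})"
    and "\<And>\<tau>. \<tau> \<in> {0..\<sigma>} \<Longrightarrow> \<bar>\<phi>' \<tau>\<bar> \<le> B"
  shows "\<bar>\<phi> \<sigma> - \<phi> 0\<bar> \<le> B * \<sigma>"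
proof -
  have "norm (\<phi> \<sigma> - \<phi> 0) \<le> B * norm (\<sigma> - 0)"
  proof (rule field_differentiable_bound[of "{0..\<sigma>}" \<phi> \<phi>' B])
    fix z assume "z \<in> {0..\<sigma>}"
    then show "(\<phi> has_real_derivative \<phi>' z) (at z within {0..\<sigma>})"
      using assms(1,2) by (intro has_field_derivative_subset[OF assms(3)]) auto
  qed (use assms in auto)
  then show ?thesis using assms(1) by simp
qed

lemma bigo_antiderivative:
  fixes \<phi> :: "real \<Rightarrow> real"
  assumes "h > 0" "\<And>\<sigma>. \<sigma> \<in> {0..h} \<Longrightarrow> (\<phi> has_real_derivative \<phi>' \<sigma>) (at \<sigma> within {0..h})"
    and "\<phi> 0 = 0" "\<phi>' \<in> O[at_0_nonneg](\<lambda>\<sigma>. \<sigma> ^ k)"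
  shows "\<phi> \<in> O[at_0_nonneg](\<lambda>\<sigma>. \<sigma> ^ Suc k)"
proof -
  obtain C where C: "C > 0" "\<forall>\<^sub>F \<sigma> in at_0_nonneg. norm (\<phi>' \<sigma>) \<le> C * norm (\<sigma> ^ k)"
    using assms(4) by (elim landau_o.bigE)
  then obtain \<delta> where \<delta>: "\<delta> > 0" "\<And>\<sigma>. 0 \<le> \<sigma> \<Longrightarrow> \<sigma> < \<delta> \<Longrightarrow> norm (\<phi>' \<sigma>) \<le> C * norm (\<sigma> ^ k)"
    unfolding eventually_at_0_nonneg by blast
  show ?thesis
  proof (rule landau_o.bigI[of C])
    show "\<forall>\<^sub>F \<sigma> in at_0_nonneg. norm (\<phi> \<sigma>) \<le> C * norm (\<sigma> ^ Suc k)"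
      unfolding eventually_at_0_nonneg
    proof (intro exI[of _ "min \<delta> h"] conjI allI impI)
      fix \<sigma> assume \<sigma>: "0 \<le> \<sigma> \<and> \<sigma> < min \<delta> h"
      have "\<bar>\<phi> \<sigma> - \<phi> 0\<bar> \<le> (C * \<sigma> ^ k) * \<sigma>"
      proof (rule mean_value_bound[OF _ _ assms(2)])
        fix \<tau> assume \<tau>: "\<tau> \<in> {0..\<sigma>}"
        have "\<bar>\<phi>' \<tau>\<bar> \<le> C * \<tau> ^ k" using \<delta>(2)[of \<tau>] \<tau> \<sigma> by auto
        also have "\<dots> \<le> C * \<sigma> ^ k" using C(1) \<tau> by (intro mult_left_mono power_mono) auto
        finally show "\<bar>\<phi>' \<tau>\<bar> \<le> C * \<sigma> ^ k" .
      qed (use \<sigma> in auto)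
      then show "norm (\<phi> \<sigma>) \<le> C * norm (\<sigma> ^ Suc k)" using assms(3) \<sigma> by (simp add: abs_mult mult_ac)
    qed (use \<delta> assms(1) in auto)
  qed (use C in auto)
qed

lemma solution_tendsto:
  assumes "solves_on d f y t0 (t0 + h)" "h > 0"
  shows "((\<lambda>\<sigma>. y (t0 + \<sigma>) m) \<longlongrightarrow> y t0 m) at_0_nonneg"
proof (rule tendstoI)
  fix e :: real assume e: "e > 0"
  have "((\<lambda>\<tau>. y \<tau> m) has_real_derivative f t0 (y t0) m) (at t0 within {t0..t0 + h})"
    using assms unfolding solves_on_def by auto
  then have "continuous (at t0 within {t0..t0 + h}) (\<lambda>\<tau>. y \<tau> m)" by (rule DERIV_continuous)
  then obtain \<delta> where "\<delta> > 0" "\<forall>\<tau>\<in>{t0..t0+h}. dist \<tau> t0 < \<delta> \<longrightarrow> dist (y \<tau> m) (y t0 m) < e"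
    unfolding continuous_within_eps_delta using e by blast
  then show "\<forall>\<^sub>F \<sigma> in at_0_nonneg. dist (y (t0 + \<sigma>) m) (y t0 m) < e"
    unfolding eventually_at_0_nonneg using assms(2)
    by (intro exI[of _ "min \<delta> h"]) (auto simp: dist_real_def)
qed

lemma solution_R:
  assumes "solves_on d f y t0 (t0 + h)" "h > 0"
  shows "y t0 \<in> R d" "\<forall>\<^sub>F \<sigma> in at_0_nonneg. y (t0 + \<sigma>) \<in> R d"
  using assms unfolding solves_on_def eventually_at_0_nonneg by (auto intro!: exI[of _ h])

text \<open>
  Along the solution \<open>g\<close> has the derivative \<open>g\<^sub>t + \<Sum>\<^sub>m f\<^sub>m \<partial>\<^sub>m g\<close>, again a composition with the solution, which
  is one degree less smooth; integrating its expansion gives that of \<open>g\<close>.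
\<close>

lemma taylor_along_solution:
  assumes sol: "solves_on d f y t0 (t0 + h)" and h: "h > 0"
    and f: "\<And>m. m < d \<Longrightarrow> C_k d k (\<lambda>t x. f t x m)"
    and g: "C_k d k g"
  shows "\<exists>a. (\<lambda>\<sigma>. g (t0 + \<sigma>) (y (t0 + \<sigma>)) - (\<Sum>p<k. \<sigma> ^ p * a p)) \<in> O[at_0_nonneg](\<lambda>\<sigma>. \<sigma> ^ k)"
  using f g
proof (induction k arbitrary: g)
  case 0
  have "((\<lambda>\<sigma>. g (t0 + \<sigma>) (y (t0 + \<sigma>))) \<longlongrightarrow> g t0 (y t0)) at_0_nonneg"
  proof (rule C_k_tendsto[OF 0(2) solution_R(1)[OF sol h]])
    have "((\<lambda>\<sigma>. t0 + \<sigma>) \<longlongrightarrow> t0 + 0) at_0_nonneg"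
      unfolding at_0_nonneg_def by (intro tendsto_intros filterlim_mono[OF filterlim_ident]) auto
    then show "((\<lambda>\<sigma>. t0 + \<sigma>) \<longlongrightarrow> t0) at_0_nonneg" by simp
  qed (use solution_tendsto[OF sol h] solution_R(2)[OF sol h] in auto)
  then have "(\<lambda>\<sigma>. g (t0 + \<sigma>) (y (t0 + \<sigma>))) \<in> O[at_0_nonneg](\<lambda>_. 1)"
    by (intro bigoI_tendsto[where c = "g t0 (y t0)"]) auto
  then show ?case by simp
next
  case (Suc k)
  obtain g' where g': "C_k d k g'" "\<And>t x. x \<in> R d \<Longrightarrow> ((\<lambda>\<tau>. g \<tau> x) has_real_derivative g' t x) (at t)"
    using Suc.prems(2) by (rule C_k_SucE) blast
  obtain D where D: "\<And>m. m < d \<Longrightarrow> C_k d k (D m)"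
    "\<And>m t x. m < d \<Longrightarrow> x \<in> R d \<Longrightarrow> ((\<lambda>u. g t (x(m := u))) has_real_derivative D m t x) (at (x m))"
    using Suc.prems(2) by (rule C_k_Suc_partialsE) blast
  define G where "G t x = g' t x + (\<Sum>m<d. f t x m * D m t x)" for t x
  have f: "C_k d k (\<lambda>t x. f t x m)" if "m < d" for m using C_k_SucD Suc.prems(1) that by blast
  have "C_k d k G" unfolding G_def
    by (intro C_k_add C_k_sum C_k_mult g' D f) auto
  from Suc.IH[OF f this] obtain a where
    a: "(\<lambda>\<sigma>. G (t0 + \<sigma>) (y (t0 + \<sigma>)) - (\<Sum>p<k. \<sigma> ^ p * a p)) \<in> O[at_0_nonneg](\<lambda>\<sigma>. \<sigma> ^ k)" by blast
  define a' where "a' p = (case p of 0 \<Rightarrow> g t0 (y t0) | Suc p \<Rightarrow> a p / (real p + 1))" for p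
  define \<phi> where "\<phi> \<sigma> = g (t0 + \<sigma>) (y (t0 + \<sigma>)) - (\<Sum>p<Suc k. \<sigma> ^ p * a' p)" for \<sigma>
  have \<phi>_eq: "\<phi> \<sigma> = g (t0 + \<sigma>) (y (t0 + \<sigma>)) - (g t0 (y t0) + (\<Sum>p<k. \<sigma> ^ Suc p * (a p / (real p + 1))))" for \<sigma>
    unfolding \<phi>_def by (subst sum.lessThan_Suc_shift) (simp add: a'_def)
  have "\<phi> \<in> O[at_0_nonneg](\<lambda>\<sigma>. \<sigma> ^ Suc k)"
  proof (rule bigo_antiderivative[OF h _ _ a])
    show "\<phi> 0 = 0" by (simp add: \<phi>_eq)
    fix \<sigma> assume \<sigma>: "\<sigma> \<in> {0..h}"
    have "((\<lambda>\<tau>. g \<tau> (y \<tau>)) has_real_derivative G (t0 + \<sigma>) (y (t0 + \<sigma>))) (at (t0 + \<sigma>) within {t0..t0 + h})"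
      unfolding G_def
      by (rule chain_rule[OF C_k_le[OF g'(1)] g'(2) C_k_le[OF D(1)] D(2)])
        (use \<sigma> sol in \<open>auto simp: solves_on_def\<close>)
    then have "((\<lambda>\<tau>. g \<tau> (y \<tau>)) has_real_derivative G (t0 + \<sigma>) (y (t0 + \<sigma>))) (at (t0 + \<sigma>) within (+) t0 ` {0..h})"
      by (simp add: add.commute)
    moreover have "((+) t0 has_real_derivative 1) (at \<sigma> within {0..h})"
      by (auto intro!: derivative_eq_intros)
    ultimately have "((\<lambda>\<sigma>. g (t0 + \<sigma>) (y (t0 + \<sigma>))) has_real_derivative G (t0 + \<sigma>) (y (t0 + \<sigma>)) * 1) (at \<sigma> within {0..h})"
      unfolding comp_def[of "\<lambda>\<tau>. g \<tau> (y \<tau>)" "(+) t0", symmetric] by (rule DERIV_image_chain)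
    moreover have "((\<lambda>\<sigma>. g t0 (y t0) + (\<Sum>p<k. \<sigma> ^ Suc p * (a p / (real p + 1)))) has_real_derivative
      (\<Sum>p<k. \<sigma> ^ p * a p)) (at \<sigma> within {0..h})"
      by (auto intro!: derivative_eq_intros sum.cong simp: add.commute simp del: power_Suc)
    ultimately show "(\<phi> has_real_derivative G (t0 + \<sigma>) (y (t0 + \<sigma>)) - (\<Sum>p<k. \<sigma> ^ p * a p)) (at \<sigma> within {0..h})"
      unfolding \<phi>_eq by (auto intro: DERIV_diff)
  qed
  then show ?case unfolding \<phi>_def by blast
qed

lemma C_k_locally_bounded:
  assumes "C_k d q g" "x0 \<in> R d"
  shows "\<forall>\<^sub>F \<delta> in at_right 0. \<forall>t x. \<bar>t - t0\<bar> < \<delta> \<longrightarrow> x \<in> R d \<longrightarrow> (\<forall>m<d. \<bar>x m - x0 m\<bar> < \<delta>) \<longrightarrow>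
    \<bar>g t x\<bar> \<le> \<bar>g t0 x0\<bar> + 1"
proof -
  obtain \<delta> where \<delta>: "\<delta> > 0" "\<And>t x. \<bar>t - t0\<bar> < \<delta> \<Longrightarrow> x \<in> R d \<Longrightarrow> (\<And>m. m < d \<Longrightarrow> \<bar>x m - x0 m\<bar> < \<delta>) \<Longrightarrow>
    \<bar>g t x - g t0 x0\<bar> < 1"
    using R_Euclidean_delta[OF C_k_continuous[OF assms(1)] assms(2), of 1] by auto
  have "\<forall>\<^sub>F \<delta>' in at_right 0. \<delta>' < \<delta>"
    using eventually_at_right_real[OF \<delta>(1)] by (auto elim: eventually_mono)
  then show ?thesis
  proof eventually_elim
    case (elim \<delta>')
    show ?case
    proof (intro allI impI)
      fix t x assume *: "\<bar>t - t0\<bar> < \<delta>'" "x \<in> R d" "\<forall>m<d. \<bar>x m - x0 m\<bar> < \<delta>'"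
      have "\<bar>g t x - g t0 x0\<bar> < 1"
        by (rule \<delta>(2)) (use * elim in \<open>auto intro: less_trans\<close>)
      then show "\<bar>g t x\<bar> \<le> \<bar>g t0 x0\<bar> + 1" by linarith
    qed
  qed
qed

text \<open>
  Coordinates relative to \<open>y0\<close>, with an extra coordinate 1 that turns affine functions into linear ones.
\<close>

definition hat :: "nat \<Rightarrow> state \<Rightarrow> state \<Rightarrow> nat \<Rightarrow> real" where
  "hat d y0 x n = (if n < d then x n - y0 n else 1)"

text \<open>
  Two applications of the mean value theorem bound the remainder by the second partial derivatives.
\<close>

lemma linearisation_remainder:
  assumes D: "\<And>m t x. m < d \<Longrightarrow> x \<in> R d \<Longrightarrow> ((\<lambda>u. g t (x(m := u))) has_real_derivative D m t x) (at (x m))"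
    and E: "\<And>m n t x. m < d \<Longrightarrow> n < d \<Longrightarrow> x \<in> R d \<Longrightarrow> ((\<lambda>u. D m t (x(n := u))) has_real_derivative E m n t x) (at (x n))"
    and bound: "\<And>m n z. m < d \<Longrightarrow> n < d \<Longrightarrow> z \<in> R d \<Longrightarrow> (\<And>k. \<bar>z k - x k\<bar> \<le> \<bar>x' k - x k\<bar>) \<Longrightarrow> \<bar>E m n t z\<bar> \<le> B"
    and x: "x \<in> R d" "x' \<in> R d"
  shows "\<bar>g t x' - (g t x + (\<Sum>m<d. (x' m - x m) * D m t x))\<bar> \<le> B * (\<Sum>n<d. \<bar>x' n - x n\<bar>)\<^sup>2"
proof -
  obtain z where z: "\<And>m. m < d \<Longrightarrow> z m \<in> R d" "\<And>m n. m < d \<Longrightarrow> \<bar>z m n - x n\<bar> \<le> \<bar>x' n - x n\<bar>"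
     "g t x' - g t x = (\<Sum>m<d. (x' m - x m) * D m t (z m))"
    using mvt_space[where g = g and D = D and t = t, OF D x] by blast
  have *: "\<bar>D m t (z m) - D m t x\<bar> \<le> B * (\<Sum>n<d. \<bar>x' n - x n\<bar>)" if m: "m < d" for m
  proof -
    obtain \<zeta> where \<zeta>: "\<And>n. n < d \<Longrightarrow> \<zeta> n \<in> R d" "\<And>n k. n < d \<Longrightarrow> \<bar>\<zeta> n k - x k\<bar> \<le> \<bar>z m k - x k\<bar>"
     "D m t (z m) - D m t x = (\<Sum>n<d. (z m n - x n) * E m n t (\<zeta> n))"
      using mvt_space[where g = "D m" and D = "E m" and t = t, OF E[OF m] x(1) z(1)[OF m]] by blast
    have "\<bar>D m t (z m) - D m t x\<bar> \<le> (\<Sum>n<d. \<bar>(z m n - x n) * E m n t (\<zeta> n)\<bar>)"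
      unfolding \<zeta>(3) by (rule sum_abs)
    also have "\<dots> \<le> (\<Sum>n<d. \<bar>x' n - x n\<bar> * B)"
    proof (rule sum_mono)
      fix n assume "n \<in> {..<d}"
      then have n: "n < d" by simp
      have "\<bar>E m n t (\<zeta> n)\<bar> \<le> B"
        by (rule bound[OF m n \<zeta>(1)[OF n]]) (rule order_trans[OF \<zeta>(2)[OF n] z(2)[OF m]])
      then show "\<bar>(z m n - x n) * E m n t (\<zeta> n)\<bar> \<le> \<bar>x' n - x n\<bar> * B"
        using z(2)[OF m, of n] by (simp add: abs_mult mult_mono)
    qed
    finally show ?thesis by (simp add: sum_distrib_left mult.commute)
  qed
  have "\<bar>g t x' - (g t x + (\<Sum>m<d. (x' m - x m) * D m t x))\<bar> = \<bar>\<Sum>m<d. (x' m - x m) * (D m t (z m) - D m t x)\<bar>"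
    using z(3) by (simp add: right_diff_distrib sum_subtractf)
  also have "\<dots> \<le> (\<Sum>m<d. \<bar>(x' m - x m) * (D m t (z m) - D m t x)\<bar>)" by (rule sum_abs)
  also have "\<dots> \<le> (\<Sum>m<d. \<bar>x' m - x m\<bar> * (B * (\<Sum>n<d. \<bar>x' n - x n\<bar>)))"
    by (intro sum_mono) (auto simp: abs_mult intro!: mult_left_mono *)
  also have "\<dots> = B * (\<Sum>n<d. \<bar>x' n - x n\<bar>)\<^sup>2"
    unfolding sum_distrib_right[symmetric] power2_eq_square by (rule mult.left_commute)
  finally show ?thesis .
qed

text \<open>
  With \<open>y\<close> the exact solution, \<open>g(t, x) = g(t, y) + \<Sum>\<^sub>m \<partial>\<^sub>m g(t, y) (x\<^sub>m - y\<^sub>m)\<close> up to a quadratic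
  remainder.  In the coordinates relative to \<open>y t0\<close> this is affine in \<open>x\<close>, with coefficients that
  depend on time along the solution only and are replaced by their Taylor polynomials.
\<close>

lemma linearisation_along_solution:
  assumes sol: "solves_on d f y t0 (t0 + h)" and h: "h > 0"
    and f: "\<And>m. m < d \<Longrightarrow> C_k d 4 (\<lambda>t x. f t x m)"
    and g: "C_k d 5 g"
  obtains G \<delta> M where "\<delta> > 0" "M \<ge> 0"
    "\<And>\<sigma> x. 0 \<le> \<sigma> \<Longrightarrow> \<sigma> < \<delta> \<Longrightarrow> x \<in> R d \<Longrightarrow> (\<And>n. n < d \<Longrightarrow> \<bar>x n - y t0 n\<bar> < \<delta>) \<Longrightarrow>
     \<bar>g (t0 + \<sigma>) x - (\<Sum>p<4. \<sigma> ^ p * (\<Sum>n\<le>d. G p n * hat d (y t0) x n))\<bar>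
       \<le> M * (\<sigma> ^ 4 + (\<Sum>n<d. \<bar>x n - y (t0 + \<sigma>) n\<bar>)\<^sup>2)"
proof -
  note y0 = solution_R(1)[OF sol h]
  have g': "C_k d (Suc 4) g" using g by (simp add: eval_nat_numeral)
  obtain D where D: "\<And>m. m < d \<Longrightarrow> C_k d 4 (D m)"
    "\<And>m t x. m < d \<Longrightarrow> x \<in> R d \<Longrightarrow> ((\<lambda>u. g t (x(m := u))) has_real_derivative D m t x) (at (x m))"
    using g' by (rule C_k_Suc_partialsE) blast
  have "\<exists>E. (\<forall>n<d. C_k d 3 (E n)) \<and> (\<forall>n<d. \<forall>t. \<forall>x\<in>R d. ((\<lambda>u. D m t (x(n := u))) has_real_derivative E n t x) (at (x n)))" if "m < d" for m
  proof -
    have "C_k d (Suc 3) (D m)" using D(1)[OF that] by (simp add: eval_nat_numeral)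
    from C_k_Suc_partialsE[OF this] show ?thesis by metis
  qed
  then have "\<forall>m. \<exists>E. m < d \<longrightarrow> (\<forall>n<d. C_k d 3 (E n)) \<and> (\<forall>n<d. \<forall>t. \<forall>x\<in>R d. ((\<lambda>u. D m t (x(n := u))) has_real_derivative E n t x) (at (x n)))"
    by blast
  from choice[OF this] obtain E where E: "\<And>m n. m < d \<Longrightarrow> n < d \<Longrightarrow> C_k d 3 (E m n)"
    "\<And>m n t x. m < d \<Longrightarrow> n < d \<Longrightarrow> x \<in> R d \<Longrightarrow> ((\<lambda>u. D m t (x(n := u))) has_real_derivative E m n t x) (at (x n))"
    by blast
  define B where "B = (\<Sum>m<d. \<Sum>n<d. \<bar>E m n t0 (y t0)\<bar> + 1)"
  have B: "\<bar>E m n t0 (y t0)\<bar> + 1 \<le> B" if "m < d" "n < d" for m n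
  proof -
    have "\<bar>E m n t0 (y t0)\<bar> + 1 \<le> (\<Sum>n<d. \<bar>E m n t0 (y t0)\<bar> + 1)"
      using that by (intro member_le_sum[where f = "\<lambda>n. \<bar>E m n t0 (y t0)\<bar> + 1"]) auto
    also have "\<dots> \<le> B" unfolding B_def
      using that by (intro member_le_sum[where f = "\<lambda>m. \<Sum>n<d. \<bar>E m n t0 (y t0)\<bar> + 1"] sum_nonneg) auto
    finally show ?thesis .
  qed
  have B0: "B \<ge> 0" unfolding B_def by (intro sum_nonneg) auto
  have "\<forall>\<^sub>F \<delta> in at_right 0. \<forall>m\<in>{..<d}. \<forall>n\<in>{..<d}. \<forall>t x. \<bar>t - t0\<bar> < \<delta> \<longrightarrow> x \<in> R d \<longrightarrow> (\<forall>k<d. \<bar>x k - y t0 k\<bar> < \<delta>) \<longrightarrow>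
    \<bar>E m n t x\<bar> \<le> \<bar>E m n t0 (y t0)\<bar> + 1"
    by (intro eventually_ball_finite ballI C_k_locally_bounded[OF E(1) y0]) auto
  then have "\<forall>\<^sub>F \<delta> in at_right 0. \<delta> > 0 \<and> (\<forall>m\<in>{..<d}. \<forall>n\<in>{..<d}. \<forall>t x. \<bar>t - t0\<bar> < \<delta> \<longrightarrow> x \<in> R d \<longrightarrow> (\<forall>k<d. \<bar>x k - y t0 k\<bar> < \<delta>) \<longrightarrow>
    \<bar>E m n t x\<bar> \<le> \<bar>E m n t0 (y t0)\<bar> + 1)"
    using eventually_at_right_less by eventually_elim auto
  from eventually_happens'[OF trivial_limit_at_right_real this]
  obtain \<delta>1 where \<delta>1: "\<delta>1 > 0" "\<And>m n t x. m < d \<Longrightarrow> n < d \<Longrightarrow> \<bar>t - t0\<bar> < \<delta>1 \<Longrightarrow> x \<in> R d \<Longrightarrow> (\<And>k. k < d \<Longrightarrow> \<bar>x k - y t0 k\<bar> < \<delta>1) \<Longrightarrow>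
    \<bar>E m n t x\<bar> \<le> \<bar>E m n t0 (y t0)\<bar> + 1"
    by blast
  \<comment> \<open>The coefficients of the affine function; the last one belongs to the coordinate 1.\<close>
  define \<Phi> where "\<Phi> n = (if n < d then D n else (\<lambda>t x. g t x - (\<Sum>k<d. (x k - y t0 k) * D k t x)))" for n
  have "C_k d 4 (\<Phi> n)" for n
    using D(1) C_k_le[OF g, of 4] unfolding \<Phi>_def by (auto intro!: C_k_minus C_k_sum C_k_mult C_k_coord)
  then have "\<forall>n. \<exists>a. (\<lambda>\<sigma>. \<Phi> n (t0 + \<sigma>) (y (t0 + \<sigma>)) - (\<Sum>p<4. \<sigma> ^ p * a p)) \<in> O[at_0_nonneg](\<lambda>\<sigma>. \<sigma> ^ 4)"
    using taylor_along_solution[OF sol h f] by blast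
  from choice[OF this] obtain a where a: "\<And>n. (\<lambda>\<sigma>. \<Phi> n (t0 + \<sigma>) (y (t0 + \<sigma>)) - (\<Sum>p<4. \<sigma> ^ p * a n p)) \<in> O[at_0_nonneg](\<lambda>\<sigma>. \<sigma> ^ 4)"
    by blast
  have "\<forall>n. \<exists>C>0. \<forall>\<^sub>F \<sigma> in at_0_nonneg. norm (\<Phi> n (t0 + \<sigma>) (y (t0 + \<sigma>)) - (\<Sum>p<4. \<sigma> ^ p * a n p)) \<le> C * norm (\<sigma> ^ 4)"
  proof
    fix n show "\<exists>C>0. \<forall>\<^sub>F \<sigma> in at_0_nonneg. norm (\<Phi> n (t0 + \<sigma>) (y (t0 + \<sigma>)) - (\<Sum>p<4. \<sigma> ^ p * a n p)) \<le> C * norm (\<sigma> ^ 4)"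
      by (rule landau_o.bigE[OF a[of n]]) blast
  qed
  from choice[OF this] obtain C where C: "\<And>n. C n > 0" "\<And>n. \<forall>\<^sub>F \<sigma> in at_0_nonneg. norm (\<Phi> n (t0 + \<sigma>) (y (t0 + \<sigma>)) - (\<Sum>p<4. \<sigma> ^ p * a n p)) \<le> C n * norm (\<sigma> ^ 4)"
    by blast
  have "\<forall>\<^sub>F \<sigma> in at_0_nonneg. (\<forall>n\<in>{..<d}. dist (y (t0 + \<sigma>) n) (y t0 n) < \<delta>1 / 3) \<and> y (t0 + \<sigma>) \<in> R d \<and>
      (\<forall>n\<in>{..d}. norm (\<Phi> n (t0 + \<sigma>) (y (t0 + \<sigma>)) - (\<Sum>p<4. \<sigma> ^ p * a n p)) \<le> C n * norm (\<sigma> ^ 4))"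
    using \<delta>1(1)
    by (intro eventually_conj eventually_ball_finite ballI tendstoD[OF solution_tendsto[OF sol h]] solution_R(2)[OF sol h] C) auto
  then obtain \<delta>2 where \<delta>2: "\<delta>2 > 0" "\<And>\<sigma>. 0 \<le> \<sigma> \<Longrightarrow> \<sigma> < \<delta>2 \<Longrightarrow> (\<forall>n\<in>{..<d}. dist (y (t0 + \<sigma>) n) (y t0 n) < \<delta>1 / 3) \<and> y (t0 + \<sigma>) \<in> R d \<and>
      (\<forall>n\<in>{..d}. norm (\<Phi> n (t0 + \<sigma>) (y (t0 + \<sigma>)) - (\<Sum>p<4. \<sigma> ^ p * a n p)) \<le> C n * norm (\<sigma> ^ 4))"
    unfolding eventually_at_0_nonneg by blast
  \<comment> \<open>Intermediate points deviate by at most the deviation of \<open>x\<close> and twice that of the solution; the bound 1 is for \<open>hat\<close>.\<close>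
  define \<delta> where "\<delta> = min (min (\<delta>1 / 3) \<delta>2) 1"
  have \<delta>: "\<delta> > 0" "\<delta> \<le> \<delta>1 / 3" "\<delta> \<le> \<delta>2" "\<delta> \<le> 1" using \<delta>1(1) \<delta>2(1) by (auto simp: \<delta>_def)
  define M where "M = B + (\<Sum>n\<le>d. C n)"
  have C0: "(\<Sum>n\<le>d. C n) \<ge> 0" using C(1) by (intro sum_nonneg) (auto intro: less_imp_le)
  have M: "M \<ge> 0" using B0 C0 by (simp add: M_def)
  show ?thesis
  proof (rule that[of \<delta> M "\<lambda>p n. a n p", OF \<delta>(1) M])
    fix \<sigma> x assume \<sigma>: "0 \<le> \<sigma>" "\<sigma> < \<delta>" and xR: "x \<in> R d" and x: "\<And>n. n < d \<Longrightarrow> \<bar>x n - y t0 n\<bar> < \<delta>"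
    define t where "t = t0 + \<sigma>"
    have y: "\<And>n. n < d \<Longrightarrow> \<bar>y t n - y t0 n\<bar> < \<delta>1 / 3" "y t \<in> R d"
      and \<Phi>: "\<And>n. n \<le> d \<Longrightarrow> \<bar>\<Phi> n t (y t) - (\<Sum>p<4. \<sigma> ^ p * a n p)\<bar> \<le> C n * \<sigma> ^ 4"
      using \<delta>2(2)[of \<sigma>] \<sigma> \<delta>(3) by (auto simp: t_def dist_real_def)
    have 1: "\<bar>g t x - (g t (y t) + (\<Sum>m<d. (x m - y t m) * D m t (y t)))\<bar> \<le> B * (\<Sum>n<d. \<bar>x n - y t n\<bar>)\<^sup>2"
    proof (rule linearisation_remainder[where g = g and D = D and E = E, OF D(2) E(2) _ y(2) xR])
      fix m n z assume mn: "m < d" "n < d" and z: "z \<in> R d" "\<And>k. \<bar>z k - y t k\<bar> \<le> \<bar>x k - y t k\<bar>"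
      have "\<bar>E m n t z\<bar> \<le> \<bar>E m n t0 (y t0)\<bar> + 1"
      proof (rule \<delta>1(2)[OF mn _ z(1)])
        show "\<bar>t - t0\<bar> < \<delta>1" using \<sigma> \<delta>(2) \<delta>1(1) by (simp add: t_def)
        fix k assume "k < d"
        then show "\<bar>z k - y t0 k\<bar> < \<delta>1" using z(2)[of k] x[of k] y(1)[of k] \<delta>(2) by linarith
      qed
      then show "\<bar>E m n t z\<bar> \<le> B" using B[OF mn] by linarith
    qed
    have "g t (y t) + (\<Sum>m<d. (x m - y t m) * D m t (y t)) = (\<Sum>n\<le>d. \<Phi> n t (y t) * hat d (y t0) x n)"
      by (simp add: lessThan_Suc_atMost[symmetric] \<Phi>_def hat_def mult.commute)
        (simp add: sum_subtractf[symmetric] right_diff_distrib[symmetric])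
    moreover have "(\<Sum>p<4. \<sigma> ^ p * (\<Sum>n\<le>d. a n p * hat d (y t0) x n)) = (\<Sum>n\<le>d. (\<Sum>p<4. \<sigma> ^ p * a n p) * hat d (y t0) x n)"
      unfolding sum_distrib_left sum_distrib_right mult.assoc by (rule sum.swap)
    ultimately have 2: "g t x - (\<Sum>p<4. \<sigma> ^ p * (\<Sum>n\<le>d. a n p * hat d (y t0) x n)) =
        (g t x - (g t (y t) + (\<Sum>m<d. (x m - y t m) * D m t (y t)))) +
        (\<Sum>n\<le>d. (\<Phi> n t (y t) - (\<Sum>p<4. \<sigma> ^ p * a n p)) * hat d (y t0) x n)"
      unfolding left_diff_distrib[of _ _ "hat d (y t0) x _"] sum_subtractf by linarith
    have "\<bar>\<Sum>n\<le>d. (\<Phi> n t (y t) - (\<Sum>p<4. \<sigma> ^ p * a n p)) * hat d (y t0) x n\<bar> \<le>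
       (\<Sum>n\<le>d. \<bar>(\<Phi> n t (y t) - (\<Sum>p<4. \<sigma> ^ p * a n p)) * hat d (y t0) x n\<bar>)" by (rule sum_abs)
    also have "\<dots> \<le> (\<Sum>n\<le>d. (C n * \<sigma> ^ 4) * 1)"
    proof (rule sum_mono)
      fix n assume n: "n \<in> {..d}"
      have "\<bar>hat d (y t0) x n\<bar> \<le> 1" using x[of n] \<delta>(4) unfolding hat_def by auto
      then show "\<bar>(\<Phi> n t (y t) - (\<Sum>p<4. \<sigma> ^ p * a n p)) * hat d (y t0) x n\<bar> \<le> (C n * \<sigma> ^ 4) * 1"
        unfolding abs_mult using \<Phi>[of n] n by (intro mult_mono) auto
    qed
    also have "\<dots> = (\<Sum>n\<le>d. C n) * \<sigma> ^ 4" by (simp add: sum_distrib_right)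
    finally have 3: "\<bar>\<Sum>n\<le>d. (\<Phi> n t (y t) - (\<Sum>p<4. \<sigma> ^ p * a n p)) * hat d (y t0) x n\<bar> \<le> (\<Sum>n\<le>d. C n) * \<sigma> ^ 4" .
    have "0 \<le> B * \<sigma> ^ 4" "0 \<le> (\<Sum>n\<le>d. C n) * (\<Sum>n<d. \<bar>x n - y t n\<bar>)\<^sup>2"
      using B0 C0 by auto
    then show "\<bar>g (t0 + \<sigma>) x - (\<Sum>p<4. \<sigma> ^ p * (\<Sum>n\<le>d. a n p * hat d (y t0) x n))\<bar>
       \<le> M * (\<sigma> ^ 4 + (\<Sum>n<d. \<bar>x n - y (t0 + \<sigma>) n\<bar>)\<^sup>2)"
      unfolding t_def[symmetric] 2 M_def distrib_left distrib_right using 1 3 by linarith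
  qed
qed

section \<open>Chain expansions\<close>

lemma bigo_bounded_mult:
  fixes f g k :: "'a \<Rightarrow> real"
  assumes "f \<in> O[F](\<lambda>_. 1)" "g \<in> O[F](k)"
  shows "(\<lambda>x. f x * g x) \<in> O[F](k)"
  using landau_o.big_mult[OF assms] by simp

lemma bigo_const_mult:
  fixes g k :: "'a \<Rightarrow> real"
  assumes "g \<in> O[F](k)"
  shows "(\<lambda>x. a * g x) \<in> O[F](k)"
  by (rule bigo_bounded_mult[OF _ assms]) simp

lemma bigo_power_mono:
  assumes "(Hf \<longlongrightarrow> (0::real)) F" "b \<le> a"
  shows "(\<lambda>x. Hf x ^ a) \<in> O[F](\<lambda>x. Hf x ^ b)"
proof (rule landau_o.bigI[of 1])
  have "\<forall>\<^sub>F x in F. \<bar>Hf x\<bar> < 1" using tendstoD[OF assms(1), of 1] by simp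
  then show "\<forall>\<^sub>F x in F. norm (Hf x ^ a) \<le> 1 * norm (Hf x ^ b)"
  proof eventually_elim
    case (elim x)
    then show ?case using power_decreasing[OF assms(2), of "\<bar>Hf x\<bar>"] by (simp add: power_abs)
  qed
qed simp

lemma bigo_trans_power:
  assumes "f \<in> O[F](\<lambda>x. Hf x ^ a)" "(Hf \<longlongrightarrow> (0::real)) F" "b \<le> a"
  shows "f \<in> O[F](\<lambda>x. Hf x ^ b)"
  using landau_o.big_trans[OF assms(1) bigo_power_mono[OF assms(2,3)]] .

text \<open>
  Exponents up to 3 suffice: a letter with a larger exponent has order at least 5.
\<close>

definition chain_steps :: "(part \<times> nat) set" where
  "chain_steps = {Fast, Slow} \<times> {..<4}"

primrec bounded_chains :: "nat \<Rightarrow> chain set" where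
  "bounded_chains 0 = {[]}"
| "bounded_chains (Suc K) = insert [] ((\<lambda>(a, w). a # w) ` (chain_steps \<times> bounded_chains K))"

lemma finite_chain_steps [simp]: "finite chain_steps" by (simp add: chain_steps_def)

lemma finite_bounded_chains [simp]: "finite (bounded_chains K)" by (induction K) auto

lemma Nil_in_bounded_chains [simp]: "[] \<in> bounded_chains K" by (cases K) auto

lemma sum_bounded_chains_Suc:
  fixes f :: "chain \<Rightarrow> real"
  shows "(\<Sum>w\<in>bounded_chains (Suc K). f w) = f [] + (\<Sum>\<kappa>\<in>{Fast, Slow}. \<Sum>p<4. \<Sum>w\<in>bounded_chains K. f ((\<kappa>, p) # w))"
proof -
  have "(\<Sum>w\<in>bounded_chains (Suc K). f w) = f [] + (\<Sum>w\<in>(\<lambda>(a, w). a # w) ` (chain_steps \<times> bounded_chains K). f w)"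
    unfolding bounded_chains.simps by (subst sum.insert) auto
  also have "(\<Sum>w\<in>(\<lambda>(a, w). a # w) ` (chain_steps \<times> bounded_chains K). f w) = (\<Sum>(a, w)\<in>chain_steps \<times> bounded_chains K. f (a # w))"
    by (subst sum.reindex) (auto simp: inj_on_def case_prod_unfold)
  also have "\<dots> = (\<Sum>a\<in>chain_steps. \<Sum>w\<in>bounded_chains K. f (a # w))" by (rule sum.cartesian_product[symmetric])
  also have "\<dots> = (\<Sum>\<kappa>\<in>{Fast, Slow}. \<Sum>p<4. \<Sum>w\<in>bounded_chains K. f ((\<kappa>, p) # w))"
    unfolding chain_steps_def by (subst sum.cartesian_product) (simp add: case_prod_unfold)
  finally show ?thesis .
qed

text \<open>
  The elementary vector of a chain, obtained by applying the coefficient matrices \<open>G \<kappa> p\<close> of the linearised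
  fields letter by letter.  The empty chain stands for the constant 1, which sits in coordinate \<open>d\<close> (see
  \<open>hat\<close>).
\<close>

primrec elem_vec :: "nat \<Rightarrow> (part \<Rightarrow> nat \<Rightarrow> nat \<Rightarrow> nat \<Rightarrow> real) \<Rightarrow> chain \<Rightarrow> nat \<Rightarrow> real" where
  "elem_vec d G [] n = (if n < d then 0 else 1)"
| "elem_vec d G (a # w) m = (if m < d then \<Sum>n\<le>d. G (fst a) (snd a) m n * elem_vec d G w n else 0)"

definition expansion :: "nat \<Rightarrow> (part \<Rightarrow> nat \<Rightarrow> nat \<Rightarrow> nat \<Rightarrow> real) \<Rightarrow> nat \<Rightarrow> real \<Rightarrow> (chain \<Rightarrow> real) \<Rightarrow> nat \<Rightarrow> real" where
  "expansion d G K H W n = (\<Sum>w\<in>bounded_chains K. H ^ chain_order w * W w * elem_vec d G w n)"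

lemma expansion_0: "n < d \<Longrightarrow> expansion d G 0 H W n = 0"
  by (simp add: expansion_def)

lemma expansion_Suc:
  assumes "n < d"
  shows "expansion d G (Suc K) H W n = (\<Sum>\<kappa>\<in>{Fast, Slow}. \<Sum>p<4. \<Sum>w\<in>bounded_chains K.
    H * (H ^ (p + chain_order w)) * W ((\<kappa>, p) # w) * elem_vec d G ((\<kappa>, p) # w) n)"
  unfolding expansion_def sum_bounded_chains_Suc using assms by (simp add: mult.assoc)

lemma expansion_hat:
  assumes "W [] = 1"
  shows "expansion d G K H W d = 1"
proof -
  have "expansion d G K H W d = (\<Sum>w\<in>bounded_chains K. if w = [] then 1 else 0)"
    unfolding expansion_def
  proof (rule sum.cong[OF refl])
    fix w show "H ^ chain_order w * W w * elem_vec d G w d = (if w = [] then 1 else 0)"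
      using assms by (cases w) auto
  qed
  then show ?thesis by simp
qed

text \<open>
  The value of the linearised field at time \<open>H \<rho>\<close> and at a point with expansion \<open>W\<close>.
\<close>

definition field_expansion :: "nat \<Rightarrow> (part \<Rightarrow> nat \<Rightarrow> nat \<Rightarrow> nat \<Rightarrow> real) \<Rightarrow> nat \<Rightarrow> part \<Rightarrow> real \<Rightarrow> real \<Rightarrow> (chain \<Rightarrow> real) \<Rightarrow> nat \<Rightarrow> real" where
  "field_expansion d G K \<kappa> H \<rho> W m = (\<Sum>p<4. \<Sum>w\<in>bounded_chains K. H ^ (p + chain_order w) * (\<rho> ^ p * W w) * elem_vec d G ((\<kappa>, p) # w) m)"

lemma field_expansion_eq:
  assumes "m < d"
  shows "field_expansion d G K \<kappa> H \<rho> W m = (\<Sum>p<4. (H * \<rho>) ^ p * (\<Sum>n\<le>d. G \<kappa> p m n * expansion d G K H W n))"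
  unfolding field_expansion_def
proof (rule sum.cong[OF refl])
  fix p :: nat
  have "(\<Sum>n\<le>d. G \<kappa> p m n * expansion d G K H W n) =
    (\<Sum>w\<in>bounded_chains K. \<Sum>n\<le>d. G \<kappa> p m n * (H ^ chain_order w * W w * elem_vec d G w n))"
    unfolding expansion_def sum_distrib_left by (rule sum.swap)
  also have "\<dots> = (\<Sum>w\<in>bounded_chains K. H ^ chain_order w * W w * elem_vec d G ((\<kappa>, p) # w) m)"
    using assms by (simp add: sum_distrib_left mult_ac)
  finally show "(\<Sum>w\<in>bounded_chains K. H ^ (p + chain_order w) * (\<rho> ^ p * W w) * elem_vec d G ((\<kappa>, p) # w) m) =
     (H * \<rho>) ^ p * (\<Sum>n\<le>d. G \<kappa> p m n * expansion d G K H W n)"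
    by (simp only: sum_distrib_left) (simp add: power_add power_mult_distrib mult_ac)
qed

primrec field_of :: "vfield \<Rightarrow> vfield \<Rightarrow> part \<Rightarrow> vfield" where
  "field_of fF fS Fast = fF"
| "field_of fF fS Slow = fS"

lemma sum_parts: "(\<Sum>\<kappa>\<in>{Fast, Slow}. f \<kappa>) = f Fast + (f Slow :: real)"
  by simp

locale split_problem =
  fixes d :: nat and fF fS :: vfield and t0 h :: real and y :: "real \<Rightarrow> state"
  assumes smooth: "smooth_field d 5 fF" "smooth_field d 5 fS"
    and h_pos: "h > 0"
    and sol: "solves_on d (\<lambda>t x m. fF t x m + fS t x m) y t0 (t0 + h)"
begin

abbreviation fld where "fld \<equiv> field_of fF fS"

lemma smooth_part: "m < d \<Longrightarrow> C_k d 5 (\<lambda>t x. fld \<kappa> t x m)"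
  using smooth by (cases \<kappa>) (auto simp: smooth_field_def)

lemma smooth_sum: "m < d \<Longrightarrow> C_k d 4 (\<lambda>t x. fF t x m + fS t x m)"
  using smooth_part[of m Fast] smooth_part[of m Slow] by (auto intro!: C_k_add C_k_le[of d 5 _ 4])

text \<open>
  The conclusion of \<open>linearisation_along_solution\<close>.
\<close>

definition linearises_at where
  "linearises_at G g \<longleftrightarrow> (\<exists>\<delta>>0. \<exists>M\<ge>0. \<forall>\<sigma> x. 0 \<le> \<sigma> \<longrightarrow> \<sigma> < \<delta> \<longrightarrow> x \<in> R d \<longrightarrow> (\<forall>n<d. \<bar>x n - y t0 n\<bar> < \<delta>) \<longrightarrow>
     \<bar>g (t0 + \<sigma>) x - (\<Sum>p<4. \<sigma> ^ p * (\<Sum>n\<le>d. G p n * hat d (y t0) x n))\<bar>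
       \<le> M * (\<sigma> ^ 4 + (\<Sum>n<d. \<bar>x n - y (t0 + \<sigma>) n\<bar>)\<^sup>2))"

definition linearises where
  "linearises G \<longleftrightarrow> (\<forall>\<kappa> m. m < d \<longrightarrow> linearises_at (\<lambda>p n. G \<kappa> p m n) (\<lambda>t x. fld \<kappa> t x m))"

lemma ex_linearisation: "\<exists>G. linearises G"
proof -
  have "\<exists>G. linearises_at G (\<lambda>t x. fld \<kappa> t x m)" if "m < d" for \<kappa> m
    unfolding linearises_at_def
    by (rule linearisation_along_solution[OF sol h_pos smooth_sum smooth_part[OF that, of \<kappa>]]) blast+
  then have "\<forall>a. \<exists>G. snd a < d \<longrightarrow> linearises_at G (\<lambda>t x. fld (fst a) t x (snd a))"
    by blast
  from choice[OF this] obtain G where "\<And>a. snd a < d \<Longrightarrow> linearises_at (G a) (\<lambda>t x. fld (fst a) t x (snd a))"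
    by blast
  then have "linearises (\<lambda>\<kappa> p m n. G (\<kappa>, m) p n)"
    unfolding linearises_def by fastforce
  then show ?thesis by blast
qed

text \<open>
  An error \<open>O(H\<^bsup>j\<^esup>)\<close> against the exact solution makes the quadratic remainder of the linearisation
  \<open>O(H\<^bsup>2j\<^esup>)\<close>, and the Taylor polynomials contribute \<open>O(H\<^sup>4)\<close>.  The statement is about an arbitrary filter
  because it serves for the exact solution and for all stages of all steps.
\<close>

lemma field_expansion_bigo:
  assumes G: "linearises G" and m: "m < d"
    and H: "(Hf \<longlongrightarrow> 0) F" and \<sigma>: "\<forall>\<^sub>F z in F. 0 \<le> Hf z * \<rho> z \<and> \<rho> z \<le> 1 \<and> 0 \<le> Hf z"
    and XR: "\<forall>\<^sub>F z in F. X z \<in> R d" and W: "\<And>z. W z [] = 1"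
    and X: "\<And>n. n < d \<Longrightarrow> (\<lambda>z. X z n - y t0 n - expansion d G K (Hf z) (W z) n) \<in> O[F](\<lambda>z. Hf z ^ Suc K)"
    and X0: "\<And>n. n < d \<Longrightarrow> ((\<lambda>z. X z n) \<longlongrightarrow> y t0 n) F"
    and err: "\<And>n. n < d \<Longrightarrow> (\<lambda>z. X z n - y (t0 + Hf z * \<rho> z) n) \<in> O[F](\<lambda>z. Hf z ^ j)"
    and K: "Suc K \<le> 4" "Suc K \<le> 2 * j"
  shows "(\<lambda>z. fld \<kappa> (t0 + Hf z * \<rho> z) (X z) m - field_expansion d G K \<kappa> (Hf z) (\<rho> z) (W z) m)
    \<in> O[F](\<lambda>z. Hf z ^ Suc K)"
proof -
  define \<sigma> where "\<sigma> z = Hf z * \<rho> z" for z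
  have \<sigma>b: "\<forall>\<^sub>F z in F. 0 \<le> \<sigma> z \<and> \<sigma> z \<le> Hf z"
    using \<sigma> by eventually_elim (auto simp: \<sigma>_def mult_left_le)
  have \<sigma>O: "\<sigma> \<in> O[F](Hf)"
    by (rule landau_o.bigI[of 1]) (use \<sigma>b in \<open>auto elim: eventually_mono\<close>)
  have \<sigma>1: "(\<lambda>z. \<sigma> z ^ p) \<in> O[F](\<lambda>z. 1)" for p
    using bigo_trans_power[OF landau_o.big_power[OF \<sigma>O, of p] H, of 0] by simp
  obtain \<delta> M where \<delta>: "\<delta> > 0" "M \<ge> 0" and lin: "\<And>\<sigma> x. 0 \<le> \<sigma> \<Longrightarrow> \<sigma> < \<delta> \<Longrightarrow> x \<in> R d \<Longrightarrow> (\<forall>n<d. \<bar>x n - y t0 n\<bar> < \<delta>) \<Longrightarrow>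
     \<bar>fld \<kappa> (t0 + \<sigma>) x m - (\<Sum>p<4. \<sigma> ^ p * (\<Sum>n\<le>d. G \<kappa> p m n * hat d (y t0) x n))\<bar>
       \<le> M * (\<sigma> ^ 4 + (\<Sum>n<d. \<bar>x n - y (t0 + \<sigma>) n\<bar>)\<^sup>2)"
    using G m unfolding linearises_def linearises_at_def by blast
  define E where "E z = (\<Sum>n<d. \<bar>X z n - y (t0 + \<sigma> z) n\<bar>)" for z
  have "E \<in> O[F](\<lambda>z. Hf z ^ j)"
    unfolding E_def using err by (intro big_sum_in_bigo) (simp add: \<sigma>_def)
  then have "(\<lambda>z. (E z)\<^sup>2) \<in> O[F](\<lambda>z. (Hf z ^ j)\<^sup>2)" by (rule landau_o.big_power)
  then have "(\<lambda>z. (E z)\<^sup>2) \<in> O[F](\<lambda>z. Hf z ^ (2 * j))" by (simp add: power_mult[symmetric] mult.commute)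
  then have E2: "(\<lambda>z. (E z)\<^sup>2) \<in> O[F](\<lambda>z. Hf z ^ Suc K)" using bigo_trans_power H K(2) by blast
  have "(\<lambda>z. \<sigma> z ^ 4) \<in> O[F](\<lambda>z. Hf z ^ Suc K)"
    using bigo_trans_power[OF landau_o.big_power[OF \<sigma>O, of 4] H K(1)] .
  then have bound: "(\<lambda>z. M * (\<sigma> z ^ 4 + (E z)\<^sup>2)) \<in> O[F](\<lambda>z. Hf z ^ Suc K)"
    using E2 by (intro bigo_const_mult sum_in_bigo)
  have near: "\<forall>\<^sub>F z in F. \<sigma> z < \<delta> \<and> (\<forall>n\<in>{..<d}. dist (X z n) (y t0 n) < \<delta>)"
  proof (intro eventually_conj eventually_ball_finite ballI)
    show "\<forall>\<^sub>F z in F. \<sigma> z < \<delta>"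
      using \<sigma>b tendstoD[OF H \<delta>(1)] by eventually_elim auto
  qed (use tendstoD[OF X0 \<delta>(1)] in auto)
  have 1: "(\<lambda>z. fld \<kappa> (t0 + \<sigma> z) (X z) m - (\<Sum>p<4. \<sigma> z ^ p * (\<Sum>n\<le>d. G \<kappa> p m n * hat d (y t0) (X z) n)))
      \<in> O[F](\<lambda>z. Hf z ^ Suc K)"
  proof (rule landau_o.big_trans[OF _ bound], rule landau_o.bigI[of 1])
    show "\<forall>\<^sub>F z in F. norm (fld \<kappa> (t0 + \<sigma> z) (X z) m - (\<Sum>p<4. \<sigma> z ^ p * (\<Sum>n\<le>d. G \<kappa> p m n * hat d (y t0) (X z) n)))
       \<le> 1 * norm (M * (\<sigma> z ^ 4 + (E z)\<^sup>2))"
      using near \<sigma>b XR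
    proof eventually_elim
      case (elim z)
      then show ?case using lin[of "\<sigma> z" "X z"] \<delta>(2) by (simp add: E_def dist_real_def abs_mult)
    qed
  qed simp
  have hat: "(\<lambda>z. hat d (y t0) (X z) n - expansion d G K (Hf z) (W z) n) \<in> O[F](\<lambda>z. Hf z ^ Suc K)" if "n \<le> d" for n
  proof (cases "n < d")
    case True
    then show ?thesis using X[OF True] by (simp add: hat_def)
  next
    case False
    then show ?thesis using that W by (simp add: hat_def expansion_hat)
  qed
  have "(\<lambda>z. \<Sum>p<4. \<sigma> z ^ p * (\<Sum>n\<le>d. G \<kappa> p m n * (hat d (y t0) (X z) n - expansion d G K (Hf z) (W z) n)))
     \<in> O[F](\<lambda>z. Hf z ^ Suc K)"
    by (intro big_sum_in_bigo bigo_bounded_mult[OF \<sigma>1] bigo_const_mult hat) auto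
  from sum_in_bigo(1)[OF 1 this] show ?thesis
    by (simp add: field_expansion_eq[OF m] \<sigma>_def right_diff_distrib sum_subtractf)
qed

lemma id_tendsto_at_0_nonneg: "((\<lambda>\<sigma>. \<sigma>) \<longlongrightarrow> 0) at_0_nonneg"
  unfolding at_0_nonneg_def by (intro filterlim_mono[OF filterlim_ident]) auto

lemma solution_derivative:
  assumes "\<sigma> \<in> {0..h}"
  shows "((\<lambda>\<sigma>. y (t0 + \<sigma>) n) has_real_derivative (\<Sum>\<kappa>\<in>{Fast, Slow}. fld \<kappa> (t0 + \<sigma>) (y (t0 + \<sigma>)) n)) (at \<sigma> within {0..h})"
proof -
  have "((\<lambda>\<tau>. y \<tau> n) has_real_derivative (\<Sum>\<kappa>\<in>{Fast, Slow}. fld \<kappa> (t0 + \<sigma>) (y (t0 + \<sigma>)) n)) (at (t0 + \<sigma>) within (+) t0 ` {0..h})"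
    using sol assms by (auto simp: solves_on_def add.commute)
  moreover have "((+) t0 has_real_derivative 1) (at \<sigma> within {0..h})"
    by (auto intro!: derivative_eq_intros)
  ultimately have "((\<lambda>\<tau>. y \<tau> n) \<circ> (+) t0 has_real_derivative (\<Sum>\<kappa>\<in>{Fast, Slow}. fld \<kappa> (t0 + \<sigma>) (y (t0 + \<sigma>)) n) * 1) (at \<sigma> within {0..h})"
    by (rule DERIV_image_chain)
  then show ?thesis by (simp add: comp_def)
qed

text \<open>
  One Picard iteration for each \<open>K\<close>.  On the exact solution the linearisation has no quadratic remainder.
\<close>

lemma exact_expansion:
  assumes G: "linearises G" and n: "n < d" and K: "K \<le> 4"
  shows "(\<lambda>\<sigma>. y (t0 + \<sigma>) n - y t0 n - expansion d G K \<sigma> exact_weight n) \<in> O[at_0_nonneg](\<lambda>\<sigma>. \<sigma> ^ Suc K)"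
  using n K
proof (induction K arbitrary: n)
  case 0
  have "((\<lambda>\<sigma>. \<Sum>\<kappa>\<in>{Fast, Slow}. fld \<kappa> (t0 + \<sigma>) (y (t0 + \<sigma>)) n) \<longlongrightarrow> (\<Sum>\<kappa>\<in>{Fast, Slow}. fld \<kappa> (t0 + 0) (y t0) n)) at_0_nonneg"
    by (intro tendsto_sum C_k_tendsto[OF smooth_part[OF 0(1)] solution_R(1)[OF sol h_pos]]
      solution_R(2)[OF sol h_pos] solution_tendsto[OF sol h_pos] tendsto_add tendsto_const id_tendsto_at_0_nonneg)
  then have *: "(\<lambda>\<sigma>. \<Sum>\<kappa>\<in>{Fast, Slow}. fld \<kappa> (t0 + \<sigma>) (y (t0 + \<sigma>)) n) \<in> O[at_0_nonneg](\<lambda>\<sigma>. \<sigma> ^ 0)"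
    by (intro bigoI_tendsto[where c = "\<Sum>\<kappa>\<in>{Fast, Slow}. fld \<kappa> (t0 + 0) (y t0) n"]) auto
  have "(\<lambda>\<sigma>. y (t0 + \<sigma>) n - y t0 n) \<in> O[at_0_nonneg](\<lambda>\<sigma>. \<sigma> ^ Suc 0)"
  proof (rule bigo_antiderivative[OF h_pos _ _ *])
    fix \<sigma> assume "\<sigma> \<in> {0..h}"
    from DERIV_diff[OF solution_derivative[OF this, of n] DERIV_const[of "y t0 n"]]
    show "((\<lambda>\<sigma>. y (t0 + \<sigma>) n - y t0 n) has_real_derivative (\<Sum>\<kappa>\<in>{Fast, Slow}. fld \<kappa> (t0 + \<sigma>) (y (t0 + \<sigma>)) n)) (at \<sigma> within {0..h})"
      by (simp only: diff_zero)
  qed simp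
  then show ?case using 0 by (simp add: expansion_0)
next
  case (Suc K)
  note n = Suc.prems(1)
  define \<phi>' where "\<phi>' \<sigma> = (\<Sum>\<kappa>\<in>{Fast, Slow}. fld \<kappa> (t0 + \<sigma> * 1) (y (t0 + \<sigma>)) n - field_expansion d G K \<kappa> \<sigma> 1 exact_weight n)" for \<sigma>
  have \<phi>': "\<phi>' \<in> O[at_0_nonneg](\<lambda>\<sigma>. \<sigma> ^ Suc K)"
    unfolding \<phi>'_def
  proof (rule big_sum_in_bigo, rule field_expansion_bigo[OF G n id_tendsto_at_0_nonneg, where j = 4])
    show "\<forall>\<^sub>F \<sigma> in at_0_nonneg. 0 \<le> \<sigma> * 1 \<and> (1::real) \<le> 1 \<and> 0 \<le> \<sigma>"
      unfolding eventually_at_0_nonneg by (auto intro: exI[of _ 1])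
  qed (use solution_R[OF sol h_pos] solution_tendsto[OF sol h_pos] Suc in auto)
  show ?case
  proof (rule bigo_antiderivative[OF h_pos _ _ \<phi>'])
    fix \<sigma> assume \<sigma>: "\<sigma> \<in> {0..h}"
    have D: "((\<lambda>\<sigma>. \<sigma> * \<sigma> ^ (p + chain_order w) * exact_weight ((\<kappa>, p) # w) * elem_vec d G ((\<kappa>, p) # w) n) has_real_derivative
        \<sigma> ^ (p + chain_order w) * (1 ^ p * exact_weight w) * elem_vec d G ((\<kappa>, p) # w) n) (at \<sigma> within {0..h})" for \<kappa> p w
    proof -
      have "((\<lambda>\<sigma>. \<sigma> ^ Suc (p + chain_order w) * (exact_weight ((\<kappa>, p) # w) * elem_vec d G ((\<kappa>, p) # w) n)) has_real_derivative
        (real (Suc (p + chain_order w)) * \<sigma> ^ (p + chain_order w)) * (exact_weight ((\<kappa>, p) # w) * elem_vec d G ((\<kappa>, p) # w) n)) (at \<sigma> within {0..h})"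
        by (rule derivative_eq_intros refl)+ simp
      then show ?thesis by (simp add: mult_ac del: elem_vec.simps)
    qed
    have "((\<lambda>\<sigma>. expansion d G (Suc K) \<sigma> exact_weight n) has_real_derivative
      (\<Sum>\<kappa>\<in>{Fast, Slow}. field_expansion d G K \<kappa> \<sigma> 1 exact_weight n)) (at \<sigma> within {0..h})"
      unfolding expansion_Suc[OF n] field_expansion_def by (intro DERIV_sum D)
    from DERIV_diff[OF DERIV_diff[OF solution_derivative[OF \<sigma>, of n] DERIV_const] this]
    show "((\<lambda>\<sigma>. y (t0 + \<sigma>) n - y t0 n - expansion d G (Suc K) \<sigma> exact_weight n) has_real_derivative \<phi>' \<sigma>) (at \<sigma> within {0..h})"
      by (simp only: \<phi>'_def sum_subtractf diff_zero mult_1_right)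
  qed (simp add: expansion_Suc n)
qed

end

section \<open>The expansion of the numerical solution\<close>

lemma poly_unit_interval_bound:
  fixes p :: "real poly"
  assumes "0 \<le> t" "t \<le> 1"
  shows "\<bar>poly p t\<bar> \<le> (\<Sum>k\<le>degree p. \<bar>coeff p k\<bar>)"
proof -
  have "\<bar>poly p t\<bar> \<le> (\<Sum>k\<le>degree p. \<bar>coeff p k * t ^ k\<bar>)"
    unfolding Polynomial.poly_altdef by (rule sum_abs)
  also have "\<dots> \<le> (\<Sum>k\<le>degree p. \<bar>coeff p k\<bar>)"
    using assms by (intro sum_mono) (auto simp: abs_mult power_le_one mult_left_le)
  finally show ?thesis .
qed

text \<open>
  At the first time at which the bound \<open>\<delta>\<close> is reached, the premise on initial segments yields
  a contradiction.
\<close>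

lemma continuous_no_exit:
  fixes \<rho> :: "real \<Rightarrow> real"
  assumes cont: "continuous_on {0..H} \<rho>" and "\<rho> 0 < \<delta>"
    and stay: "\<And>\<theta>. \<theta> \<in> {0..H} \<Longrightarrow> (\<And>\<tau>. \<tau> \<in> {0..\<theta>} \<Longrightarrow> \<rho> \<tau> \<le> \<delta>) \<Longrightarrow> \<rho> \<theta> < \<delta>"
    and "\<theta> \<in> {0..H}"
  shows "\<rho> \<theta> < \<delta>"
proof (rule ccontr)
  assume "\<not> \<rho> \<theta> < \<delta>"
  define S where "S = {\<tau> \<in> {0..H}. \<rho> \<tau> = \<delta>}"
  have "S = {0..H} \<inter> \<rho> -` {\<delta>}" by (auto simp: S_def)
  then have "closed S" using continuous_closed_preimage[OF cont] by simp
  moreover have "{0..H} \<inter> S = S" by (auto simp: S_def)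
  ultimately have "compact S" using compact_Int_closed[of "{0..H}" S] by simp
  have hit: "\<exists>\<tau>'\<in>S. \<tau>' \<le> \<tau>" if \<tau>: "\<tau> \<in> {0..H}" "\<rho> \<tau> \<ge> \<delta>" for \<tau>
  proof -
    have "continuous_on {0..\<tau>} \<rho>" using \<tau> by (intro continuous_on_subset[OF cont]) auto
    then obtain \<tau>' where "0 \<le> \<tau>'" "\<tau>' \<le> \<tau>" "\<rho> \<tau>' = \<delta>"
      using IVT'[of \<rho> 0 \<delta> \<tau>] less_imp_le[OF assms(2)] \<tau> by auto
    then show ?thesis using \<tau> by (auto simp: S_def)
  qed
  have "S \<noteq> {}" using hit[of \<theta>] assms(4) \<open>\<not> \<rho> \<theta> < \<delta>\<close> by auto
  then obtain \<theta>0 where \<theta>0: "\<theta>0 \<in> S" "\<And>\<tau>. \<tau> \<in> S \<Longrightarrow> \<theta>0 \<le> \<tau>"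
    using compact_attains_inf[OF \<open>compact S\<close>] by blast
  have "\<rho> \<theta>0 < \<delta>"
  proof (rule stay)
    fix \<tau> assume \<tau>: "\<tau> \<in> {0..\<theta>0}"
    show "\<rho> \<tau> \<le> \<delta>"
    proof (rule ccontr)
      assume *: "\<not> \<rho> \<tau> \<le> \<delta>"
      then obtain \<tau>' where "\<tau>' \<in> S" "\<tau>' \<le> \<tau>" using hit[of \<tau>] \<tau> \<theta>0(1) by (auto simp: S_def)
      then have "\<tau>' = \<tau>" using \<theta>0(2) \<tau> by force
      then show False using * \<open>\<tau>' \<in> S\<close> by (simp add: S_def)
    qed
  qed (use \<theta>0 in \<open>simp add: S_def\<close>)
  then show False using \<theta>0(1) by (simp add: S_def)
qed

text \<open>
  Estimates have to be uniform in the inner time \<open>\<theta>\<close> and in all steps \<open>x\<close> of size \<open>H\<close>.  Taking limits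
  along this filter on triples \<open>(H, \<theta>, x)\<close> expresses this with the usual \<open>O\<close>.
\<close>

definition step_filter :: "(real \<Rightarrow> 'x \<Rightarrow> bool) \<Rightarrow> (real \<times> real \<times> 'x) filter" where
  "step_filter P = inf (filtercomap fst (at_right 0)) (principal {(H, \<theta>, x). 0 \<le> \<theta> \<and> \<theta> \<le> H \<and> P H x})"

lemma eventually_step_filter:
  "eventually Q (step_filter P) \<longleftrightarrow> (\<forall>\<^sub>F H in at_right 0. \<forall>\<theta> x. 0 \<le> \<theta> \<longrightarrow> \<theta> \<le> H \<longrightarrow> P H x \<longrightarrow> Q (H, \<theta>, x))"
  (is "?l \<longleftrightarrow> ?r")
proof
  assume ?l
  then obtain E where E: "eventually E (at_right 0)" "\<And>z. E (fst z) \<Longrightarrow> z \<in> {(H, \<theta>, x). 0 \<le> \<theta> \<and> \<theta> \<le> H \<and> P H x} \<longrightarrow> Q z"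
    unfolding step_filter_def eventually_inf_principal eventually_filtercomap by blast
  from E(1) show ?r by eventually_elim (use E(2) in force)
next
  assume ?r
  then show ?l
    unfolding step_filter_def eventually_inf_principal eventually_filtercomap by fastforce
qed

lemma step_filterI:
  assumes "\<And>H \<theta> x. 0 < H \<Longrightarrow> 0 \<le> \<theta> \<Longrightarrow> \<theta> \<le> H \<Longrightarrow> P H x \<Longrightarrow> Q (H, \<theta>, x)"
  shows "eventually Q (step_filter P)"
  unfolding eventually_step_filter using eventually_at_right_less[of 0]
  by eventually_elim (use assms in auto)

lemma tendsto_step_size: "(fst \<longlongrightarrow> 0) (step_filter P)"
proof -
  have "filterlim fst (at_right 0) (filtercomap fst (at_right (0::real)))" by (rule filterlim_filtercomap)
  then have "filterlim fst (at_right 0) (step_filter P)"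
    unfolding step_filter_def by (rule filterlim_mono) auto
  then show ?thesis by (rule filterlim_mono) (auto simp: at_within_def)
qed

lemma filterlim_step_time:
  "filterlim (\<lambda>z. (fst z, fst z, snd (snd z))) (step_filter P) (step_filter P)"
  unfolding filterlim_iff eventually_step_filter
  by (auto elim!: eventually_mono)

text \<open>
  The end of the inner interval is one of the times for which an estimate along the filter is uniform.
\<close>

lemma bigo_step_time:
  assumes "g \<in> O[step_filter P](\<lambda>z. fst z ^ k)"
  shows "(\<lambda>z. g (fst z, fst z, snd (snd z))) \<in> O[step_filter P](\<lambda>z. fst z ^ k)"
  using landau_o.big.compose[OF assms filterlim_step_time] by simp

text \<open>
  The mean value inequality on \<open>[0, H]\<close>, with the same constant for all steps.
\<close>

lemma bigo_uniform_antiderivative: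
  fixes \<phi> \<phi>' :: "real \<times> real \<times> 'x \<Rightarrow> real"
  assumes D: "\<And>H \<theta> x. 0 < H \<Longrightarrow> 0 \<le> \<theta> \<Longrightarrow> \<theta> \<le> H \<Longrightarrow> P H x \<Longrightarrow>
      ((\<lambda>\<theta>. \<phi> (H, \<theta>, x)) has_real_derivative \<phi>' (H, \<theta>, x)) (at \<theta> within {0..H})"
    and "\<phi>' \<in> O[step_filter P](\<lambda>z. fst z ^ k)"
  shows "(\<lambda>z. \<phi> z - \<phi> (fst z, 0, snd (snd z))) \<in> O[step_filter P](\<lambda>z. fst z ^ Suc k)"
proof -
  obtain C where C: "C > 0" "\<forall>\<^sub>F z in step_filter P. norm (\<phi>' z) \<le> C * norm (fst z ^ k)"
    using assms(2) by (elim landau_o.bigE)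
  show ?thesis
  proof (rule landau_o.bigI[of C])
    show "\<forall>\<^sub>F z in step_filter P. norm (\<phi> z - \<phi> (fst z, 0, snd (snd z))) \<le> C * norm (fst z ^ Suc k)"
      using C(2) eventually_at_right_less[of 0] unfolding eventually_step_filter
    proof eventually_elim
      case (elim H)
      show ?case
      proof (intro allI impI)
        fix \<theta> x assume \<theta>: "0 \<le> \<theta>" "\<theta> \<le> H" and P: "P H x"
        have "\<bar>\<phi> (H, \<theta>, x) - \<phi> (H, 0, x)\<bar> \<le> (C * H ^ k) * \<theta>"
        proof (rule mean_value_bound[OF \<theta>])
          fix \<tau> assume "\<tau> \<in> {0..H}"
          then show "((\<lambda>\<theta>. \<phi> (H, \<theta>, x)) has_real_derivative \<phi>' (H, \<tau>, x)) (at \<tau> within {0..H})"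
            using D elim(2) P by simp
        next
          fix \<tau> assume "\<tau> \<in> {0..\<theta>}"
          then have "norm (\<phi>' (H, \<tau>, x)) \<le> C * norm (fst (H, \<tau>, x) ^ k)" using elim(1) P \<theta> by simp
          then show "\<bar>\<phi>' (H, \<tau>, x)\<bar> \<le> C * H ^ k" using elim(2) by simp
        qed
        also have "\<dots> \<le> (C * H ^ k) * H" using \<theta> C(1) elim(2) by (intro mult_left_mono) auto
        finally show "norm (\<phi> (H, \<theta>, x) - \<phi> (fst (H, \<theta>, x), 0, snd (snd (H, \<theta>, x)))) \<le> C * norm (fst (H, \<theta>, x) ^ Suc k)"
          using elim(2) by (simp add: abs_mult mult_ac)
      qed
    qed
  qed (use C in auto)
qed

locale ipc_problem = ipc_method s A b c \<gamma> \<psi> + split_problem d fF fS t0 h y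
  for s A b c \<gamma> \<psi> d fF fS t0 h y
begin

definition is_step :: "real \<Rightarrow> real \<Rightarrow> (nat \<Rightarrow> state) \<times> (nat \<Rightarrow> state) \<times> (nat \<Rightarrow> real \<Rightarrow> state) \<Rightarrow> bool" where
  "is_step r H = (\<lambda>(Ystar, Y, v). ipc_step d s A c \<gamma> \<psi> fF fS t0 H (y t0) Ystar Y v \<and>
     (\<forall>i\<in>{1..s}. norm_R d (\<lambda>m. Ystar i m - y t0 m) \<le> r))"

text \<open>
  The right-hand side of the modified fast problem, with the times in the form \<open>t0 + H \<rho>\<close> used by
  \<open>field_expansion_bigo\<close>.
\<close>

definition inner_rhs where
  "inner_rhs Ystar Y v H i \<theta> m = delta c $ i * fF (t0 + H * (node c i + delta c $ i * (\<theta> / H))) (v (Suc i) \<theta>) m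
      + (\<Sum>j<s. poly (\<gamma> $$ (i, j)) (\<theta> / H) * fS (t0 + H * c $ j) (Y (Suc j)) m
             + poly (\<psi> $$ (i, j)) (\<theta> / H) * fS (t0 + H * c $ j) (Ystar (Suc j)) m)"

lemma is_stepD:
  assumes "is_step r H (Ystar, Y, v)" and i: "i < s" and H: "0 < H"
  shows "Y 0 = y t0" "Ystar (Suc i) \<in> R d" "v (Suc i) 0 = Y i" "v (Suc i) H = Y (Suc i)"
    "norm_R d (\<lambda>m. Ystar (Suc i) m - y t0 m) \<le> r"
    "Ystar (Suc i) m = y t0 m + H * ((\<Sum>j<i. A $$ (i, j) * (\<Sum>\<kappa>\<in>{Fast, Slow}. fld \<kappa> (t0 + H * c $ j) (Y (Suc j)) m))
      + A $$ (i, i) * (\<Sum>\<kappa>\<in>{Fast, Slow}. fld \<kappa> (t0 + H * c $ i) (Ystar (Suc i)) m))"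
    "\<theta> \<in> {0..H} \<Longrightarrow> v (Suc i) \<theta> \<in> R d"
    "\<theta> \<in> {0..H} \<Longrightarrow> ((\<lambda>\<theta>. v (Suc i) \<theta> m) has_real_derivative inner_rhs Ystar Y v H i \<theta> m) (at \<theta> within {0..H})"
proof -
  have step: "ipc_step d s A c \<gamma> \<psi> fF fS t0 H (y t0) Ystar Y v"
    and r: "\<forall>i\<in>{1..s}. norm_R d (\<lambda>m. Ystar i m - y t0 m) \<le> r"
    using assms(1) by (auto simp: is_step_def)
  show "Y 0 = y t0" "Ystar (Suc i) \<in> R d" "v (Suc i) 0 = Y i" "v (Suc i) H = Y (Suc i)"
    using step i by (auto simp: ipc_step_def Let_def)
  show "norm_R d (\<lambda>m. Ystar (Suc i) m - y t0 m) \<le> r" using r i by auto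
  show "Ystar (Suc i) m = y t0 m + H * ((\<Sum>j<i. A $$ (i, j) * (\<Sum>\<kappa>\<in>{Fast, Slow}. fld \<kappa> (t0 + H * c $ j) (Y (Suc j)) m))
      + A $$ (i, i) * (\<Sum>\<kappa>\<in>{Fast, Slow}. fld \<kappa> (t0 + H * c $ i) (Ystar (Suc i)) m))"
    using step i by (simp add: ipc_step_def Let_def mult.commute[of H "c $ _"] distrib_left)
  assume \<theta>: "\<theta> \<in> {0..H}"
  have sol': "solves_on d
           (\<lambda>\<theta> x m. delta c $ i * fF (t0 + node c i * H + delta c $ i * \<theta>) x m
              + (\<Sum>j<i. poly (\<gamma> $$ (i, j)) (\<theta> / H) * fS (t0 + node c (Suc j) * H) (Y (Suc j)) m)
              + (\<Sum>j\<le>i. poly (\<psi> $$ (i, j)) (\<theta> / H) * fS (t0 + node c (Suc j) * H) (Ystar (Suc j)) m))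
           (v (Suc i)) 0 H"
    using step i unfolding ipc_step_def Let_def by blast
  then show "v (Suc i) \<theta> \<in> R d" using \<theta> unfolding solves_on_def by blast
  have rhs: "delta c $ i * fF (t0 + node c i * H + delta c $ i * \<theta>) (v (Suc i) \<theta>) m
              + (\<Sum>j<i. poly (\<gamma> $$ (i, j)) (\<theta> / H) * fS (t0 + node c (Suc j) * H) (Y (Suc j)) m)
              + (\<Sum>j\<le>i. poly (\<psi> $$ (i, j)) (\<theta> / H) * fS (t0 + node c (Suc j) * H) (Ystar (Suc j)) m)
     = inner_rhs Ystar Y v H i \<theta> m"
  proof -
    have "t0 + node c i * H + delta c $ i * \<theta> = t0 + H * (node c i + delta c $ i * (\<theta> / H))"
      using H by (simp add: field_simps)
    then show ?thesis
      by (simp add: inner_rhs_def slow_forcing_sum[OF i] add.assoc mult.commute[of _ H])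
  qed
  show "((\<lambda>\<theta>. v (Suc i) \<theta> m) has_real_derivative inner_rhs Ystar Y v H i \<theta> m) (at \<theta> within {0..H})"
    using sol' \<theta> unfolding solves_on_def rhs[symmetric] by blast
qed

lemma fields_locally_bounded:
  "\<exists>\<delta>>0. \<exists>B\<ge>0. \<forall>\<kappa> m t x. m < d \<longrightarrow> \<bar>t - t0\<bar> < \<delta> \<longrightarrow> x \<in> R d \<longrightarrow> (\<forall>k<d. \<bar>x k - y t0 k\<bar> < \<delta>) \<longrightarrow>
     \<bar>fld \<kappa> t x m\<bar> \<le> B"
proof -
  note y0 = solution_R(1)[OF sol h_pos]
  have "\<forall>\<^sub>F \<delta> in at_right 0. 0 < \<delta> \<and> (\<forall>\<kappa>\<in>{Fast, Slow}. \<forall>m\<in>{..<d}. \<forall>t x. \<bar>t - t0\<bar> < \<delta> \<longrightarrow> x \<in> R d \<longrightarrow> (\<forall>k<d. \<bar>x k - y t0 k\<bar> < \<delta>) \<longrightarrow>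
     \<bar>fld \<kappa> t x m\<bar> \<le> \<bar>fld \<kappa> t0 (y t0) m\<bar> + 1)"
    by (intro eventually_conj eventually_at_right_less eventually_ball_finite ballI C_k_locally_bounded[OF smooth_part y0]) auto
  from eventually_happens'[OF trivial_limit_at_right_real this] obtain \<delta> where \<delta>: "\<delta> > 0"
    "\<And>\<kappa> m t x. \<kappa> \<in> {Fast, Slow} \<Longrightarrow> m < d \<Longrightarrow> \<bar>t - t0\<bar> < \<delta> \<Longrightarrow> x \<in> R d \<Longrightarrow> (\<forall>k<d. \<bar>x k - y t0 k\<bar> < \<delta>) \<Longrightarrow>
     \<bar>fld \<kappa> t x m\<bar> \<le> \<bar>fld \<kappa> t0 (y t0) m\<bar> + 1"
    by blast
  define B where "B = (\<Sum>m<d. \<Sum>\<kappa>\<in>{Fast, Slow}. \<bar>fld \<kappa> t0 (y t0) m\<bar> + 1)"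
  have B: "\<bar>fld \<kappa> t0 (y t0) m\<bar> + 1 \<le> B" if "m < d" for \<kappa> m
  proof -
    have "\<bar>fld \<kappa> t0 (y t0) m\<bar> + 1 \<le> (\<Sum>\<kappa>\<in>{Fast, Slow}. \<bar>fld \<kappa> t0 (y t0) m\<bar> + 1)"
      by (cases \<kappa>) auto
    also have "\<dots> \<le> B" unfolding B_def
      using that by (intro member_le_sum[where f = "\<lambda>m. \<Sum>\<kappa>\<in>{Fast, Slow}. \<bar>fld \<kappa> t0 (y t0) m\<bar> + 1"] sum_nonneg) auto
    finally show ?thesis .
  qed
  have part: "\<kappa> \<in> {Fast, Slow}" for \<kappa> by (cases \<kappa>) auto
  have "B \<ge> 0" unfolding B_def by (intro sum_nonneg) auto
  moreover have "\<bar>fld \<kappa> t x m\<bar> \<le> B" if "m < d" "\<bar>t - t0\<bar> < \<delta>" "x \<in> R d" "\<forall>k<d. \<bar>x k - y t0 k\<bar> < \<delta>" for \<kappa> m t x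
    using \<delta>(2)[OF part[of \<kappa>] that] B[OF that(1), of \<kappa>] by linarith
  ultimately show ?thesis using \<delta>(1) by blast
qed

lemma delta_bounds: "i < s \<Longrightarrow> 0 \<le> delta c $ i" "i < s \<Longrightarrow> delta c $ i \<le> 1"
  using node_bounds[of i] c_bounds[of i] by (auto simp: delta_eq)

lemma inner_node_bounds:
  assumes "i < s" "0 \<le> \<tau>" "\<tau> \<le> 1"
  shows "0 \<le> node c i + delta c $ i * \<tau>" "node c i + delta c $ i * \<tau> \<le> 1"
proof -
  show "0 \<le> node c i + delta c $ i * \<tau>"
    using node_bounds(1)[OF assms(1)] delta_bounds(1)[OF assms(1)] assms(2) by simp
  have "delta c $ i * \<tau> \<le> delta c $ i * 1"
    using delta_bounds(1)[OF assms(1)] assms(3) by (intro mult_left_mono) auto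
  then show "node c i + delta c $ i * \<tau> \<le> 1"
    using c_bounds(2)[OF assms(1)] assms(1) by (simp add: delta_eq)
qed

text \<open>
  The closeness to the initial value is assumed for the predictor stages only.  Their slow forcing is
  therefore bounded; stage after stage, an inner solution can then not leave a neighbourhood in which
  the fields are bounded by \<open>B\<close>, because it moves by at most \<open>L H\<close>.
\<close>

lemma a_priori_bound:
  "\<exists>r>0. \<exists>C. \<forall>\<^sub>F H in at_right 0. \<forall>Ystar Y v. is_step r H (Ystar, Y, v) \<longrightarrow>
     (\<forall>m<d. \<forall>i<s. \<bar>Ystar (Suc i) m - y t0 m\<bar> \<le> C * H \<and> (\<forall>\<theta>\<in>{0..H}. \<bar>v (Suc i) \<theta> m - y t0 m\<bar> \<le> C * H))"
proof -
  obtain \<delta> B where \<delta>: "\<delta> > 0" "B \<ge> 0" and bd: "\<And>\<kappa> m t x. m < d \<Longrightarrow> \<bar>t - t0\<bar> < \<delta> \<Longrightarrow> x \<in> R d \<Longrightarrow> (\<forall>k<d. \<bar>x k - y t0 k\<bar> < \<delta>) \<Longrightarrow>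
     \<bar>fld \<kappa> t x m\<bar> \<le> B"
    using fields_locally_bounded by blast
  define P where "P = (\<Sum>i<s. \<Sum>j<s. (\<Sum>k\<le>degree (\<gamma> $$ (i, j)). \<bar>coeff (\<gamma> $$ (i, j)) k\<bar>) + (\<Sum>k\<le>degree (\<psi> $$ (i, j)). \<bar>coeff (\<psi> $$ (i, j)) k\<bar>))"
  have P: "\<bar>poly (\<gamma> $$ (i, j)) t\<bar> \<le> P" "\<bar>poly (\<psi> $$ (i, j)) t\<bar> \<le> P" if "i < s" "j < s" "0 \<le> t" "t \<le> 1" for i j t
  proof -
    define a where "a i j = (\<Sum>k\<le>degree (\<gamma> $$ (i, j)). \<bar>coeff (\<gamma> $$ (i, j)) k\<bar>)" for i j
    define b where "b i j = (\<Sum>k\<le>degree (\<psi> $$ (i, j)). \<bar>coeff (\<psi> $$ (i, j)) k\<bar>)" for i j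
    have ab: "0 \<le> a i j" "0 \<le> b i j" for i j unfolding a_def b_def by (auto intro: sum_nonneg)
    have "a i j + b i j \<le> (\<Sum>j<s. a i j + b i j)"
      using that ab by (intro member_le_sum[where f = "\<lambda>j. a i j + b i j"]) (auto intro: add_nonneg_nonneg)
    also have "\<dots> \<le> P" unfolding P_def a_def[symmetric] b_def[symmetric]
      using that ab by (intro member_le_sum[where f = "\<lambda>i. \<Sum>j<s. a i j + b i j"] sum_nonneg) (auto intro: add_nonneg_nonneg)
    finally have "a i j + b i j \<le> P" .
    then show "\<bar>poly (\<gamma> $$ (i, j)) t\<bar> \<le> P" "\<bar>poly (\<psi> $$ (i, j)) t\<bar> \<le> P"
      using poly_unit_interval_bound[OF that(3,4), of "\<gamma> $$ (i, j)"] poly_unit_interval_bound[OF that(3,4), of "\<psi> $$ (i, j)"] ab[of i j]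
      unfolding a_def b_def by linarith+
  qed
  have P0: "P \<ge> 0" unfolding P_def by (intro sum_nonneg add_nonneg_nonneg) auto
  define L where "L = B + (\<Sum>j<s. P * B + P * B)"
  have L0: "L \<ge> 0" unfolding L_def using \<delta>(2) P0 by (intro add_nonneg_nonneg sum_nonneg) auto
  define N where "N = (\<Sum>i<s. \<Sum>j<s. \<bar>A $$ (i, j)\<bar> * (2 * B))"
  define C where "C = real s * L + N"
  have N0: "N \<ge> 0" unfolding N_def using \<delta>(2) by (intro sum_nonneg) auto
  \<comment> \<open>So small a step keeps the sum of the \<open>d\<close> deviations below \<open>\<delta> / 2\<close> and all times within \<open>\<delta>\<close>.\<close>
  have "((\<lambda>H. (real d + 1) * (real s * L) * H + H) \<longlongrightarrow> (real d + 1) * (real s * L) * 0 + 0) (at_right 0)"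
    by (intro tendsto_intros)
  then have "\<forall>\<^sub>F H in at_right 0. (real d + 1) * (real s * L) * H + H < \<delta> / 2"
    using \<delta>(1) by (intro order_tendstoD(2)) auto
  then have "\<forall>\<^sub>F H in at_right 0. \<forall>Ystar Y v. is_step (\<delta> / 2) H (Ystar, Y, v) \<longrightarrow>
     (\<forall>m<d. \<forall>i<s. \<bar>Ystar (Suc i) m - y t0 m\<bar> \<le> C * H \<and> (\<forall>\<theta>\<in>{0..H}. \<bar>v (Suc i) \<theta> m - y t0 m\<bar> \<le> C * H))"
    using eventually_at_right_less[of 0]
  proof eventually_elim
    case (elim H)
    show ?case
    proof (intro allI impI)
      fix Ystar Y v assume step: "is_step (\<delta> / 2) H (Ystar, Y, v)"
      note D = is_stepD[OF step _ elim(2)]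
      have LH: "0 \<le> (real d + 1) * (real s * L) * H" "0 \<le> real s * L * H" using L0 elim(2) by auto
      have dLH: "real d * (real s * L * H) < \<delta> / 2" "real s * L * H < \<delta>"
      proof -
        have "(real d + 1) * (real s * L) * H = real d * (real s * L * H) + real s * L * H"
          by (simp add: algebra_simps)
        moreover have "0 \<le> real d * (real s * L * H)" using LH(2) by simp
        ultimately show "real d * (real s * L * H) < \<delta> / 2" "real s * L * H < \<delta>"
          using elim LH(2) \<delta>(1) by linarith+
      qed
      have H\<delta>: "H < \<delta>" using elim(1) LH \<delta>(1) by linarith
      have time: "\<bar>t0 + H * \<rho> - t0\<bar> < \<delta>" if "0 \<le> \<rho>" "\<rho> \<le> 1" for \<rho>
      proof -
        have "H * \<rho> \<le> H * 1" using that elim(2) by (intro mult_left_mono) auto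
        moreover have "0 \<le> H * \<rho>" using that elim(2) by simp
        ultimately show ?thesis using H\<delta> by linarith
      qed
      have ystar: "\<bar>Ystar (Suc j) m - y t0 m\<bar> < \<delta>" if "j < s" "m < d" for j m
        using abs_le_norm_R[OF that(2), of "\<lambda>m. Ystar (Suc j) m - y t0 m"] D(5)[OF that(1)] \<delta>(1) by linarith
      have inner: "\<forall>m<d. \<forall>\<theta>\<in>{0..H}. \<bar>v (Suc i) \<theta> m - y t0 m\<bar> \<le> real (Suc i) * L * H" if "i < s" for i
        using that
      proof (induction i rule: less_induct)
        case (less i)
        have le_s: "real (Suc k) * L * H \<le> real s * L * H" if "k < s" for k
          using that L0 elim(2) by (intro mult_right_mono) auto
        have Yb: "\<bar>Y (Suc j) m - y t0 m\<bar> \<le> real (Suc j) * L * H" if "j < i" "m < d" for j m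
        proof -
          have j: "j < s" using that(1) less.prems by simp
          have "H \<in> {0..H}" using elim(2) by simp
          then have "\<bar>v (Suc j) H m - y t0 m\<bar> \<le> real (Suc j) * L * H"
            using less.IH[OF that(1) j] that(2) by blast
          then show ?thesis unfolding D(4)[OF j] .
        qed
        have YR: "Y (Suc j) \<in> R d" if "j < s" for j using D(4)[OF that] D(7)[OF that, of H] elim(2) by simp
        have start: "\<bar>v (Suc i) 0 m - y t0 m\<bar> \<le> real i * L * H" if "m < d" for m
        proof (cases i)
          case 0
          then show ?thesis using D(1,3)[OF less.prems] by simp
        next
          case (Suc k)
          then show ?thesis using Yb[of k m] D(3)[OF less.prems] that by simp
        qed
        have rhs: "\<bar>inner_rhs Ystar Y v H i \<theta> m\<bar> \<le> L"
          if \<theta>: "\<theta> \<in> {0..H}" and m: "m < d" and near: "\<forall>k<d. \<bar>v (Suc i) \<theta> k - y t0 k\<bar> < \<delta>" for \<theta> m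
        proof -
          have \<tau>: "0 \<le> \<theta> / H" "\<theta> / H \<le> 1" using \<theta> elim(2) by auto
          have "\<bar>fF (t0 + H * (node c i + delta c $ i * (\<theta> / H))) (v (Suc i) \<theta>) m\<bar> \<le> B"
            using bd[OF m time[OF inner_node_bounds[OF less.prems \<tau>]] D(7)[OF less.prems \<theta>] near, of Fast] by simp
          then have 1: "\<bar>delta c $ i * fF (t0 + H * (node c i + delta c $ i * (\<theta> / H))) (v (Suc i) \<theta>) m\<bar> \<le> 1 * B"
            unfolding abs_mult using delta_bounds[OF less.prems] by (intro mult_mono) auto
          have 2: "\<bar>poly (\<gamma> $$ (i, j)) (\<theta> / H) * fS (t0 + H * c $ j) (Y (Suc j)) m
             + poly (\<psi> $$ (i, j)) (\<theta> / H) * fS (t0 + H * c $ j) (Ystar (Suc j)) m\<bar> \<le> P * B + P * B" if j: "j < s" for j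
          proof -
            have a: "\<bar>poly (\<gamma> $$ (i, j)) (\<theta> / H) * fS (t0 + H * c $ j) (Y (Suc j)) m\<bar> \<le> P * B"
            proof (cases "j < i")
              case True
              have "\<forall>k<d. \<bar>Y (Suc j) k - y t0 k\<bar> < \<delta>"
                using Yb[OF True] le_s[OF j] dLH(2) by fastforce
              then have "\<bar>fS (t0 + H * c $ j) (Y (Suc j)) m\<bar> \<le> B"
                using bd[OF m time[OF c_bounds[OF j]] YR[OF j], of Slow] by simp
              then show ?thesis unfolding abs_mult using P(1)[OF less.prems j \<tau>] P0 by (intro mult_mono) auto
            next
              case False
              then show ?thesis using \<gamma>_upper[of i j] j P0 \<delta>(2) by simp
            qed
            have "\<bar>fS (t0 + H * c $ j) (Ystar (Suc j)) m\<bar> \<le> B"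
              using bd[OF m time[OF c_bounds[OF j]] D(2)[OF j], of Slow] ystar[OF j] by simp
            then have "\<bar>poly (\<psi> $$ (i, j)) (\<theta> / H) * fS (t0 + H * c $ j) (Ystar (Suc j)) m\<bar> \<le> P * B"
              unfolding abs_mult using P(2)[OF less.prems j \<tau>] P0 by (intro mult_mono) auto
            then show ?thesis using a by linarith
          qed
          have "\<bar>\<Sum>j<s. poly (\<gamma> $$ (i, j)) (\<theta> / H) * fS (t0 + H * c $ j) (Y (Suc j)) m
             + poly (\<psi> $$ (i, j)) (\<theta> / H) * fS (t0 + H * c $ j) (Ystar (Suc j)) m\<bar> \<le> (\<Sum>j<s. P * B + P * B)"
            using 2 by (intro order_trans[OF sum_abs] sum_mono) auto
          then show ?thesis using 1 unfolding inner_rhs_def L_def by linarith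
        qed
        have drift: "\<bar>v (Suc i) \<theta> m - y t0 m\<bar> \<le> real (Suc i) * L * H"
          if \<theta>: "\<theta> \<in> {0..H}" and m: "m < d" and near: "\<And>\<tau>. \<tau> \<in> {0..\<theta>} \<Longrightarrow> \<forall>k<d. \<bar>v (Suc i) \<tau> k - y t0 k\<bar> < \<delta>" for \<theta> m
        proof -
          have "\<bar>v (Suc i) \<theta> m - v (Suc i) 0 m\<bar> \<le> L * \<theta>"
            by (rule mean_value_bound[OF _ _ D(8)[OF less.prems]]) (use \<theta> m rhs near in auto)
          also have "\<dots> \<le> L * H" using \<theta> L0 by (intro mult_left_mono) auto
          finally show ?thesis using start[OF m] by (simp add: distrib_right)
        qed
        \<comment> \<open>The sum, and not the maximum, of the deviations, so that continuity is immediate.\<close>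
        define \<rho> where "\<rho> \<theta> = (\<Sum>m<d. \<bar>v (Suc i) \<theta> m - y t0 m\<bar>)" for \<theta>
        have mem: "\<bar>v (Suc i) \<theta> m - y t0 m\<bar> \<le> \<rho> \<theta>" if "m < d" for \<theta> m
          unfolding \<rho>_def using that by (intro member_le_sum[where f = "\<lambda>m. \<bar>v (Suc i) \<theta> m - y t0 m\<bar>"]) auto
        have \<rho>_le: "\<rho> \<theta> < \<delta> / 2" if "\<And>m. m < d \<Longrightarrow> \<bar>v (Suc i) \<theta> m - y t0 m\<bar> \<le> real (Suc i) * L * H" for \<theta>
        proof -
          have "\<rho> \<theta> \<le> (\<Sum>m<d. real s * L * H)"
            unfolding \<rho>_def using that le_s[OF less.prems] by (intro sum_mono) (auto intro: order_trans)
          then show ?thesis using dLH(1) by simp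
        qed
        have \<rho>: "\<rho> \<theta> < \<delta> / 2" if \<theta>: "\<theta> \<in> {0..H}" for \<theta>
        proof (rule continuous_no_exit[OF _ _ _ \<theta>])
          have "continuous_on {0..H} (\<lambda>\<theta>. v (Suc i) \<theta> m)" for m
            using D(8)[OF less.prems] by (intro DERIV_continuous_on) auto
          then show "continuous_on {0..H} \<rho>" unfolding \<rho>_def by (intro continuous_intros) auto
          have "real i * L * H \<le> real (Suc i) * L * H" using L0 elim(2) by (intro mult_right_mono) auto
          then show "\<rho> 0 < \<delta> / 2" by (intro \<rho>_le) (use start in \<open>auto intro: order_trans\<close>)
          fix \<theta> assume *: "\<theta> \<in> {0..H}" "\<And>\<tau>. \<tau> \<in> {0..\<theta>} \<Longrightarrow> \<rho> \<tau> \<le> \<delta> / 2"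
          have "\<forall>k<d. \<bar>v (Suc i) \<tau> k - y t0 k\<bar> < \<delta>" if "\<tau> \<in> {0..\<theta>}" for \<tau>
            using *(2)[OF that] mem[of _ \<tau>] \<delta>(1) by fastforce
          then show "\<rho> \<theta> < \<delta> / 2" by (intro \<rho>_le drift[OF *(1)]) auto
        qed
        show ?case
        proof (intro allI impI ballI)
          fix m \<theta> assume m: "m < d" and \<theta>: "\<theta> \<in> {0..H}"
          show "\<bar>v (Suc i) \<theta> m - y t0 m\<bar> \<le> real (Suc i) * L * H"
          proof (rule drift[OF \<theta> m])
            fix \<tau> assume "\<tau> \<in> {0..\<theta>}"
            then have "\<rho> \<tau> < \<delta> / 2" using \<rho>[of \<tau>] \<theta> by auto
            then show "\<forall>k<d. \<bar>v (Suc i) \<tau> k - y t0 k\<bar> < \<delta>" using mem[of _ \<tau>] \<delta>(1) by fastforce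
          qed
        qed
      qed
      fix m i assume m: "m < d" and i: "i < s"
      have sLH: "real (Suc j) * L * H \<le> real s * L * H" if "j < s" for j
        using that L0 elim(2) by (intro mult_right_mono) auto
      have inner': "\<bar>v (Suc j) \<theta> k - y t0 k\<bar> \<le> real s * L * H" if "j < s" "k < d" "\<theta> \<in> {0..H}" for j k \<theta>
      proof -
        have "\<bar>v (Suc j) \<theta> k - y t0 k\<bar> \<le> real (Suc j) * L * H" using inner[OF that(1)] that by blast
        then show ?thesis using sLH[OF that(1)] by linarith
      qed
      have Yn: "\<forall>k<d. \<bar>Y (Suc j) k - y t0 k\<bar> < \<delta>" if "j < s" for j
        using inner'[OF that, of _ H] D(4)[OF that] elim(2) dLH(2) by force
      have fb: "\<bar>\<Sum>\<kappa>\<in>{Fast, Slow}. fld \<kappa> (t0 + H * c $ j) x m\<bar> \<le> 2 * B" if "j < s" "x \<in> R d" "\<forall>k<d. \<bar>x k - y t0 k\<bar> < \<delta>" for j x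
        using bd[OF m time[OF c_bounds[OF that(1)]] that(2,3), of Fast] bd[OF m time[OF c_bounds[OF that(1)]] that(2,3), of Slow] by simp
      have "\<bar>(\<Sum>j<i. A $$ (i, j) * (\<Sum>\<kappa>\<in>{Fast, Slow}. fld \<kappa> (t0 + H * c $ j) (Y (Suc j)) m))
          + A $$ (i, i) * (\<Sum>\<kappa>\<in>{Fast, Slow}. fld \<kappa> (t0 + H * c $ i) (Ystar (Suc i)) m)\<bar> \<le>
         (\<Sum>j<i. \<bar>A $$ (i, j)\<bar> * (2 * B)) + \<bar>A $$ (i, i)\<bar> * (2 * B)"
      proof (intro order_trans[OF abs_triangle_ineq] add_mono order_trans[OF sum_abs] sum_mono)
        fix j assume "j \<in> {..<i}"
        then have j: "j < s" using i by auto
        have "Y (Suc j) \<in> R d" using D(4)[OF j] D(7)[OF j, of H] elim(2) by simp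
        then show "\<bar>A $$ (i, j) * (\<Sum>\<kappa>\<in>{Fast, Slow}. fld \<kappa> (t0 + H * c $ j) (Y (Suc j)) m)\<bar> \<le> \<bar>A $$ (i, j)\<bar> * (2 * B)"
          unfolding abs_mult using fb[OF j _ Yn[OF j]] by (intro mult_left_mono) auto
      next
        show "\<bar>A $$ (i, i) * (\<Sum>\<kappa>\<in>{Fast, Slow}. fld \<kappa> (t0 + H * c $ i) (Ystar (Suc i)) m)\<bar> \<le> \<bar>A $$ (i, i)\<bar> * (2 * B)"
          unfolding abs_mult using fb[OF i D(2)[OF i]] ystar[OF i] by (intro mult_left_mono) auto
      qed
      also have "\<dots> = (\<Sum>j<Suc i. \<bar>A $$ (i, j)\<bar> * (2 * B))" by simp
      also have "\<dots> \<le> (\<Sum>j<s. \<bar>A $$ (i, j)\<bar> * (2 * B))"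
        using i \<delta>(2) by (intro sum_mono2) auto
      also have "\<dots> \<le> N" unfolding N_def
        using i \<delta>(2) by (intro member_le_sum[where f = "\<lambda>i. \<Sum>j<s. \<bar>A $$ (i, j)\<bar> * (2 * B)"] sum_nonneg) auto
      finally have "\<bar>Ystar (Suc i) m - y t0 m\<bar> \<le> H * N"
        unfolding D(6)[OF i, of m] using elim(2) by (simp add: abs_mult)
      then have "\<bar>Ystar (Suc i) m - y t0 m\<bar> \<le> C * H"
        using LH(2) unfolding C_def distrib_right mult.commute[of N H] by linarith
      moreover have "\<bar>v (Suc i) \<theta> m - y t0 m\<bar> \<le> C * H" if "\<theta> \<in> {0..H}" for \<theta>
        using inner'[OF i m that] mult_nonneg_nonneg[OF N0 less_imp_le[OF elim(2)]]
        unfolding C_def distrib_right by linarith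
      ultimately show "\<bar>Ystar (Suc i) m - y t0 m\<bar> \<le> C * H \<and> (\<forall>\<theta>\<in>{0..H}. \<bar>v (Suc i) \<theta> m - y t0 m\<bar> \<le> C * H)"
        by blast
    qed
  qed
  then show ?thesis using \<delta>(1) half_gt_zero by blast
qed

text \<open>
  The components of a point \<open>(H, \<theta>, Ystar, Y, v)\<close> of the filter: step size, scaled inner time, and the three
  kinds of stage values belonging to stage \<open>Suc i\<close>.
\<close>

abbreviation hh :: "real \<times> real \<times> (nat \<Rightarrow> state) \<times> (nat \<Rightarrow> state) \<times> (nat \<Rightarrow> real \<Rightarrow> state) \<Rightarrow> real" where
  "hh z \<equiv> fst z"

definition tau :: "real \<times> real \<times> (nat \<Rightarrow> state) \<times> (nat \<Rightarrow> state) \<times> (nat \<Rightarrow> real \<Rightarrow> state) \<Rightarrow> real" where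
  "tau z = fst (snd z) / fst z"

definition pred_stage :: "nat \<Rightarrow> real \<times> real \<times> (nat \<Rightarrow> state) \<times> (nat \<Rightarrow> state) \<times> (nat \<Rightarrow> real \<Rightarrow> state) \<Rightarrow> state" where
  "pred_stage i z = fst (snd (snd z)) (Suc i)"

definition stage :: "nat \<Rightarrow> real \<times> real \<times> (nat \<Rightarrow> state) \<times> (nat \<Rightarrow> state) \<times> (nat \<Rightarrow> real \<Rightarrow> state) \<Rightarrow> state" where
  "stage i z = fst (snd (snd (snd z))) (Suc i)"

definition inner_sol :: "nat \<Rightarrow> real \<times> real \<times> (nat \<Rightarrow> state) \<times> (nat \<Rightarrow> state) \<times> (nat \<Rightarrow> real \<Rightarrow> state) \<Rightarrow> state" where
  "inner_sol i z = snd (snd (snd (snd z))) (Suc i) (fst (snd z))"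

lemmas proj_defs = tau_def pred_stage_def stage_def inner_sol_def

abbreviation "\<F> r \<equiv> step_filter (is_step r)"

abbreviation "OH r k \<equiv> O[\<F> r](\<lambda>z. fst z ^ k)"

text \<open>
  The expansion of all stage values over chains of length at most \<open>K\<close>.  The values at the end of an inner
  problem follow by \<open>stage_bigo\<close>.
\<close>

definition expands where
  "expands r G K \<longleftrightarrow> (\<forall>i<s. \<forall>n<d.
     (\<lambda>z. inner_sol i z n - y t0 n - expansion d G K (hh z) (\<lambda>w. poly (V w i) (tau z)) n) \<in> OH r (Suc K) \<and>
     (\<lambda>z. pred_stage i z n - y t0 n - expansion d G K (hh z) (\<lambda>w. U w i) n) \<in> OH r (Suc K))"

lemma eventually_step:
  assumes "\<And>H \<theta> Ystar Y v. 0 < H \<Longrightarrow> 0 \<le> \<theta> \<Longrightarrow> \<theta> \<le> H \<Longrightarrow> is_step r H (Ystar, Y, v) \<Longrightarrow> Q (H, \<theta>, Ystar, Y, v)"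
  shows "eventually Q (\<F> r)"
  by (rule step_filterI) (use assms in auto)

lemma tau_bounds: "\<forall>\<^sub>F z in \<F> r. 0 \<le> tau z \<and> tau z \<le> 1 \<and> 0 < hh z"
  by (rule eventually_step) (auto simp: tau_def)

lemma step_in_R:
  assumes "i < s"
  shows "\<forall>\<^sub>F z in \<F> r. inner_sol i z \<in> R d" "\<forall>\<^sub>F z in \<F> r. stage i z \<in> R d" "\<forall>\<^sub>F z in \<F> r. pred_stage i z \<in> R d"
proof -
  show "\<forall>\<^sub>F z in \<F> r. inner_sol i z \<in> R d"
    by (rule eventually_step) (auto simp: proj_defs intro: is_stepD(7)[OF _ assms])
  show "\<forall>\<^sub>F z in \<F> r. pred_stage i z \<in> R d"
    by (rule eventually_step) (auto simp: proj_defs intro: is_stepD(2)[OF _ assms])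
  show "\<forall>\<^sub>F z in \<F> r. stage i z \<in> R d"
  proof (rule eventually_step)
    fix H \<theta> Ystar Y v assume *: "0 < H" "is_step r H (Ystar, Y, v)"
    show "stage i (H, \<theta>, Ystar, Y, v) \<in> R d"
      using is_stepD(7)[OF *(2) assms *(1), of H] is_stepD(4)[OF *(2) assms *(1)] *(1) by (simp add: proj_defs)
  qed
qed

lemma inner_sol_end:
  assumes "i < s"
  shows "\<forall>\<^sub>F z in \<F> r. inner_sol i (hh z, hh z, snd (snd z)) = stage i z \<and> tau (hh z, hh z, snd (snd z)) = 1"
  by (rule eventually_step) (simp add: proj_defs is_stepD(4)[OF _ assms])

lemma stage_bigo:
  assumes i: "i < s"
    and "(\<lambda>z. inner_sol i z n - g (hh z) (tau z)) \<in> OH r k"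
  shows "(\<lambda>z. stage i z n - g (hh z) 1) \<in> OH r k"
proof -
  have 1: "(\<lambda>z. inner_sol i (hh z, hh z, snd (snd z)) n - g (hh z) (tau (hh z, hh z, snd (snd z)))) \<in> OH r k"
    using bigo_step_time[OF assms(2)] by simp
  have ev: "\<forall>\<^sub>F z in \<F> r. inner_sol i (hh z, hh z, snd (snd z)) n - g (hh z) (tau (hh z, hh z, snd (snd z)))
      = stage i z n - g (hh z) 1"
    using inner_sol_end[OF i, of r] by eventually_elim simp
  show ?thesis using 1 by (rule landau_o.big.in_cong[OF ev, THEN iffD1])
qed

lemma expandsD:
  assumes "expands r G K" "i < s" "n < d"
  shows "(\<lambda>z. inner_sol i z n - y t0 n - expansion d G K (hh z) (\<lambda>w. poly (V w i) (tau z)) n) \<in> OH r (Suc K)"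
    "(\<lambda>z. pred_stage i z n - y t0 n - expansion d G K (hh z) (\<lambda>w. U w i) n) \<in> OH r (Suc K)"
    "(\<lambda>z. stage i z n - y t0 n - expansion d G K (hh z) (\<lambda>w. poly (V w i) 1) n) \<in> OH r (Suc K)"
proof -
  show 1: "(\<lambda>z. inner_sol i z n - y t0 n - expansion d G K (hh z) (\<lambda>w. poly (V w i) (tau z)) n) \<in> OH r (Suc K)"
    and "(\<lambda>z. pred_stage i z n - y t0 n - expansion d G K (hh z) (\<lambda>w. U w i) n) \<in> OH r (Suc K)"
    using assms unfolding expands_def by auto
  show "(\<lambda>z. stage i z n - y t0 n - expansion d G K (hh z) (\<lambda>w. poly (V w i) 1) n) \<in> OH r (Suc K)"
    using stage_bigo[OF assms(2), where g = "\<lambda>H t. y t0 n + expansion d G K H (\<lambda>w. poly (V w i) t) n"] 1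
    by (simp only: diff_diff_eq)
qed

lemma poly_tau_bounded: "(\<lambda>z. poly p (tau z)) \<in> O[\<F> r](\<lambda>_. 1)"
proof (rule bigoI[of _ "\<Sum>k\<le>degree p. \<bar>coeff p k\<bar>"])
  show "\<forall>\<^sub>F z in \<F> r. norm (poly p (tau z)) \<le> (\<Sum>k\<le>degree p. \<bar>coeff p k\<bar>) * norm (1::real)"
    using tau_bounds by eventually_elim (use poly_unit_interval_bound in auto)
qed

text \<open>
  What is known of a stage value \<open>X\<close> at time \<open>t0 + H \<rho>\<close> with weights \<open>W\<close>: its expansion, and an error
  \<open>O(H\<^bsup>j\<^esup>)\<close> against the exact solution.
\<close>

definition expanded_value where
  "expanded_value r G K j X \<rho> W \<longleftrightarrow>
     (\<forall>\<^sub>F z in \<F> r. 0 \<le> hh z * \<rho> z \<and> \<rho> z \<le> 1 \<and> 0 \<le> hh z) \<and> (\<forall>\<^sub>F z in \<F> r. X z \<in> R d) \<and> (\<forall>z. W z [] = 1) \<and>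
     (\<forall>n<d. (\<lambda>z. X z n - y t0 n - expansion d G K (hh z) (W z) n) \<in> OH r (Suc K)) \<and>
     (\<forall>n<d. ((\<lambda>z. X z n) \<longlongrightarrow> y t0 n) (\<F> r)) \<and>
     (\<forall>n<d. (\<lambda>z. X z n - y (t0 + hh z * \<rho> z) n) \<in> OH r j)"

lemma field_at_expanded_value:
  assumes "linearises G" "m < d" "expanded_value r G K j X \<rho> W" "Suc K \<le> 4" "Suc K \<le> 2 * j"
  shows "(\<lambda>z. fld \<kappa> (t0 + hh z * \<rho> z) (X z) m - field_expansion d G K \<kappa> (hh z) (\<rho> z) (W z) m)
    \<in> OH r (Suc K)"
  using assms(3) unfolding expanded_value_def
  by (intro field_expansion_bigo[OF assms(1,2) tendsto_step_size _ _ _ _ _ _ assms(4,5)]) auto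

lemma expansion_pred_stage:
  assumes "n < d"
  shows "expansion d G (Suc K) H (\<lambda>w. U w i) n = H * ((\<Sum>j<i. A $$ (i, j) * (\<Sum>\<kappa>\<in>{Fast, Slow}. field_expansion d G K \<kappa> H (c $ j) (\<lambda>w. poly (V w j) 1) n))
      + A $$ (i, i) * (\<Sum>\<kappa>\<in>{Fast, Slow}. field_expansion d G K \<kappa> H (c $ i) (\<lambda>w. U w i) n))"
proof -
  have *: "(\<Sum>p<4. \<Sum>w\<in>bounded_chains K. H * H ^ (p + chain_order w) * U ((\<kappa>, p) # w) i * elem_vec d G ((\<kappa>, p) # w) n) =
     H * ((\<Sum>j<i. A $$ (i, j) * field_expansion d G K \<kappa> H (c $ j) (\<lambda>w. poly (V w j) 1) n)
      + A $$ (i, i) * field_expansion d G K \<kappa> H (c $ i) (\<lambda>w. U w i) n)" for \<kappa>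
  proof -
    have "(\<Sum>j<i. A $$ (i, j) * field_expansion d G K \<kappa> H (c $ j) (\<lambda>w. poly (V w j) 1) n) =
      (\<Sum>p<4. \<Sum>w\<in>bounded_chains K. H ^ (p + chain_order w) * (\<Sum>j<i. A $$ (i, j) * c $ j ^ p * poly (V w j) 1) * elem_vec d G ((\<kappa>, p) # w) n)"
      unfolding field_expansion_def sum_distrib_left sum_distrib_right
      by (subst sum.swap, rule sum.cong[OF refl], subst sum.swap) (simp only: mult_ac)
    moreover have "A $$ (i, i) * field_expansion d G K \<kappa> H (c $ i) (\<lambda>w. U w i) n =
      (\<Sum>p<4. \<Sum>w\<in>bounded_chains K. H ^ (p + chain_order w) * (A $$ (i, i) * c $ i ^ p * U w i) * elem_vec d G ((\<kappa>, p) # w) n)"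
      unfolding field_expansion_def sum_distrib_left by (simp only: mult_ac)
    ultimately show ?thesis
      unfolding sum.distrib[symmetric] sum_distrib_left[of H]
      by (simp only: sum.distrib[symmetric] sum_distrib_left[of H] U_Cons distrib_left distrib_right mult_ac)
  qed
  show ?thesis
    unfolding expansion_Suc[OF assms] sum_parts * by (simp add: distrib_left sum.distrib)
qed

text \<open>
  The expansion satisfies the modified fast problem of the linearised fields, up to chains of length
  \<open>K + 1\<close>.
\<close>

lemma expansion_inner_derivative:
  assumes n: "n < d" and H: "0 < H"
  shows "((\<lambda>\<theta>. expansion d G (Suc K) H (\<lambda>w. poly (V w i) (\<theta> / H)) n) has_real_derivative
     delta c $ i * field_expansion d G K Fast H (node c i + delta c $ i * (\<theta> / H)) (\<lambda>w. poly (V w i) (\<theta> / H)) n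
      + (\<Sum>j<s. poly (\<gamma> $$ (i, j)) (\<theta> / H) * field_expansion d G K Slow H (c $ j) (\<lambda>w. poly (V w j) 1) n
             + poly (\<psi> $$ (i, j)) (\<theta> / H) * field_expansion d G K Slow H (c $ j) (\<lambda>w. U w j) n)) (at \<theta> within S)"
proof -
  have D: "((\<lambda>\<theta>. H * H ^ (p + chain_order w) * poly (V ((\<kappa>, p) # w) i) (\<theta> / H) * elem_vec d G ((\<kappa>, p) # w) n) has_real_derivative
      H ^ (p + chain_order w) * poly (rate \<kappa> p (V w) (U w) i) (\<theta> / H) * elem_vec d G ((\<kappa>, p) # w) n) (at \<theta> within S)" for \<kappa> p w
  proof -
    have "((\<lambda>\<theta>. H * H ^ (p + chain_order w) * poly (V ((\<kappa>, p) # w) i) (\<theta> / H) * elem_vec d G ((\<kappa>, p) # w) n) has_real_derivative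
      H * H ^ (p + chain_order w) * (poly (rate \<kappa> p (V w) (U w) i) (\<theta> / H) / H) * elem_vec d G ((\<kappa>, p) # w) n) (at \<theta> within S)"
      unfolding pderiv_V_Cons[symmetric] by (intro DERIV_cmult_right DERIV_cmult has_derivative_poly_scaled[OF H])
    then show ?thesis using H by (simp del: elem_vec.simps)
  qed
  have fast: "(\<Sum>p<4. \<Sum>w\<in>bounded_chains K. H ^ (p + chain_order w) * poly (rate Fast p (V w) (U w) i) (\<theta> / H) * elem_vec d G ((Fast, p) # w) n) =
     delta c $ i * field_expansion d G K Fast H (node c i + delta c $ i * (\<theta> / H)) (\<lambda>w. poly (V w i) (\<theta> / H)) n"
    unfolding field_expansion_def sum_distrib_left rate_def by (simp add: poly_power mult_ac del: elem_vec.simps)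
  have slow: "(\<Sum>p<4. \<Sum>w\<in>bounded_chains K. H ^ (p + chain_order w) * poly (rate Slow p (V w) (U w) i) (\<theta> / H) * elem_vec d G ((Slow, p) # w) n) =
     (\<Sum>j<s. poly (\<gamma> $$ (i, j)) (\<theta> / H) * field_expansion d G K Slow H (c $ j) (\<lambda>w. poly (V w j) 1) n
             + poly (\<psi> $$ (i, j)) (\<theta> / H) * field_expansion d G K Slow H (c $ j) (\<lambda>w. U w j) n)"
  proof -
    have "(\<Sum>j<s. poly (\<gamma> $$ (i, j)) (\<theta> / H) * field_expansion d G K Slow H (c $ j) (\<lambda>w. poly (V w j) 1) n
             + poly (\<psi> $$ (i, j)) (\<theta> / H) * field_expansion d G K Slow H (c $ j) (\<lambda>w. U w j) n) =
      (\<Sum>j<s. \<Sum>p<4. \<Sum>w\<in>bounded_chains K. H ^ (p + chain_order w) * (c $ j ^ p * poly (V w j) 1 * poly (\<gamma> $$ (i, j)) (\<theta> / H)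
         + c $ j ^ p * U w j * poly (\<psi> $$ (i, j)) (\<theta> / H)) * elem_vec d G ((Slow, p) # w) n)"
      unfolding field_expansion_def sum_distrib_left sum.distrib[symmetric] by (intro sum.cong refl) (simp add: algebra_simps del: elem_vec.simps)
    also have "\<dots> = (\<Sum>p<4. \<Sum>w\<in>bounded_chains K. \<Sum>j<s. H ^ (p + chain_order w) * (c $ j ^ p * poly (V w j) 1 * poly (\<gamma> $$ (i, j)) (\<theta> / H)
         + c $ j ^ p * U w j * poly (\<psi> $$ (i, j)) (\<theta> / H)) * elem_vec d G ((Slow, p) # w) n)"
      by (subst sum.swap, rule sum.cong[OF refl], rule sum.swap)
    also have "\<dots> = (\<Sum>p<4. \<Sum>w\<in>bounded_chains K. H ^ (p + chain_order w) * poly (rate Slow p (V w) (U w) i) (\<theta> / H) * elem_vec d G ((Slow, p) # w) n)"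
      unfolding rate_def by (simp add: poly_sum sum_distrib_left sum_distrib_right del: elem_vec.simps)
    finally show ?thesis by simp
  qed
  have "((\<lambda>\<theta>. expansion d G (Suc K) H (\<lambda>w. poly (V w i) (\<theta> / H)) n) has_real_derivative
     (\<Sum>\<kappa>\<in>{Fast, Slow}. \<Sum>p<4. \<Sum>w\<in>bounded_chains K. H ^ (p + chain_order w) * poly (rate \<kappa> p (V w) (U w) i) (\<theta> / H) * elem_vec d G ((\<kappa>, p) # w) n)) (at \<theta> within S)"
    unfolding expansion_Suc[OF n] by (intro DERIV_sum D)
  then show ?thesis unfolding sum_parts fast slow .
qed

text \<open>
  One Picard iteration.  Inserting expansions of length \<open>K\<close> into the fields gives errors \<open>O(H\<^bsup>K+1\<^esup>)\<close>, and the
  factor \<open>H\<close> of the predictor, or the integration over an inner interval, gains one power.  The initial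
  value of an inner problem is the previous stage, which requires an induction over the stages.
\<close>

lemma expands_Suc:
  assumes G: "linearises G" and K: "Suc K \<le> 4" "Suc K \<le> 2 * j"
    and inner: "\<And>i. i < s \<Longrightarrow> expanded_value r G K j (inner_sol i) (\<lambda>z. node c i + delta c $ i * tau z) (\<lambda>z w. poly (V w i) (tau z))"
    and stage: "\<And>i. i < s \<Longrightarrow> expanded_value r G K j (stage i) (\<lambda>z. c $ i) (\<lambda>z w. poly (V w i) 1)"
    and pred: "\<And>i. i < s \<Longrightarrow> expanded_value r G K j (pred_stage i) (\<lambda>z. c $ i) (\<lambda>z w. U w i)"
  shows "expands r G (Suc K)"
proof -
  note fe = field_at_expanded_value[OF G _ _ K]
  have alg: "h * (a - b + (x - z)) = y0 + h * (a + x) - y0 - h * (b + z)" for h a b x z y0 :: real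
    by (simp add: algebra_simps)
  have pred_goal: "(\<lambda>z. pred_stage i z n - y t0 n - expansion d G (Suc K) (hh z) (\<lambda>w. U w i) n) \<in> OH r (Suc (Suc K))"
    if i: "i < s" and n: "n < d" for i n
  proof -
    define E where "E z = (\<Sum>j<i. A $$ (i, j) * (\<Sum>\<kappa>\<in>{Fast, Slow}. fld \<kappa> (t0 + hh z * c $ j) (stage j z) n - field_expansion d G K \<kappa> (hh z) (c $ j) (\<lambda>w. poly (V w j) 1) n))
      + A $$ (i, i) * (\<Sum>\<kappa>\<in>{Fast, Slow}. fld \<kappa> (t0 + hh z * c $ i) (pred_stage i z) n - field_expansion d G K \<kappa> (hh z) (c $ i) (\<lambda>w. U w i) n)" for z
    have "E \<in> OH r (Suc K)"
      unfolding E_def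
      by (intro sum_in_bigo(1) big_sum_in_bigo bigo_const_mult fe n stage pred i) (use i in auto)
    then have "(\<lambda>z. hh z * E z) \<in> O[\<F> r](\<lambda>z. hh z * hh z ^ Suc K)"
      by (intro landau_o.big_mult) auto
    moreover have "\<forall>\<^sub>F z in \<F> r. hh z * E z = pred_stage i z n - y t0 n - expansion d G (Suc K) (hh z) (\<lambda>w. U w i) n"
    proof (rule eventually_step)
      fix H \<theta> Ystar Y v assume H: "0 < H" and *: "is_step r H (Ystar, Y, v)"
      show "hh (H, \<theta>, Ystar, Y, v) * E (H, \<theta>, Ystar, Y, v) = pred_stage i (H, \<theta>, Ystar, Y, v) n - y t0 n - expansion d G (Suc K) (hh (H, \<theta>, Ystar, Y, v)) (\<lambda>w. U w i) n"
        unfolding expansion_pred_stage[OF n] E_def proj_defs fst_conv snd_conv is_stepD(6)[OF * i H, of n]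
        by (simp only: sum_subtractf right_diff_distrib[of "A $$ _"]) (rule alg)
    qed
    ultimately show ?thesis
      by (subst landau_o.big.in_cong[symmetric]) auto
  qed
  define \<phi> where "\<phi> i n z = inner_sol i z n - y t0 n - expansion d G (Suc K) (hh z) (\<lambda>w. poly (V w i) (tau z)) n" for i n z
  have inner_step: "(\<lambda>z. inner_sol i z n - y t0 n - expansion d G (Suc K) (hh z) (\<lambda>w. poly (V w i) (tau z)) n) \<in> OH r (Suc (Suc K))"
    if i: "i < s" and n: "n < d"
      and init: "\<forall>\<^sub>F z in \<F> r. \<phi> i n (hh z, 0, snd (snd z)) = g z" "g \<in> OH r (Suc (Suc K))" for i n g
  proof -
    define \<phi>' where "\<phi>' z = delta c $ i * (fld Fast (t0 + hh z * (node c i + delta c $ i * tau z)) (inner_sol i z) n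
          - field_expansion d G K Fast (hh z) (node c i + delta c $ i * tau z) (\<lambda>w. poly (V w i) (tau z)) n)
      + (\<Sum>j<s. poly (\<gamma> $$ (i, j)) (tau z) * (fld Slow (t0 + hh z * c $ j) (stage j z) n - field_expansion d G K Slow (hh z) (c $ j) (\<lambda>w. poly (V w j) 1) n)
             + poly (\<psi> $$ (i, j)) (tau z) * (fld Slow (t0 + hh z * c $ j) (pred_stage j z) n - field_expansion d G K Slow (hh z) (c $ j) (\<lambda>w. U w j) n))" for z
    have \<phi>'_bigo: "\<phi>' \<in> OH r (Suc K)"
      unfolding \<phi>'_def
      by (intro sum_in_bigo(1) big_sum_in_bigo bigo_const_mult bigo_bounded_mult[OF poly_tau_bounded] fe n inner stage pred i) auto
    have "(\<lambda>z. \<phi> i n z - \<phi> i n (fst z, 0, snd (snd z))) \<in> OH r (Suc (Suc K))"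
    proof (rule bigo_uniform_antiderivative[OF _ \<phi>'_bigo])
      fix H \<theta> x assume H: "0 < H" "0 \<le> \<theta>" "\<theta> \<le> H" and step: "is_step r H x"
      obtain Ystar Y v where x: "x = (Ystar, Y, v)" by (cases x)
      have \<theta>: "\<theta> \<in> {0..H}" using H by simp
      have "((\<lambda>\<theta>. \<phi> i n (H, \<theta>, x)) has_real_derivative inner_rhs Ystar Y v H i \<theta> n - 0 -
        (delta c $ i * field_expansion d G K Fast H (node c i + delta c $ i * (\<theta> / H)) (\<lambda>w. poly (V w i) (\<theta> / H)) n
      + (\<Sum>j<s. poly (\<gamma> $$ (i, j)) (\<theta> / H) * field_expansion d G K Slow H (c $ j) (\<lambda>w. poly (V w j) 1) n
             + poly (\<psi> $$ (i, j)) (\<theta> / H) * field_expansion d G K Slow H (c $ j) (\<lambda>w. U w j) n))) (at \<theta> within {0..H})"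
        unfolding \<phi>_def proj_defs x fst_conv snd_conv
        by (intro DERIV_diff DERIV_const is_stepD(8)[OF step[unfolded x] i H(1) \<theta>] expansion_inner_derivative[OF n H(1)])
      also have "inner_rhs Ystar Y v H i \<theta> n - 0 -
        (delta c $ i * field_expansion d G K Fast H (node c i + delta c $ i * (\<theta> / H)) (\<lambda>w. poly (V w i) (\<theta> / H)) n
      + (\<Sum>j<s. poly (\<gamma> $$ (i, j)) (\<theta> / H) * field_expansion d G K Slow H (c $ j) (\<lambda>w. poly (V w j) 1) n
             + poly (\<psi> $$ (i, j)) (\<theta> / H) * field_expansion d G K Slow H (c $ j) (\<lambda>w. U w j) n)) = \<phi>' (H, \<theta>, x)"
        unfolding \<phi>'_def inner_rhs_def proj_defs x fst_conv snd_conv by (simp add: right_diff_distrib sum.distrib sum_subtractf)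
      finally show "((\<lambda>\<theta>. \<phi> i n (H, \<theta>, x)) has_real_derivative \<phi>' (H, \<theta>, x)) (at \<theta> within {0..H})" .
    qed
    moreover have "(\<lambda>z. \<phi> i n (fst z, 0, snd (snd z))) \<in> OH r (Suc (Suc K))"
      using init(2) by (rule landau_o.big.in_cong[OF init(1), THEN iffD2])
    ultimately have "(\<lambda>z. \<phi> i n z - \<phi> i n (fst z, 0, snd (snd z)) + \<phi> i n (fst z, 0, snd (snd z))) \<in> OH r (Suc (Suc K))"
      by (rule sum_in_bigo)
    then have "(\<lambda>z. \<phi> i n z) \<in> OH r (Suc (Suc K))"
      by (simp only: diff_add_cancel)
    then show ?thesis unfolding \<phi>_def .
  qed
  have inner_goal: "(\<lambda>z. inner_sol i z n - y t0 n - expansion d G (Suc K) (hh z) (\<lambda>w. poly (V w i) (tau z)) n) \<in> OH r (Suc (Suc K))"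
    if i: "i < s" and n: "n < d" for i n
    using i
  proof (induction i)
    case 0
    show ?case
    proof (rule inner_step[OF 0 n], rule eventually_step)
      fix H \<theta> Ystar Y v assume H: "0 < H" and *: "is_step r H (Ystar, Y, v)"
      have "poly (V ((\<kappa>, p) # w) 0) 0 = 0" for \<kappa> p w by (simp add: V_Cons_0)
      then show "\<phi> 0 n (hh (H, \<theta>, Ystar, Y, v), 0, snd (snd (H, \<theta>, Ystar, Y, v))) = (\<lambda>_. 0) (H, \<theta>, Ystar, Y, v)"
        using is_stepD(1,3)[OF * 0 H] by (simp add: \<phi>_def proj_defs expansion_Suc[OF n])
    qed simp
  next
    case (Suc i)
    then have i: "i < s" by simp
    have IH: "(\<lambda>z. inner_sol i z n - (y t0 n + expansion d G (Suc K) (hh z) (\<lambda>w. poly (V w i) (tau z)) n)) \<in> OH r (Suc (Suc K))"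
      using Suc.IH[OF i] by (simp only: diff_diff_eq)
    show ?case
    proof (rule inner_step[OF Suc.prems n], rule eventually_step)
      show "(\<lambda>z. stage i z n - (y t0 n + expansion d G (Suc K) (hh z) (\<lambda>w. poly (V w i) 1) n)) \<in> OH r (Suc (Suc K))"
        by (rule stage_bigo[OF i, where g = "\<lambda>H t. y t0 n + expansion d G (Suc K) H (\<lambda>w. poly (V w i) t) n", OF IH])
      fix H \<theta> Ystar Y v assume H: "0 < H" and *: "is_step r H (Ystar, Y, v)"
      have "poly (V ((\<kappa>, p) # w) (Suc i)) 0 = poly (V ((\<kappa>, p) # w) i) 1" for \<kappa> p w by (simp only: V_Cons_0 V_Cons_1)
      then show "\<phi> (Suc i) n (hh (H, \<theta>, Ystar, Y, v), 0, snd (snd (H, \<theta>, Ystar, Y, v))) =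
          stage i (H, \<theta>, Ystar, Y, v) n - (y t0 n + expansion d G (Suc K) (hh (H, \<theta>, Ystar, Y, v)) (\<lambda>w. poly (V w i) 1) n)"
        using is_stepD(3)[OF * Suc.prems H] by (simp add: \<phi>_def proj_defs expansion_Suc[OF n])
    qed
  qed
  show ?thesis unfolding expands_def using pred_goal inner_goal by blast
qed

lemma expands_0:
  assumes r: "\<forall>\<^sub>F H in at_right 0. \<forall>Ystar Y v. is_step r H (Ystar, Y, v) \<longrightarrow>
     (\<forall>m<d. \<forall>i<s. \<bar>Ystar (Suc i) m - y t0 m\<bar> \<le> C * H \<and> (\<forall>\<theta>\<in>{0..H}. \<bar>v (Suc i) \<theta> m - y t0 m\<bar> \<le> C * H))"
  shows "expands r G 0"
  unfolding expands_def
proof (intro allI impI conjI)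
  fix i n assume i: "i < s" and n: "n < d"
  have "\<forall>\<^sub>F z in \<F> r. norm (inner_sol i z n - y t0 n) \<le> C * norm (hh z ^ Suc 0)"
    unfolding eventually_step_filter using r eventually_at_right_less[of 0]
    by eventually_elim (use i n in \<open>auto simp: proj_defs\<close>)
  then show "(\<lambda>z. inner_sol i z n - y t0 n - expansion d G 0 (hh z) (\<lambda>w. poly (V w i) (tau z)) n) \<in> OH r (Suc 0)"
    using n by (simp add: expansion_0 bigoI)
  have "\<forall>\<^sub>F z in \<F> r. norm (pred_stage i z n - y t0 n) \<le> C * norm (hh z ^ Suc 0)"
    unfolding eventually_step_filter using r eventually_at_right_less[of 0]
    by eventually_elim (use i n in \<open>auto simp: proj_defs\<close>)
  then show "(\<lambda>z. pred_stage i z n - y t0 n - expansion d G 0 (hh z) (\<lambda>w. U w i) n) \<in> OH r (Suc 0)"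
    using n by (simp add: expansion_0 bigoI)
qed

text \<open>
  \<open>H \<rho>\<close> is a time within the step.
\<close>

definition in_step where
  "in_step r \<rho> \<longleftrightarrow> (\<forall>\<^sub>F z in \<F> r. 0 \<le> hh z * \<rho> z \<and> \<rho> z \<le> 1 \<and> 0 \<le> hh z)"

lemma in_step_stages:
  assumes "i < s"
  shows "in_step r (\<lambda>z. node c i + delta c $ i * tau z)" "in_step r (\<lambda>z. c $ i)" "in_step r (\<lambda>z. 1)"
  unfolding in_step_def using tau_bounds
  by (eventually_elim; use inner_node_bounds[OF assms] c_bounds[OF assms] in auto)+

lemma in_step_filterlim:
  assumes "in_step r \<rho>"
  shows "filterlim (\<lambda>z. hh z * \<rho> z) at_0_nonneg (\<F> r)" "(\<lambda>z. hh z * \<rho> z) \<in> O[\<F> r](\<lambda>z. hh z)"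
proof -
  have b: "\<forall>\<^sub>F z in \<F> r. 0 \<le> hh z * \<rho> z \<and> hh z * \<rho> z \<le> hh z"
    using assms unfolding in_step_def by eventually_elim (auto simp: mult_left_le)
  show "(\<lambda>z. hh z * \<rho> z) \<in> O[\<F> r](\<lambda>z. hh z)"
    by (rule bigoI[of _ 1]) (use b in \<open>auto elim: eventually_mono\<close>)
  have "((\<lambda>z. hh z * \<rho> z) \<longlongrightarrow> 0) (\<F> r)"
    by (rule tendsto_sandwich[OF _ _ tendsto_const tendsto_step_size]) (use b in \<open>auto elim: eventually_mono\<close>)
  then show "filterlim (\<lambda>z. hh z * \<rho> z) at_0_nonneg (\<F> r)"
    unfolding at_0_nonneg_def filterlim_inf filterlim_principal using b by (auto elim: eventually_mono)
qed

lemma exact_expansion_in_step: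
  assumes G: "linearises G" and \<rho>: "in_step r \<rho>" and n: "n < d" and K: "K \<le> 4"
  shows "(\<lambda>z. y (t0 + hh z * \<rho> z) n - y t0 n - expansion d G K (hh z * \<rho> z) exact_weight n) \<in> OH r (Suc K)"
proof -
  have "(\<lambda>z. y (t0 + hh z * \<rho> z) n - y t0 n - expansion d G K (hh z * \<rho> z) exact_weight n) \<in> O[\<F> r](\<lambda>z. (hh z * \<rho> z) ^ Suc K)"
    using landau_o.big.compose[OF exact_expansion[OF G n K] in_step_filterlim(1)[OF \<rho>]] .
  also have "(\<lambda>z. (hh z * \<rho> z) ^ Suc K) \<in> OH r (Suc K)"
    by (rule landau_o.big_power[OF in_step_filterlim(2)[OF \<rho>]])
  finally show ?thesis .
qed

lemma stage_error_1:
  assumes G: "linearises G" and \<rho>: "in_step r \<rho>" and n: "n < d"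
    and X: "(\<lambda>z. X z n - y t0 n - expansion d G 0 (hh z) (W z) n) \<in> OH r 1"
  shows "(\<lambda>z. X z n - y (t0 + hh z * \<rho> z) n) \<in> OH r 1"
proof -
  from sum_in_bigo(2)[OF X exact_expansion_in_step[OF G \<rho> n, of 0, folded One_nat_def]]
  show ?thesis using n by (simp add: expansion_0)
qed

text \<open>
  The terms of order one agree because the weight \<open>\<rho>\<close> of a chain \<open>[(\<kappa>, 0)]\<close> is the position in time.
\<close>

lemma stage_error_2:
  assumes G: "linearises G" and \<rho>: "in_step r \<rho>" and n: "n < d"
    and X: "(\<lambda>z. X z n - y t0 n - expansion d G 1 (hh z) (W z) n) \<in> OH r 2"
    and W: "\<And>\<kappa> z. W z [(\<kappa>, 0)] = \<rho> z" "\<And>\<kappa> p. (\<lambda>z. W z [(\<kappa>, p)]) \<in> O[\<F> r](\<lambda>_. 1)"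
  shows "(\<lambda>z. X z n - y (t0 + hh z * \<rho> z) n) \<in> OH r 2"
proof -
  let ?\<sigma> = "\<lambda>z. hh z * \<rho> z"
  have exact: "(\<lambda>z. y (t0 + hh z * \<rho> z) n - y t0 n - expansion d G 1 (hh z * \<rho> z) exact_weight n) \<in> OH r 2"
    using exact_expansion_in_step[OF G \<rho> n, of 1] by (simp add: numeral_2_eq_2)
  have diff_term: "(\<lambda>z. hh z ^ Suc p * (W z [(\<kappa>, p)] * elem_vec d G [(\<kappa>, p)] n) - ?\<sigma> z ^ Suc p * (exact_weight [(\<kappa>, p)] * elem_vec d G [(\<kappa>, p)] n))
      \<in> OH r 2" for \<kappa> p
  proof (cases p)
    case 0
    then show ?thesis by (simp add: W(1) del: elem_vec.simps)
  next
    case (Suc p')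
    then have p: "2 \<le> Suc p" by simp
    have 1: "(\<lambda>z. hh z ^ Suc p) \<in> OH r 2"
      by (rule bigo_power_mono[OF tendsto_step_size p])
    have 2: "(\<lambda>z. ?\<sigma> z ^ Suc p) \<in> OH r 2"
      by (rule landau_o.big_trans[OF landau_o.big_power[OF in_step_filterlim(2)[OF \<rho>]] 1])
    have W1: "(\<lambda>z. W z [(\<kappa>, p)] * elem_vec d G [(\<kappa>, p)] n) \<in> O[\<F> r](\<lambda>_. 1)"
      by (rule bigo_bounded_mult[OF W(2)]) simp
    show ?thesis
      unfolding mult.commute[of "hh _ ^ Suc p"] mult.commute[of "?\<sigma> _ ^ Suc p"]
      by (intro sum_in_bigo(2) bigo_bounded_mult[OF W1 1] bigo_const_mult 2)
  qed
  have "(\<lambda>z. expansion d G 1 (hh z) (W z) n - expansion d G 1 (?\<sigma> z) exact_weight n) \<in> OH r 2"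
  proof -
    have eq: "expansion d G 1 (hh z) (W z) n - expansion d G 1 (?\<sigma> z) exact_weight n =
      (\<Sum>\<kappa>\<in>{Fast, Slow}. \<Sum>p<4. hh z ^ Suc p * (W z [(\<kappa>, p)] * elem_vec d G [(\<kappa>, p)] n) - ?\<sigma> z ^ Suc p * (exact_weight [(\<kappa>, p)] * elem_vec d G [(\<kappa>, p)] n))" for z
      unfolding One_nat_def expansion_Suc[OF n] by (simp only: sum_subtractf) (simp add: mult.assoc del: elem_vec.simps exact_weight.simps)
    show ?thesis unfolding eq by (intro big_sum_in_bigo diff_term)
  qed
  from sum_in_bigo(1)[OF sum_in_bigo(2)[OF X exact] this] show ?thesis by simp
qed

lemma expanded_values:
  assumes G: "linearises G" and E0: "expands r G 0" and E: "expands r G K" and i: "i < s"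
    and j: "j = 1 \<or> j = 2 \<and> expands r G 1"
  shows "expanded_value r G K j (inner_sol i) (\<lambda>z. node c i + delta c $ i * tau z) (\<lambda>z w. poly (V w i) (tau z))"
    "expanded_value r G K j (stage i) (\<lambda>z. c $ i) (\<lambda>z w. poly (V w i) 1)"
    "expanded_value r G K j (pred_stage i) (\<lambda>z. c $ i) (\<lambda>z w. U w i)"
proof -
  have lim: "((\<lambda>z. X z n) \<longlongrightarrow> y t0 n) (\<F> r)"
    if n: "n < d" and X: "(\<lambda>z. X z n - y t0 n - expansion d G 0 (hh z) (W z) n) \<in> OH r (Suc 0)" for X :: "_ \<Rightarrow> nat \<Rightarrow> real" and W n
  proof -
    obtain C where C: "\<forall>\<^sub>F z in \<F> r. norm (X z n - y t0 n) \<le> C * norm (hh z)"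
      using X n by (auto simp: expansion_0 elim: landau_o.bigE)
    have "((\<lambda>z. C * norm (hh z)) \<longlongrightarrow> C * norm (0::real)) (\<F> r)"
      by (intro tendsto_intros tendsto_step_size)
    then have "((\<lambda>z. C * norm (hh z)) \<longlongrightarrow> 0) (\<F> r)" by simp
    with C have "((\<lambda>z. X z n - y t0 n) \<longlongrightarrow> 0) (\<F> r)"
      by (rule Lim_null_comparison)
    then show ?thesis by (simp add: LIM_zero_iff)
  qed
  have err: "(\<lambda>z. X z n - y (t0 + hh z * \<rho> z) n) \<in> OH r j"
    if n: "n < d" and \<rho>: "in_step r \<rho>"
      and X: "(\<lambda>z. X z n - y t0 n - expansion d G 0 (hh z) (W z) n) \<in> OH r (Suc 0)"
      "expands r G 1 \<Longrightarrow> (\<lambda>z. X z n - y t0 n - expansion d G 1 (hh z) (W z) n) \<in> OH r (Suc 1)"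
      and W: "\<And>\<kappa> z. W z [(\<kappa>, 0)] = \<rho> z" "\<And>\<kappa> p. (\<lambda>z. W z [(\<kappa>, p)]) \<in> O[\<F> r](\<lambda>_. 1)"
    for X :: "_ \<Rightarrow> nat \<Rightarrow> real" and \<rho> W n
    using j
  proof
    assume "j = 1"
    then show ?thesis using stage_error_1[OF G \<rho> n, of X W] X(1) by simp
  next
    assume "j = 2 \<and> expands r G 1"
    then show ?thesis using stage_error_2[where X = X and W = W, OF G \<rho> n _ W] X(2) by (simp add: numeral_2_eq_2)
  qed
  show "expanded_value r G K j (inner_sol i) (\<lambda>z. node c i + delta c $ i * tau z) (\<lambda>z w. poly (V w i) (tau z))"
    unfolding expanded_value_def
  proof (intro conjI allI impI)
    fix n assume n: "n < d"
    show "((\<lambda>z. inner_sol i z n) \<longlongrightarrow> y t0 n) (\<F> r)" using lim[where X = "inner_sol i" and W = "\<lambda>z w. poly (V w i) (tau z)", OF n expandsD(1)[OF E0 i n]] .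
    show "(\<lambda>z. inner_sol i z n - y (t0 + hh z * (node c i + delta c $ i * tau z)) n) \<in> OH r j"
      by (rule err[where X = "inner_sol i" and W = "\<lambda>z w. poly (V w i) (tau z)" and \<rho> = "\<lambda>z. node c i + delta c $ i * tau z", OF n in_step_stages(1)[OF i] expandsD(1)[OF E0 i n] expandsD(1)[OF _ i n]])
        (simp_all add: V_leaf[OF i] poly_tau_bounded mult.commute)
  qed (use in_step_stages(1)[OF i] step_in_R(1)[OF i] expandsD(1)[OF E i] in \<open>simp_all add: in_step_def\<close>)
  show "expanded_value r G K j (stage i) (\<lambda>z. c $ i) (\<lambda>z w. poly (V w i) 1)"
    unfolding expanded_value_def
  proof (intro conjI allI impI)
    fix n assume n: "n < d"
    show "((\<lambda>z. stage i z n) \<longlongrightarrow> y t0 n) (\<F> r)" using lim[where X = "stage i" and W = "\<lambda>z w. poly (V w i) 1", OF n expandsD(3)[OF E0 i n]] .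
    show "(\<lambda>z. stage i z n - y (t0 + hh z * (c $ i)) n) \<in> OH r j"
      by (rule err[where X = "stage i" and W = "\<lambda>z w. poly (V w i) 1" and \<rho> = "\<lambda>z. c $ i", OF n in_step_stages(2)[OF i] expandsD(3)[OF E0 i n] expandsD(3)[OF _ i n]])
        (simp_all add: V_leaf[OF i] delta_eq i)
  qed (use in_step_stages(2)[OF i] step_in_R(2)[OF i] expandsD(3)[OF E i] in \<open>simp_all add: in_step_def\<close>)
  show "expanded_value r G K j (pred_stage i) (\<lambda>z. c $ i) (\<lambda>z w. U w i)"
    unfolding expanded_value_def
  proof (intro conjI allI impI)
    fix n assume n: "n < d"
    show "((\<lambda>z. pred_stage i z n) \<longlongrightarrow> y t0 n) (\<F> r)" using lim[where X = "pred_stage i" and W = "\<lambda>z w. U w i", OF n expandsD(2)[OF E0 i n]] .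
    show "(\<lambda>z. pred_stage i z n - y (t0 + hh z * (c $ i)) n) \<in> OH r j"
      by (rule err[where X = "pred_stage i" and W = "\<lambda>z w. U w i" and \<rho> = "\<lambda>z. c $ i", OF n in_step_stages(2)[OF i] expandsD(2)[OF E0 i n] expandsD(2)[OF _ i n]])
        (simp_all add: U_leaf[OF i])
  qed (use in_step_stages(2)[OF i] step_in_R(3)[OF i] expandsD(2)[OF E i] in \<open>simp_all add: in_step_def\<close>)
qed

text \<open>
  For the first two iterations the a priori error \<open>O(H)\<close> is good enough; they yield the error \<open>O(H\<^sup>2)\<close> that
  the other two need.
\<close>

lemma expands_4:
  assumes G: "linearises G" and E0: "expands r G 0"
  shows "expands r G 4"
proof -
  have E1: "expands r G 1"
    using expands_Suc[OF G _ _ expanded_values[OF G E0 E0, of _ 1]] by simp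
  have "expands r G 2"
    using expands_Suc[OF G _ _ expanded_values[OF G E0 E1, of _ 1]] by (simp add: numeral_2_eq_2)
  then have "expands r G 3"
    using expands_Suc[OF G _ _ expanded_values[OF G E0 _, of 2 _ 2]] E1 by (simp add: eval_nat_numeral)
  then show ?thesis
    using expands_Suc[OF G _ _ expanded_values[OF G E0 _, of 3 _ 2]] E1 by (simp add: eval_nat_numeral)
qed

lemma local_error:
  assumes W: "\<And>w. w \<noteq> [] \<Longrightarrow> chain_order w \<le> 4 \<Longrightarrow> poly (V w (s - 1)) 1 = exact_weight w"
  shows "\<exists>r>0. \<exists>C. \<forall>\<^sub>F H in at_right 0. \<forall>Ystar Y v. is_step r H (Ystar, Y, v) \<longrightarrow>
     norm_R d (\<lambda>m. Y s m - y (t0 + H) m) \<le> C * H ^ 5"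
proof -
  obtain G where G: "linearises G" using ex_linearisation by blast
  obtain r C where r: "r > 0" and C: "\<forall>\<^sub>F H in at_right 0. \<forall>Ystar Y v. is_step r H (Ystar, Y, v) \<longrightarrow>
     (\<forall>m<d. \<forall>i<s. \<bar>Ystar (Suc i) m - y t0 m\<bar> \<le> C * H \<and> (\<forall>\<theta>\<in>{0..H}. \<bar>v (Suc i) \<theta> m - y t0 m\<bar> \<le> C * H))"
    using a_priori_bound by blast
  have E: "expands r G 4" by (rule expands_4[OF G expands_0[OF C]])
  have last: "s - 1 < s" "Suc (s - 1) = s" using s_pos by auto
  have comp: "(\<lambda>z. stage (s - 1) z n - y (t0 + hh z) n) \<in> OH r 5" if n: "n < d" for n
  proof -
    \<comment> \<open>Chains of length at most 4 may have an order above 4; their terms are small individually.\<close>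
    have "(\<lambda>z. hh z ^ chain_order w * poly (V w (s - 1)) 1 * elem_vec d G w n - hh z ^ chain_order w * exact_weight w * elem_vec d G w n) \<in> OH r 5" for w
    proof (cases "chain_order w \<le> 4")
      case True
      then show ?thesis using W[of w] by (cases w) simp_all
    next
      case False
      then have "(\<lambda>z. hh z ^ chain_order w) \<in> OH r 5"
        by (intro bigo_power_mono[OF tendsto_step_size]) auto
      then show ?thesis
        unfolding mult.assoc mult.commute[of "hh _ ^ chain_order w"] by (intro sum_in_bigo(2) bigo_const_mult)
    qed
    then have 1: "(\<lambda>z. expansion d G 4 (hh z) (\<lambda>w. poly (V w (s - 1)) 1) n - expansion d G 4 (hh z) exact_weight n) \<in> OH r 5"
      unfolding expansion_def sum_subtractf[symmetric] by (intro big_sum_in_bigo)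
    have 2: "(\<lambda>z. stage (s - 1) z n - y t0 n - expansion d G 4 (hh z) (\<lambda>w. poly (V w (s - 1)) 1) n) \<in> OH r 5"
      using expandsD(3)[OF E last(1) n] by (simp only: Suc_numeral) simp
    have 3: "(\<lambda>z. y (t0 + hh z) n - y t0 n - expansion d G 4 (hh z) exact_weight n) \<in> OH r 5"
      using exact_expansion_in_step[OF G in_step_stages(3)[OF last(1)] n order_refl] by (simp only: mult_1_right Suc_numeral) simp
    from sum_in_bigo(1)[OF sum_in_bigo(2)[OF 2 3] 1]
    show ?thesis by simp
  qed
  have "(\<lambda>z. \<Sum>n<d. \<bar>stage (s - 1) z n - y (t0 + hh z) n\<bar>) \<in> OH r 5"
    by (intro big_sum_in_bigo) (use comp in simp)
  then obtain C' where "\<forall>\<^sub>F z in \<F> r. norm (\<Sum>n<d. \<bar>stage (s - 1) z n - y (t0 + hh z) n\<bar>) \<le> C' * norm (hh z ^ 5)"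
    by (elim landau_o.bigE)
  then have C': "\<forall>\<^sub>F H in at_right 0. \<forall>\<theta> x. 0 \<le> \<theta> \<longrightarrow> \<theta> \<le> H \<longrightarrow> is_step r H x \<longrightarrow>
      norm (\<Sum>n<d. \<bar>stage (s - 1) (H, \<theta>, x) n - y (t0 + hh (H, \<theta>, x)) n\<bar>) \<le> C' * norm (hh (H, \<theta>, x) ^ 5)"
    unfolding eventually_step_filter .
  have "\<forall>\<^sub>F H in at_right 0. \<forall>Ystar Y v. is_step r H (Ystar, Y, v) \<longrightarrow>
     norm_R d (\<lambda>m. Y s m - y (t0 + H) m) \<le> C' * H ^ 5"
    using C' eventually_at_right_less[of 0]
  proof eventually_elim
    case (elim H)
    show ?case
    proof (intro allI impI)
      fix Ystar Y v assume "is_step r H (Ystar, Y, v)"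
      then have "norm (\<Sum>n<d. \<bar>Y s n - y (t0 + H) n\<bar>) \<le> C' * norm (H ^ 5)"
        using elim(1)[rule_format, of 0 "(Ystar, Y, v)"] elim(2) last(2) by (simp add: stage_def)
      moreover have "norm_R d (\<lambda>m. Y s m - y (t0 + H) m) \<le> (\<Sum>n<d. \<bar>Y s n - y (t0 + H) n\<bar>)"
        by (rule L2_set_le_sum_abs)
      ultimately show "norm_R d (\<lambda>m. Y s m - y (t0 + H) m) \<le> C' * H ^ 5"
        using elim(2) by simp
    qed
  qed
  then show ?thesis using r by blast
qed

end

context ipc_method
begin

text \<open>
  Smoothness 5 is one derivative for the linearisation and four for the Taylor polynomials of its
  coefficients.
\<close>

theorem weights_imp_ipc_order:
  assumes W: "\<And>w. w \<noteq> [] \<Longrightarrow> chain_order w \<le> 4 \<Longrightarrow> poly (V w (s - 1)) 1 = exact_weight w"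
  shows "ipc_order_at_least s A c \<gamma> \<psi> 4"
  unfolding ipc_order_at_least_def ipc_error_def[symmetric]
proof (rule exI[of _ 5], intro allI impI)
  fix d fF fS t0 h y
  assume "smooth_field d 5 fF \<and> smooth_field d 5 fS" "0 < h \<and> solves_on d (\<lambda>t x m. fF t x m + fS t x m) y t0 (t0 + h)"
  then interpret ipc_problem s A b c \<gamma> \<psi> d fF fS t0 h y
    by unfold_locales auto
  show "ipc_error d fF fS t0 y 4"
    using local_error[OF W] by (simp add: ipc_error_def is_step_def)
qed

end

section \<open>The coupling conditions as chain conditions\<close>

definition moment :: "(nat \<Rightarrow> real) \<Rightarrow> real poly \<Rightarrow> real" where
  "moment f p = (\<Sum>k | coeff p k \<noteq> 0. f k * coeff p k)"

lemma moment_eq: "degree p \<le> N \<Longrightarrow> moment f p = (\<Sum>k\<le>N. f k * coeff p k)"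
  unfolding moment_def by (rule sum.mono_neutral_left) (use le_degree in \<open>force+\<close>)

lemma moment_add: "moment f (p + q) = moment f p + moment f q"
proof -
  have "degree (p + q) \<le> max (degree p) (degree q)" by (rule degree_add_le_max)
  then show ?thesis
    using moment_eq[of "p + q" "max (degree p) (degree q)" f] moment_eq[of p "max (degree p) (degree q)" f]
      moment_eq[of q "max (degree p) (degree q)" f] by (simp add: distrib_left sum.distrib)
qed

text \<open>
  The factors \<open>\<zeta>\<^sub>k\<close>, \<open>\<omega>\<^sub>k\<close>, \<open>\<xi>\<^sub>k\<close> are the values at 1 of iterated integrals of \<open>t\<^sup>k\<close>: integrated twice,
  integrated twice with a factor \<open>t\<close> in between, and integrated three times.
\<close>

definition "zeta_weight = (\<lambda>k. 1 / ((real k + 1) * (real k + 2)))"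
definition "omega_weight = (\<lambda>k. 1 / ((real k + 1) * (real k + 3)))"
definition "xi_weight = (\<lambda>k. 1 / ((real k + 1) * (real k + 2) * (real k + 3)))"

lemma antideriv2_eq_moment: "poly (antideriv (antideriv p)) 1 = moment zeta_weight p"
  unfolding poly_antideriv_1[OF degree_antideriv] moment_eq[OF order_refl]
  by (subst sum.atMost_Suc_shift) (simp add: zeta_weight_def field_simps)

lemma antideriv3_eq_moment: "poly (antideriv (antideriv (antideriv p))) 1 = moment xi_weight p"
proof -
  have "degree (antideriv (antideriv p)) \<le> Suc (Suc (degree p))"
    using degree_antideriv[of "antideriv p"] degree_antideriv[of p] by linarith
  from poly_antideriv_1[OF this] show ?thesis
    unfolding moment_eq[OF order_refl] by (simp add: xi_weight_def sum.atMost_Suc_shift field_simps del: sum.atMost_Suc)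
qed

lemma antideriv_pCons_eq_moment: "poly (antideriv (pCons 0 (antideriv p))) 1 = moment omega_weight p"
proof -
  have "degree (pCons 0 (antideriv p)) \<le> Suc (Suc (degree p))"
    using degree_pCons_le[of 0 "antideriv p"] degree_antideriv[of p] by linarith
  from poly_antideriv_1[OF this] show ?thesis
    unfolding moment_eq[OF order_refl] by (simp add: omega_weight_def sum.atMost_Suc_shift field_simps del: sum.atMost_Suc)
qed

lemma antideriv_pCons_const: "poly (antideriv [:0, a:]) 1 = a / 2"
  by (subst antideriv_eqI[of "[:0, 0, a / 2:]"]) (simp_all add: pderiv_pCons)

text \<open>
  The action of the shift matrix \<open>L\<close>: the previous stage, and 0 for the first one.
\<close>

definition prev :: "(nat \<Rightarrow> real) \<Rightarrow> nat \<Rightarrow> real" where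
  "prev f i = (case i of 0 \<Rightarrow> 0 | Suc k \<Rightarrow> f k)"

context ipc_method
begin

lemma V_Cons_prev: "V ((\<kappa>, p) # w) i =
    [:prev (\<lambda>k. poly (V ((\<kappa>, p) # w) k) 1) i:] + antideriv (rate \<kappa> p (V w) (U w) i)"
  by (cases i) (simp_all add: prev_def V_Cons)

lemma antideriv2_rate_Slow: "poly (antideriv (antideriv (rate Slow p P Q l))) 1 =
  (\<Sum>j<s. moment zeta_weight (\<gamma> $$ (l, j)) * (c $ j ^ p * poly (P j) 1) + moment zeta_weight (\<psi> $$ (l, j)) * (c $ j ^ p * Q j))"
  by (simp add: rate_def antideriv_sum antideriv_add antideriv_smult poly_sum antideriv2_eq_moment mult.commute)

lemma antideriv3_rate_Slow: "poly (antideriv (antideriv (antideriv (rate Slow p P Q l)))) 1 =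
  (\<Sum>j<s. moment xi_weight (\<gamma> $$ (l, j)) * (c $ j ^ p * poly (P j) 1) + moment xi_weight (\<psi> $$ (l, j)) * (c $ j ^ p * Q j))"
  by (simp add: rate_def antideriv_sum antideriv_add antideriv_smult poly_sum antideriv3_eq_moment mult.commute)

lemma pCons_0_add: "pCons 0 (p + q) = pCons 0 p + pCons (0::real) q"
  by simp

lemma pCons_sum: "pCons 0 (\<Sum>i\<in>I. f i) = (\<Sum>i\<in>I. pCons 0 (f i :: real poly))"
  by (induction I rule: infinite_finite_induct) (auto simp: pCons_0_add)

lemma antideriv_pCons_rate_Slow: "poly (antideriv (pCons 0 (antideriv (rate Slow p P Q l)))) 1 =
  (\<Sum>j<s. moment omega_weight (\<gamma> $$ (l, j)) * (c $ j ^ p * poly (P j) 1) + moment omega_weight (\<psi> $$ (l, j)) * (c $ j ^ p * Q j))"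
proof -
  have [simp]: "pCons 0 (p + q) = pCons 0 p + pCons (0::real) q" "pCons 0 (Polynomial.smult a p) = Polynomial.smult a (pCons 0 p)" for p q a
    by simp_all
  show ?thesis
    by (simp add: rate_def antideriv_sum antideriv_add antideriv_smult pCons_sum poly_sum antideriv_pCons_eq_moment mult.commute
      del: add_pCons smult_pCons)
qed

lemma rate_Fast_0: "rate Fast 0 P Q l = Polynomial.smult (delta c $ l) (P l)"
  by (simp add: rate_def)

abbreviation Y where "Y w i \<equiv> poly (V w i) 1"

lemma Y_Slow:
  assumes "i < s"
  shows "Y ((Slow, p) # w) i = (\<Sum>j<i. A $$ (i, j) * c $ j ^ p * Y w j) + A $$ (i, i) * c $ i ^ p * U w i"
  using V_Slow_1[OF assms, of p w Slow] by (simp add: U_Cons)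

lemma Y_Fast_Slow: "Y ((Fast, 0) # (Slow, q) # u) i = (\<Sum>l\<le>i. delta c $ l * (prev (Y ((Slow, q) # u)) l +
   (\<Sum>j<s. moment zeta_weight (\<gamma> $$ (l, j)) * (c $ j ^ q * Y u j) + moment zeta_weight (\<psi> $$ (l, j)) * (c $ j ^ q * U u j))))"
proof (subst V_Cons_1, unfold lessThan_Suc_atMost, rule sum.cong[OF refl])
  fix l
  define Q where "Q = antideriv (rate Slow q (V u) (U u) l)"
  have "V ((Slow, q) # u) l = [:prev (Y ((Slow, q) # u)) l:] + Q"
    unfolding Q_def by (rule V_Cons_prev)
  then show "poly (antideriv (rate Fast 0 (V ((Slow, q) # u)) (U ((Slow, q) # u)) l)) 1 =
     delta c $ l * (prev (Y ((Slow, q) # u)) l +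
     (\<Sum>j<s. moment zeta_weight (\<gamma> $$ (l, j)) * (c $ j ^ q * Y u j) + moment zeta_weight (\<psi> $$ (l, j)) * (c $ j ^ q * U u j)))"
    by (simp only: rate_Fast_0 antideriv_add antideriv_smult poly_add poly_smult)
      (simp add: Q_def antideriv_const antideriv2_rate_Slow)
qed

lemma Y_Fast1_Slow: "Y [(Fast, 1), (Slow, q)] i = (\<Sum>l\<le>i. delta c $ l * node c l * (prev (Y [(Slow, q)]) l +
   (\<Sum>j<s. (moment zeta_weight (\<gamma> $$ (l, j)) + moment zeta_weight (\<psi> $$ (l, j))) * c $ j ^ q))
   + (delta c $ l)\<^sup>2 * (prev (Y [(Slow, q)]) l / 2 + (\<Sum>j<s. (moment omega_weight (\<gamma> $$ (l, j)) + moment omega_weight (\<psi> $$ (l, j))) * c $ j ^ q)))"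
proof (subst V_Cons_1, unfold lessThan_Suc_atMost, rule sum.cong[OF refl])
  fix l
  define W where "W = V [(Slow, q)] l"
  define Q where "Q = antideriv (rate Slow q (V []) (U []) l)"
  have W: "W = [:prev (Y [(Slow, q)]) l:] + Q"
    unfolding W_def Q_def by (rule V_Cons_prev)
  have "rate Fast 1 (V [(Slow, q)]) (U [(Slow, q)]) l =
     Polynomial.smult (delta c $ l * node c l) W + Polynomial.smult ((delta c $ l)\<^sup>2) (pCons 0 W)"
    by (simp add: rate_def W_def smult_add_right power2_eq_square)
  moreover have "pCons 0 W = [:0, prev (Y [(Slow, q)]) l:] + pCons 0 Q" by (simp add: W)
  ultimately show "poly (antideriv (rate Fast 1 (V [(Slow, q)]) (U [(Slow, q)]) l)) 1 = delta c $ l * node c l * (prev (Y [(Slow, q)]) l +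
   (\<Sum>j<s. (moment zeta_weight (\<gamma> $$ (l, j)) + moment zeta_weight (\<psi> $$ (l, j))) * c $ j ^ q))
   + (delta c $ l)\<^sup>2 * (prev (Y [(Slow, q)]) l / 2 + (\<Sum>j<s. (moment omega_weight (\<gamma> $$ (l, j)) + moment omega_weight (\<psi> $$ (l, j))) * c $ j ^ q))"
    by (simp only: antideriv_add antideriv_smult poly_add poly_smult antideriv_pCons_const)
      (simp add: W Q_def antideriv_add antideriv_const antideriv2_rate_Slow antideriv_pCons_rate_Slow distrib_right)
qed

lemma Y_Fast_Fast_Slow: "Y [(Fast, 0), (Fast, 0), (Slow, q)] i = (\<Sum>l\<le>i. delta c $ l * prev (Y [(Fast, 0), (Slow, q)]) l
   + (delta c $ l)\<^sup>2 * (prev (Y [(Slow, q)]) l / 2 + (\<Sum>j<s. (moment xi_weight (\<gamma> $$ (l, j)) + moment xi_weight (\<psi> $$ (l, j))) * c $ j ^ q)))"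
proof (subst V_Cons_1, unfold lessThan_Suc_atMost, rule sum.cong[OF refl])
  fix l
  define Q where "Q = antideriv (rate Slow q (V []) (U []) l)"
  have "V [(Slow, q)] l = [:prev (Y [(Slow, q)]) l:] + Q"
    unfolding Q_def by (rule V_Cons_prev)
  then have "V [(Fast, 0), (Slow, q)] l = [:prev (Y [(Fast, 0), (Slow, q)]) l:] +
     (Polynomial.smult (delta c $ l) [:0, prev (Y [(Slow, q)]) l:] + Polynomial.smult (delta c $ l) (antideriv Q))"
    by (subst V_Cons_prev) (simp only: rate_Fast_0 antideriv_smult antideriv_add antideriv_const smult_add_right)
  then show "poly (antideriv (rate Fast 0 (V [(Fast, 0), (Slow, q)]) (U [(Fast, 0), (Slow, q)]) l)) 1 =
     delta c $ l * prev (Y [(Fast, 0), (Slow, q)]) l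
   + (delta c $ l)\<^sup>2 * (prev (Y [(Slow, q)]) l / 2 + (\<Sum>j<s. (moment xi_weight (\<gamma> $$ (l, j)) + moment xi_weight (\<psi> $$ (l, j))) * c $ j ^ q))"
    by (simp only: rate_Fast_0 antideriv_add antideriv_smult poly_add poly_smult antideriv_pCons_const)
      (simp add: Q_def antideriv_const antideriv3_rate_Slow distrib_right distrib_left power2_eq_square)
qed

text \<open>
  The inner problems solve fast chains exactly, and consecutive inner problems fit together.
\<close>

lemma V_Fast:
  assumes "\<forall>a\<in>set w. fst a = Fast" "i < s"
  shows "V w i = Polynomial.smult (exact_weight w) ([:node c i, delta c $ i:] ^ chain_order w)"
  using assms
proof (induction w arbitrary: i)
  case (Cons a w)
  obtain p where a: "a = (Fast, p)" using Cons.prems by (cases a) auto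
  define N where "N = p + chain_order w"
  have rate: "rate Fast p (V w) (U w) l = Polynomial.smult (delta c $ l * exact_weight w) ([:node c l, delta c $ l:] ^ N)" if "l < s" for l
    using Cons.IH[OF _ that] Cons.prems by (simp add: rate_def N_def power_add mult.commute)
  have anti: "antideriv (rate Fast p (V w) (U w) l) = Polynomial.smult (exact_weight w / real (Suc N)) ([:node c l, delta c $ l:] ^ Suc N - [:node c l ^ Suc N:])"
    if "l < s" for l
  proof (rule antideriv_eqI)
    have "pderiv ([:node c l, delta c $ l:] ^ Suc N - [:node c l ^ Suc N:]) = Polynomial.smult (real (Suc N) * delta c $ l) ([:node c l, delta c $ l:] ^ N)"
      unfolding pderiv_diff pderiv_power_Suc by (simp add: pderiv_pCons mult.commute)
    then show "pderiv (Polynomial.smult (exact_weight w / real (Suc N)) ([:node c l, delta c $ l:] ^ Suc N - [:node c l ^ Suc N:])) = rate Fast p (V w) (U w) l"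
      unfolding pderiv_smult rate[OF that] by (simp add: mult.commute del: of_nat_Suc power_Suc)
  qed (simp add: poly_power)
  have node: "(\<Sum>l<i. poly (antideriv (rate Fast p (V w) (U w) l)) 1) = exact_weight w / real (Suc N) * node c i ^ Suc N" if "i \<le> s" for i
    using that
  proof (induction i)
    case (Suc i)
    then have "node c i + delta c $ i = c $ i" by (simp add: delta_eq)
    then have "poly (antideriv (rate Fast p (V w) (U w) i)) 1 = exact_weight w / real (Suc N) * (c $ i ^ Suc N - node c i ^ Suc N)"
      using Suc.prems by (simp add: anti poly_power del: of_nat_Suc power_Suc)
    then show ?case using Suc by (simp add: right_diff_distrib del: of_nat_Suc power_Suc)
  qed simp
  have "V (a # w) i = [:exact_weight w / real (Suc N) * node c i ^ Suc N:] + Polynomial.smult (exact_weight w / real (Suc N)) ([:node c i, delta c $ i:] ^ Suc N - [:node c i ^ Suc N:])"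
    unfolding a V_Cons using Cons.prems node[of i] anti[of i] by simp
  also have "\<dots> = Polynomial.smult (exact_weight (a # w)) ([:node c i, delta c $ i:] ^ chain_order (a # w))"
    by (simp add: a N_def smult_diff_right del: power_Suc of_nat_Suc)
  finally show ?case .
qed simp

lemma Y_Fast:
  assumes "\<forall>a\<in>set w. fst a = Fast" "i < s"
  shows "Y w i = exact_weight w * c $ i ^ chain_order w"
  using V_Fast[OF assms] assms(2) by (simp add: poly_power delta_eq)

subsection \<open>Redundant chains\<close>

lemma weights_cong:
  assumes "\<And>j. j < s \<Longrightarrow> V w j = V w' j \<and> U w j = U w' j" "i < s"
  shows "V (a # w) i = V (a # w') i \<and> U (a # w) i = U (a # w') i"
proof -
  obtain \<kappa> p where a: "a = (\<kappa>, p)" by force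
  have rate: "rate \<kappa> p (V w) (U w) l = rate \<kappa> p (V w') (U w') l" if "l < s" for l
    using assms(1) that by (cases \<kappa>) (simp_all add: rate_def)
  show ?thesis using assms rate by (simp add: a V_Cons U_Cons)
qed

text \<open>
  By \<open>V_leaf\<close> and \<open>U_leaf\<close> the last letter contributes a factor \<open>t\<close>, which is moved into the power of
  the letter before it.
\<close>

lemma leaf_merge:
  assumes "i < s"
  shows "V (u @ [(\<kappa>', p), (\<kappa>, 0)]) i = V (u @ [(\<kappa>', Suc p)]) i \<and> U (u @ [(\<kappa>', p), (\<kappa>, 0)]) i = U (u @ [(\<kappa>', Suc p)]) i"
  using assms
proof (induction u arbitrary: i)
  case Nil
  have rate: "rate \<kappa>' p (V [(\<kappa>, 0)]) (U [(\<kappa>, 0)]) l = rate \<kappa>' (Suc p) (V []) (U []) l" if "l < s" for l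
  proof (cases \<kappa>')
    case Fast
    then show ?thesis using that by (simp add: rate_def V_leaf mult.commute)
  next
    case Slow
    then show ?thesis using that by (simp add: rate_def V_leaf U_leaf delta_eq mult.commute)
  qed
  have leaf: "poly (V [(\<kappa>, 0)] j) 1 = c $ j" "U [(\<kappa>, 0)] j = c $ j" if "j < s" for j
    using that by (simp_all add: V_leaf U_leaf delta_eq)
  show ?case
    unfolding append_Nil V_Cons[of \<kappa>' p "[(\<kappa>, 0)]"] V_Cons[of \<kappa>' "Suc p" "[]"]
      U_Cons[of \<kappa>' p "[(\<kappa>, 0)]"] U_Cons[of \<kappa>' "Suc p" "[]"]
    using Nil by (simp add: leaf rate mult_ac)
next
  case (Cons a u)
  show ?case unfolding append_Cons by (rule weights_cong[OF Cons.IH Cons.prems])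
qed

end

lemma exact_leaf_merge: "exact_weight (u @ [(\<kappa>', p), (\<kappa>, 0)]) = exact_weight (u @ [(\<kappa>', Suc p)])"
proof -
  have order: "chain_order (u @ [(\<kappa>', p), (\<kappa>, 0)]) = chain_order (u @ [(\<kappa>', Suc p)])" for u
    by (induction u) auto
  show ?thesis
  proof (induction u)
    case (Cons a u)
    then show ?case using order[of "a # u"] by (simp only: append_Cons exact_weight.simps)
  qed simp
qed

lemma cwise_power_1 [simp]: "v ^\<^sub>v Suc 0 = v"
  by (auto simp: cwise_power_def)

lemma moment_coeff_mat:
  assumes "i < dim_row P" "j < dim_col P"
  shows "(\<Sum>k | coeff_mat P k $$ (i, j) \<noteq> 0. f k * coeff_mat P k $$ (i, j)) = moment f (P $$ (i, j))"
  using assms by (simp add: moment_def coeff_mat_def)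

context ipc_method
begin

abbreviation (input) "L \<equiv> lower_shift s"
abbreviation (input) "D \<equiv> diag_part A"
abbreviation (input) "T \<equiv> strict_lower_part A"
abbreviation (input) "dc \<equiv> delta c"
abbreviation (input) "dC \<equiv> delta_mat c"
abbreviation (input) "e \<equiv> unit_vec s (s - 1)"
abbreviation (input) "S f \<equiv> weighted_sum s f (\<lambda>k. coeff_mat \<psi> k + coeff_mat \<gamma> k)"

lemma carriers [simp]:
  "A \<in> carrier_mat s s" "L \<in> carrier_mat s s" "D \<in> carrier_mat s s" "T \<in> carrier_mat s s"
  "dC \<in> carrier_mat s s" "weighted_sum s f M \<in> carrier_mat s s" "c \<in> carrier_vec s"
  "c ^\<^sub>v k \<in> carrier_vec s" "dc \<in> carrier_vec s" "dc ^\<^sub>v k \<in> carrier_vec s"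
  using A_dim c_dim
  by (auto simp: lower_shift_def diag_part_def strict_lower_part_def delta_mat_def weighted_sum_def
      cwise_power_def delta_def)

lemma dims_mat [simp]:
  "dim_row L = s" "dim_row D = s" "dim_row T = s" "dim_row dC = s"
  "dim_col L = s" "dim_col D = s" "dim_col T = s" "dim_col dC = s"
  by (auto simp: lower_shift_def diag_part_def strict_lower_part_def delta_mat_def)

lemma part_entries:
  "i < s \<Longrightarrow> j < s \<Longrightarrow> D $$ (i, j) = (if i = j then A $$ (i, j) else 0)"
  "i < s \<Longrightarrow> j < s \<Longrightarrow> T $$ (i, j) = (if j < i then A $$ (i, j) else 0)"
  by (simp_all add: diag_part_def strict_lower_part_def)

lemma power_index [simp]: "i < s \<Longrightarrow> (c ^\<^sub>v k) $ i = c $ i ^ k" "i < s \<Longrightarrow> (dc ^\<^sub>v k) $ i = (dc $ i) ^ k"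
  by (simp_all add: cwise_power_def delta_def)

lemma mat_vec_carrier [simp]: "M \<in> carrier_mat s s \<Longrightarrow> x \<in> carrier_vec s \<Longrightarrow> M *\<^sub>v x \<in> carrier_vec s"
  by simp

lemma mat_mult_carrier [simp]: "M \<in> carrier_mat s s \<Longrightarrow> N \<in> carrier_mat s s \<Longrightarrow> M * N \<in> carrier_mat s s"
  by simp

lemma mat_vec_assoc:
  "M \<in> carrier_mat s s \<Longrightarrow> N \<in> carrier_mat s s \<Longrightarrow> x \<in> carrier_vec s \<Longrightarrow> (M * N) *\<^sub>v x = M *\<^sub>v (N *\<^sub>v x)"
  by (rule assoc_mult_mat_vec)

lemma mat_vec_index:
  "M \<in> carrier_mat s s \<Longrightarrow> x \<in> carrier_vec s \<Longrightarrow> i < s \<Longrightarrow> (M *\<^sub>v x) $ i = (\<Sum>j<s. M $$ (i, j) * x $ j)"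
  by (simp add: scalar_prod_def lessThan_atLeast0)

declare index_mult_mat_vec [simp del]

lemma mat_vec_add_index:
  "M \<in> carrier_mat s s \<Longrightarrow> N \<in> carrier_mat s s \<Longrightarrow> x \<in> carrier_vec s \<Longrightarrow> i < s \<Longrightarrow> ((M + N) *\<^sub>v x) $ i = (M *\<^sub>v x) $ i + (N *\<^sub>v x) $ i"
  by (simp add: mat_vec_index distrib_right sum.distrib)

lemma mat_vec_smult_index:
  "M \<in> carrier_mat s s \<Longrightarrow> x \<in> carrier_vec s \<Longrightarrow> i < s \<Longrightarrow> ((k \<cdot>\<^sub>m M) *\<^sub>v x) $ i = k * (M *\<^sub>v x) $ i"
  by (simp add: mat_vec_index sum_distrib_left mult.assoc)

lemma scalar_prod_sum: "x \<in> carrier_vec s \<Longrightarrow> u \<bullet> x = (\<Sum>j<s. u $ j * x $ j)"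
  by (simp add: scalar_prod_def lessThan_atLeast0)

lemma last_entry: "(x :: real vec) \<in> carrier_vec s \<Longrightarrow> e \<bullet> x = x $ (s - 1)"
  using s_pos scalar_prod_left_unit[of x s "s - 1"] by simp

lemma L_index: "x \<in> carrier_vec s \<Longrightarrow> i < s \<Longrightarrow> (L *\<^sub>v x) $ i = prev (($) x) i"
proof -
  assume x: "x \<in> carrier_vec s" and i: "i < s"
  have "(L *\<^sub>v x) $ i = (\<Sum>j<s. (if i = j + 1 then x $ j else 0))"
    unfolding mat_vec_index[OF carriers(2) x i] using i by (intro sum.cong) (auto simp: lower_shift_def)
  also have "\<dots> = prev (($) x) i" using i by (cases i) (simp_all add: prev_def)
  finally show ?thesis .
qed

lemma D_index: "x \<in> carrier_vec s \<Longrightarrow> i < s \<Longrightarrow> (D *\<^sub>v x) $ i = A $$ (i, i) * x $ i"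
proof -
  assume x: "x \<in> carrier_vec s" and i: "i < s"
  have "(D *\<^sub>v x) $ i = (\<Sum>j<s. (if i = j then A $$ (i, j) * x $ j else 0))"
    unfolding mat_vec_index[OF carriers(3) x i] using i by (intro sum.cong) (auto simp: diag_part_def)
  then show ?thesis using i by simp
qed

lemma T_index: "x \<in> carrier_vec s \<Longrightarrow> i < s \<Longrightarrow> (T *\<^sub>v x) $ i = (\<Sum>j<i. A $$ (i, j) * x $ j)"
proof -
  assume x: "x \<in> carrier_vec s" and i: "i < s"
  show ?thesis
    unfolding mat_vec_index[OF carriers(4) x i] using i
    by (intro sum.mono_neutral_cong_right) (auto simp: strict_lower_part_def)
qed

lemma dC_index: "x \<in> carrier_vec s \<Longrightarrow> i < s \<Longrightarrow> (dC *\<^sub>v x) $ i = (\<Sum>j\<le>i. dc $ j * x $ j)"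
proof -
  assume x: "x \<in> carrier_vec s" and i: "i < s"
  show ?thesis
    unfolding mat_vec_index[OF carriers(5) x i] using i
    by (intro sum.mono_neutral_cong_right) (auto simp: delta_mat_def)
qed

lemma A_index: "x \<in> carrier_vec s \<Longrightarrow> i < s \<Longrightarrow> (A *\<^sub>v x) $ i = (\<Sum>j<i. A $$ (i, j) * x $ j) + A $$ (i, i) * x $ i"
  by (subst mat_vec_index) (simp_all add: A_row_split)

lemma S_entries:
  assumes "i < s" "j < s"
  shows "S f $$ (i, j) = moment f (\<gamma> $$ (i, j)) + moment f (\<psi> $$ (i, j))"
    "weighted_sum s f (coeff_mat \<gamma>) $$ (i, j) = moment f (\<gamma> $$ (i, j))"
    "weighted_sum s f (coeff_mat \<psi>) $$ (i, j) = moment f (\<psi> $$ (i, j))"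
proof -
  have "S f $$ (i, j) = moment f (\<psi> $$ (i, j) + \<gamma> $$ (i, j))"
    using assms by (simp add: weighted_sum_def moment_def coeff_mat_def)
  then show "S f $$ (i, j) = moment f (\<gamma> $$ (i, j)) + moment f (\<psi> $$ (i, j))"
    by (simp add: moment_add)
qed (use assms in \<open>simp_all add: weighted_sum_def moment_coeff_mat\<close>)

lemma prev_cong: "(\<And>k. k < i \<Longrightarrow> f k = g k) \<Longrightarrow> prev f i = prev g i"
  by (cases i) (simp_all add: prev_def)

lemma sum_last: "(\<Sum>l\<le>s - 1. f l) = (\<Sum>l<s. f l)"
  using s_pos by (cases s) (simp_all add: lessThan_Suc_atMost)

lemma Y_Slow_leaf: "i < s \<Longrightarrow> Y [(Slow, q)] i = (A *\<^sub>v (c ^\<^sub>v q)) $ i"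
  by (simp add: Y_Slow A_index)

lemma U_single: "i < s \<Longrightarrow> U [(\<kappa>, q)] i = (A *\<^sub>v (c ^\<^sub>v q)) $ i"
  by (simp add: U_Cons A_index)

lemma Y_Fast_leaf: "i < s \<Longrightarrow> Y [(Fast, q)] i = c $ i ^ Suc q / (real q + 1)"
  by (subst Y_Fast) (simp_all add: add.commute)

text \<open>
  The two summands are the initial value of the inner problem and the accumulated forcing, weighted by
  \<open>f\<close>.
\<close>

lemma LS_index:
  assumes "i < s"
  shows "((L * A + S f) *\<^sub>v (c ^\<^sub>v q)) $ i = prev (Y [(Slow, q)]) i + (\<Sum>j<s. (moment f (\<gamma> $$ (i, j)) + moment f (\<psi> $$ (i, j))) * c $ j ^ q)"
proof -
  have "prev (($) (A *\<^sub>v (c ^\<^sub>v q))) i = prev (Y [(Slow, q)]) i"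
    using assms by (intro prev_cong) (simp add: Y_Slow_leaf)
  then show ?thesis
    using assms by (simp add: mat_vec_add_index mat_vec_assoc L_index mat_vec_index[of "S f"] S_entries)
qed

lemma half_LS_index:
  assumes "i < s"
  shows "(((1/2) \<cdot>\<^sub>m (L * A) + S f) *\<^sub>v (c ^\<^sub>v q)) $ i = prev (Y [(Slow, q)]) i / 2 + (\<Sum>j<s. (moment f (\<gamma> $$ (i, j)) + moment f (\<psi> $$ (i, j))) * c $ j ^ q)"
proof -
  have "prev (($) (A *\<^sub>v (c ^\<^sub>v q))) i = prev (Y [(Slow, q)]) i"
    using assms by (intro prev_cong) (simp add: Y_Slow_leaf)
  then show ?thesis
    using assms by (simp add: mat_vec_add_index mat_vec_smult_index mat_vec_assoc L_index mat_vec_index[of "S f"] S_entries)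
qed

lemma dC_LS_index:
  assumes "i < s"
  shows "(dC *\<^sub>v ((L * A + S zeta_weight) *\<^sub>v (c ^\<^sub>v q))) $ i = Y [(Fast, 0), (Slow, q)] i"
  unfolding Y_Fast_Slow using assms
  by (subst dC_index) (auto simp: LS_index distrib_right intro!: sum.cong)

text \<open>
  Each coupling condition is the condition of one chain; the names of the lemmas spell the colours, with the
  exponent of a first letter if it is 1.
\<close>

lemma chain_FS: "dc \<bullet> ((L * A + S zeta_weight) *\<^sub>v (c ^\<^sub>v q)) = Y [(Fast, 0), (Slow, q)] (s - 1)"
  unfolding Y_Fast_Slow sum_last
  by (subst scalar_prod_sum) (auto simp: LS_index distrib_right intro!: sum.cong)

lemma chain_SF: "e \<bullet> ((D * A) *\<^sub>v (c ^\<^sub>v q) + (1 / (real q + 1)) \<cdot>\<^sub>v (T *\<^sub>v (c ^\<^sub>v Suc q))) = Y [(Slow, 0), (Fast, q)] (s - 1)"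
  using s_pos by (subst last_entry)
    (auto simp: Y_Slow Y_Fast_leaf U_single mat_vec_assoc D_index T_index sum_distrib_left intro!: sum.cong)

lemma chain_F1S: "(dc \<times>\<^sub>v (L *\<^sub>v c)) \<bullet> ((L * A + S zeta_weight) *\<^sub>v c) + (dc ^\<^sub>v 2) \<bullet> (((1/2) \<cdot>\<^sub>m (L * A) + S omega_weight) *\<^sub>v c)
   = Y [(Fast, 1), (Slow, 1)] (s - 1)"
proof -
  have *: "(dc \<times>\<^sub>v (L *\<^sub>v c)) $ l = dc $ l * node c l" if "l < s" for l
    using that by (cases l) (simp_all add: cwise_mult_def L_index prev_def delta_def)
  show ?thesis
    unfolding Y_Fast1_Slow sum_last sum.distrib
    using LS_index[of _ _ 1] half_LS_index[of _ _ 1]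
    by (simp add: scalar_prod_sum * cwise_power_1)
qed

lemma chain_S1F: "((transpose_mat D *\<^sub>v e) \<times>\<^sub>v c) \<bullet> (A *\<^sub>v c) + 1/2 * (((transpose_mat T *\<^sub>v e) \<times>\<^sub>v c) \<bullet> (c ^\<^sub>v 2))
   = Y [(Slow, 1), (Fast, 1)] (s - 1)"
proof -
  have row: "(transpose_mat M *\<^sub>v e) $ j = M $$ (s - 1, j)" if "M \<in> carrier_mat s s" "j < s" for M :: "real mat" and j
    using that s_pos scalar_prod_right_unit[of "s - 1" s "col M j"] by (simp add: index_mult_mat_vec)
  have D: "((transpose_mat D *\<^sub>v e) \<times>\<^sub>v c) \<bullet> (A *\<^sub>v c) = A $$ (s - 1, s - 1) * c $ (s - 1) * (A *\<^sub>v c) $ (s - 1)"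
  proof -
    have "((transpose_mat D *\<^sub>v e) \<times>\<^sub>v c) \<bullet> (A *\<^sub>v c) = (\<Sum>j<s. if s - 1 = j then A $$ (s - 1, j) * c $ j * (A *\<^sub>v c) $ j else 0)"
      using s_pos by (subst scalar_prod_sum, simp, intro sum.cong refl) (simp add: cwise_mult_def row[unfolded One_nat_def] part_entries)
    then show ?thesis using s_pos by simp
  qed
  have T: "((transpose_mat T *\<^sub>v e) \<times>\<^sub>v c) \<bullet> (c ^\<^sub>v 2) = (\<Sum>j<s - 1. A $$ (s - 1, j) * c $ j * c $ j ^ 2)"
    using s_pos by (subst scalar_prod_sum, simp)
      (auto simp: cwise_mult_def row[unfolded One_nat_def] part_entries split: if_splits intro!: sum.mono_neutral_cong_right)
  show ?thesis
    unfolding D T using s_pos U_single[of "s - 1" Fast 1]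
    by (simp add: Y_Slow Y_Fast_leaf cwise_power_1 sum_distrib_left power2_eq_square)
qed

lemma chain_FFS: "dc \<bullet> ((L * dC * (L * A + S zeta_weight)) *\<^sub>v c) + (dc ^\<^sub>v 2) \<bullet> (((1/2) \<cdot>\<^sub>m (L * A) + S xi_weight) *\<^sub>v c)
   = Y [(Fast, 0), (Fast, 0), (Slow, 1)] (s - 1)"
proof -
  have "((L * dC * (L * A + S zeta_weight)) *\<^sub>v c) $ l = prev (Y [(Fast, 0), (Slow, 1)]) l" if l: "l < s" for l
  proof -
    have "(L * dC * (L * A + S zeta_weight)) *\<^sub>v c = L *\<^sub>v (dC *\<^sub>v ((L * A + S zeta_weight) *\<^sub>v c))"
      by (simp add: mat_vec_assoc)
    also have "\<dots> $ l = prev (($) (dC *\<^sub>v ((L * A + S zeta_weight) *\<^sub>v c))) l"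
      using l by (subst L_index) simp_all
    also have "\<dots> = prev (Y [(Fast, 0), (Slow, 1)]) l"
      using l dC_LS_index[of _ 1] by (intro prev_cong) (simp add: cwise_power_1)
    finally show ?thesis .
  qed
  then show ?thesis
    unfolding Y_Fast_Fast_Slow sum_last sum.distrib
    using half_LS_index[of _ _ 1] by (simp add: scalar_prod_sum cwise_power_1)
qed

lemma chain_FSF: "dc \<bullet> (((L * D + weighted_sum s zeta_weight (coeff_mat \<psi>)) * A) *\<^sub>v c)
    + 1/2 * (dc \<bullet> ((L * T + weighted_sum s zeta_weight (coeff_mat \<gamma>)) *\<^sub>v (c ^\<^sub>v 2)))
   = Y [(Fast, 0), (Slow, 0), (Fast, 1)] (s - 1)"
proof -
  have 1: "(((L * D + weighted_sum s zeta_weight (coeff_mat \<psi>)) * A) *\<^sub>v c) $ l =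
     prev (\<lambda>k. A $$ (k, k) * (A *\<^sub>v c) $ k) l + (\<Sum>j<s. moment zeta_weight (\<psi> $$ (l, j)) * (A *\<^sub>v c) $ j)" if l: "l < s" for l
  proof -
    have "prev (($) (D *\<^sub>v (A *\<^sub>v c))) l = prev (\<lambda>k. A $$ (k, k) * (A *\<^sub>v c) $ k) l"
      using l by (intro prev_cong) (simp add: D_index)
    then show ?thesis using l
      by (simp add: mat_vec_assoc mat_vec_add_index L_index mat_vec_index[of "weighted_sum s zeta_weight (coeff_mat \<psi>)"] S_entries)
  qed
  have 2: "((L * T + weighted_sum s zeta_weight (coeff_mat \<gamma>)) *\<^sub>v (c ^\<^sub>v 2)) $ l =
     prev (\<lambda>k. \<Sum>j<k. A $$ (k, j) * c $ j ^ 2) l + (\<Sum>j<s. moment zeta_weight (\<gamma> $$ (l, j)) * c $ j ^ 2)" if l: "l < s" for l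
  proof -
    have "prev (($) (T *\<^sub>v (c ^\<^sub>v 2))) l = prev (\<lambda>k. \<Sum>j<k. A $$ (k, j) * c $ j ^ 2) l"
      using l by (intro prev_cong) (simp add: T_index)
    then show ?thesis using l
      by (simp add: mat_vec_assoc mat_vec_add_index L_index mat_vec_index[of "weighted_sum s zeta_weight (coeff_mat \<gamma>)"] S_entries)
  qed
  have 3: "prev (Y [(Slow, 0), (Fast, 1)]) l = prev (\<lambda>k. A $$ (k, k) * (A *\<^sub>v c) $ k) l + 1/2 * prev (\<lambda>k. \<Sum>j<k. A $$ (k, j) * c $ j ^ 2) l" if "l < s" for l
    using that U_single[of _ Fast 1]
    by (cases l) (simp_all add: prev_def Y_Slow Y_Fast_leaf cwise_power_1 sum_distrib_left power2_eq_square)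
  show ?thesis
    unfolding Y_Fast_Slow sum_last
    using U_single[of _ Fast 1]
    by (simp add: scalar_prod_sum 1 2 3[unfolded One_nat_def] cwise_power_1 Y_Fast_leaf sum_distrib_left sum.distrib distrib_left power2_eq_square mult_ac)
qed

lemma chain_FSS: "dc \<bullet> (((L * A + S zeta_weight) * A) *\<^sub>v c) = Y [(Fast, 0), (Slow, 0), (Slow, 1)] (s - 1)"
proof -
  have 1: "(((L * A + S zeta_weight) * A) *\<^sub>v c) $ l =
     prev (($) (A *\<^sub>v (A *\<^sub>v c))) l + (\<Sum>j<s. (moment zeta_weight (\<gamma> $$ (l, j)) + moment zeta_weight (\<psi> $$ (l, j))) * (A *\<^sub>v c) $ j)" if l: "l < s" for l
    using l by (simp add: mat_vec_assoc mat_vec_add_index L_index mat_vec_index[of "S zeta_weight"] S_entries)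
  have 2: "prev (Y [(Slow, 0), (Slow, 1)]) l = prev (($) (A *\<^sub>v (A *\<^sub>v c))) l" if "l < s" for l
    using that U_single[of _ Slow 1] Y_Slow_leaf[of _ 1]
    by (intro prev_cong) (simp add: Y_Slow[of _ _ "[(Slow, Suc 0)]"] A_index[of "A *\<^sub>v c"] cwise_power_1)
  show ?thesis
    unfolding Y_Fast_Slow sum_last
    using U_single[of _ Slow 1] Y_Slow_leaf[of _ 1]
    by (simp add: scalar_prod_sum 1 2[unfolded One_nat_def] cwise_power_1 distrib_right sum.distrib)
qed

lemma chain_SSF: "e \<bullet> (A *\<^sub>v ((D * A) *\<^sub>v c + (1/2) \<cdot>\<^sub>v (T *\<^sub>v (c ^\<^sub>v 2)))) = Y [(Slow, 0), (Slow, 0), (Fast, 1)] (s - 1)"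
proof -
  have Y: "((D * A) *\<^sub>v c + (1/2) \<cdot>\<^sub>v (T *\<^sub>v (c ^\<^sub>v 2))) $ i = Y [(Slow, 0), (Fast, 1)] i" if "i < s" for i
    using that U_single[of i Fast 1]
    by (simp add: Y_Slow Y_Fast_leaf mat_vec_assoc D_index T_index cwise_power_1 sum_distrib_left power2_eq_square)
  have U: "U [(Slow, 0), (Fast, 1)] i = Y [(Slow, 0), (Fast, 1)] i" if "i < s" for i
    using V_Slow_1[OF that, of 0 "[(Fast, 1)]" Slow] by simp
  show ?thesis
    using s_pos Y U
    by (subst last_entry) (simp_all add: A_index Y_Slow[of _ 0 "[(Slow, 0), (Fast, Suc 0)]"])
qed

lemma chain_SFS: "e \<bullet> ((D * A * A) *\<^sub>v c) + e \<bullet> ((T * dC * (L * A + S zeta_weight)) *\<^sub>v c) = Y [(Slow, 0), (Fast, 0), (Slow, 1)] (s - 1)"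
proof -
  have "(T * dC * (L * A + S zeta_weight)) *\<^sub>v c = T *\<^sub>v (dC *\<^sub>v ((L * A + S zeta_weight) *\<^sub>v c))"
    by (simp add: mat_vec_assoc)
  then have T: "e \<bullet> ((T * dC * (L * A + S zeta_weight)) *\<^sub>v c) = (\<Sum>j<s - 1. A $$ (s - 1, j) * Y [(Fast, 0), (Slow, 1)] j)"
    using s_pos dC_LS_index[of _ 1] by (simp add: T_index cwise_power_1)
  have "U [(Fast, 0), (Slow, 1)] (s - 1) = (A *\<^sub>v (A *\<^sub>v c)) $ (s - 1)"
    using s_pos U_single[of _ Slow 1] Y_Slow_leaf[of _ 1]
    by (simp add: U_Cons[of _ _ "[(Slow, Suc 0)]"] A_index[of "A *\<^sub>v c"] cwise_power_1)
  then have D: "e \<bullet> ((D * A * A) *\<^sub>v c) = A $$ (s - 1, s - 1) * U [(Fast, 0), (Slow, 1)] (s - 1)"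
    using s_pos by (simp add: mat_vec_assoc D_index)
  show ?thesis
    unfolding T D using s_pos by (simp add: Y_Slow)
qed

text \<open>
  After absorbing last letters with exponent 0, chains of order at most four have a single letter, or are
  one of \<open>(0, 1)\<close>, \<open>(1, 1)\<close>, \<open>(0, 2)\<close>, \<open>(0, 0, 1)\<close> in some colouring.
\<close>

lemma chain_conditions_reduce:
  assumes rk: "rk_order_at_least s A b c 4"
    and FS: "Y [(Fast, 0), (Slow, 1)] (s - 1) = 1/6" and SF: "Y [(Slow, 0), (Fast, 1)] (s - 1) = 1/6"
    and F1S: "Y [(Fast, 1), (Slow, 1)] (s - 1) = 1/8" and S1F: "Y [(Slow, 1), (Fast, 1)] (s - 1) = 1/8"
    and FS2: "Y [(Fast, 0), (Slow, 2)] (s - 1) = 1/12" and SF2: "Y [(Slow, 0), (Fast, 2)] (s - 1) = 1/12"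
    and FFS: "Y [(Fast, 0), (Fast, 0), (Slow, 1)] (s - 1) = 1/24"
    and FSF: "Y [(Fast, 0), (Slow, 0), (Fast, 1)] (s - 1) = 1/24"
    and FSS: "Y [(Fast, 0), (Slow, 0), (Slow, 1)] (s - 1) = 1/24"
    and SSF: "Y [(Slow, 0), (Slow, 0), (Fast, 1)] (s - 1) = 1/24"
    and SFS: "Y [(Slow, 0), (Fast, 0), (Slow, 1)] (s - 1) = 1/24"
    and w: "w \<noteq> []" "chain_order w \<le> 4"
  shows "Y w (s - 1) = exact_weight w"
proof -
  have last: "s - 1 < s" using s_pos by simp
  have fast: "Y w (s - 1) = exact_weight w" if "\<forall>a\<in>set w. fst a = Fast" for w
    using Y_Fast[OF that last] c_last by simp
  have slow: "Y w (s - 1) = exact_weight w" if "\<forall>a\<in>set w. fst a = Slow" "w \<noteq> []" "chain_order w \<le> 4" for w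
    using slow_weights[OF that(1) last] rk_order_imp_weights[OF rk that(2,3)] by simp
  have merged: "Y (u @ [(\<kappa>', p), (\<kappa>, 0)]) (s - 1) = exact_weight (u @ [(\<kappa>', p), (\<kappa>, 0)])"
    if "Y (u @ [(\<kappa>', Suc p)]) (s - 1) = exact_weight (u @ [(\<kappa>', Suc p)])" for u \<kappa> \<kappa>' p
    using that leaf_merge[OF last, of u \<kappa>' p \<kappa>] exact_leaf_merge[of u \<kappa>' p \<kappa>] by simp
  have SFF: "Y [(Slow, 0), (Fast, 0), (Fast, 1)] (s - 1) = 1/24"
  proof -
    define a where "a = A $$ (s - 1, s - 1)"
    define t where "t k = (\<Sum>j<s - 1. A $$ (s - 1, j) * c $ j ^ k)" for k
    have b: "t k + a = 1 / (real k + 1)" if "k \<le> 3" for k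
      using slow[of "[(Slow, k)]"] that last c_last by (simp add: Y_Slow t_def a_def add.commute)
    \<comment> \<open>The diagonal entry \<open>a\<close> of the last stage acts as the node 1, so only quadrature conditions enter.\<close>
    have h: "t 1 + a = 1/2" "t 2 + a = 1/3" "t 3 + a = 1/4" using b[of 1] b[of 2] b[of 3] by simp_all
    have "U [(Fast, 0), (Fast, 1)] (s - 1) = t 2 / 2 + a * (t 1 + a)"
      using last c_last by (simp add: U_Cons Y_Fast_leaf t_def a_def sum_divide_distrib eval_nat_numeral)
    then have U: "U [(Fast, 0), (Fast, 1)] (s - 1) = 1/6" unfolding h(1) using h(2) by linarith
    have "Y [(Slow, 0), (Fast, 0), (Fast, 1)] (s - 1) = t 3 / 6 + a * U [(Fast, 0), (Fast, 1)] (s - 1)"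
      using last c_last by (simp add: Y_Slow Y_Fast t_def a_def sum_divide_distrib eval_nat_numeral)
    then show ?thesis unfolding U using h(3) by linarith
  qed
  have one: "Y [(\<kappa>, p)] (s - 1) = exact_weight [(\<kappa>, p)]" if "p \<le> 3" for \<kappa> p
    using that by (cases \<kappa>; intro fast slow) auto
  have two: "Y [(\<kappa>, p), (\<kappa>', q)] (s - 1) = exact_weight [(\<kappa>, p), (\<kappa>', q)]" if "p + q \<le> 2" for \<kappa> \<kappa>' p q
  proof (cases q)
    case 0
    show ?thesis unfolding 0 using merged[of "[]" \<kappa> p \<kappa>'] one[of "Suc p" \<kappa>] that by simp
  next
    case (Suc q')
    then have pq: "p = 0 \<and> q = 1 \<or> p = 1 \<and> q = 1 \<or> p = 0 \<and> q = 2" using that by auto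
    show ?thesis
    proof (cases "\<kappa> = \<kappa>'")
      case True
      show ?thesis
      proof (cases \<kappa>)
        case Fast
        with True show ?thesis by (intro fast) auto
      next
        case Slow
        with True show ?thesis using that by (intro slow) auto
      qed
    next
      case False
      then show ?thesis using pq FS SF F1S S1F FS2 SF2 by (cases \<kappa>; cases \<kappa>'; elim disjE conjE) simp_all
    qed
  qed
  have three: "Y [(\<kappa>, p), (\<kappa>', q), (\<kappa>'', r)] (s - 1) = exact_weight [(\<kappa>, p), (\<kappa>', q), (\<kappa>'', r)]"
    if "p + q + r \<le> 1" for \<kappa> \<kappa>' \<kappa>'' p q r
  proof (cases r)
    case 0
    show ?thesis unfolding 0 using merged[of "[(\<kappa>, p)]" \<kappa>' q \<kappa>''] two[of p "Suc q" \<kappa> \<kappa>'] that by simp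
  next
    case (Suc r')
    then have "p = 0" "q = 0" "r = 1" using that by auto
    show ?thesis
    proof (cases "\<kappa> = \<kappa>' \<and> \<kappa>' = \<kappa>''")
      case True
      show ?thesis
      proof (cases \<kappa>)
        case Fast
        with True show ?thesis by (intro fast) auto
      next
        case Slow
        with True show ?thesis using that by (intro slow) auto
      qed
    next
      case False
      then show ?thesis using FFS FSF FSS SSF SFS SFF \<open>p = 0\<close> \<open>q = 0\<close> \<open>r = 1\<close>
        by (cases \<kappa>; cases \<kappa>'; cases \<kappa>'') simp_all
    qed
  qed
  have four: "Y [(\<kappa>, 0), (\<kappa>', 0), (\<kappa>'', 0), (\<kappa>''', 0)] (s - 1) = exact_weight [(\<kappa>, 0), (\<kappa>', 0), (\<kappa>'', 0), (\<kappa>''', 0)]"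
    for \<kappa> \<kappa>' \<kappa>'' \<kappa>'''
    using merged[of "[(\<kappa>, 0), (\<kappa>', 0)]" \<kappa>'' 0 \<kappa>'''] three[of 0 0 "Suc 0" \<kappa> \<kappa>' \<kappa>''] by simp
  obtain \<kappa> p w1 where w1: "w = (\<kappa>, p) # w1" using w(1) by (cases w) auto
  show ?thesis
  proof (cases w1)
    case Nil
    then show ?thesis using one w(2) by (simp add: w1)
  next
    case (Cons a w2)
    obtain \<kappa>' q where a: "a = (\<kappa>', q)" by force
    show ?thesis
    proof (cases w2)
      case Nil
      then show ?thesis using two[of p q \<kappa> \<kappa>'] w(2) by (simp add: w1 Cons a)
    next
      case Cons2: (Cons a2 w3)
      obtain \<kappa>'' r where a2: "a2 = (\<kappa>'', r)" by force
      show ?thesis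
      proof (cases w3)
        case Nil
        then show ?thesis using three[of p q r \<kappa> \<kappa>' \<kappa>''] w(2) by (simp add: w1 Cons a Cons2 a2)
      next
        case Cons3: (Cons a3 w4)
        obtain \<kappa>''' t where a3: "a3 = (\<kappa>''', t)" by force
        have "p = 0" "q = 0" "r = 0" "t = 0" "chain_order w4 = 0" using w(2) by (auto simp: w1 Cons a Cons2 a2 Cons3 a3)
        moreover from this(5) have "w4 = []" by (cases w4) auto
        ultimately show ?thesis using four by (simp add: w1 Cons a Cons2 a2 Cons3 a3)
      qed
    qed
  qed
qed

theorem order_four_iff:
  "ipc_order_at_least s A c \<gamma> \<psi> 4 \<longleftrightarrow> rk_order_at_least s A b c 4 \<and>
     1/6 = Y [(Fast, 0), (Slow, 1)] (s - 1) \<and> 1/6 = Y [(Slow, 0), (Fast, 1)] (s - 1) \<and>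
     1/8 = Y [(Fast, 1), (Slow, 1)] (s - 1) \<and> 1/8 = Y [(Slow, 1), (Fast, 1)] (s - 1) \<and>
     1/12 = Y [(Fast, 0), (Slow, 2)] (s - 1) \<and> 1/12 = Y [(Slow, 0), (Fast, 2)] (s - 1) \<and>
     1/24 = Y [(Fast, 0), (Fast, 0), (Slow, 1)] (s - 1) \<and>
     1/24 = Y [(Fast, 0), (Slow, 0), (Fast, 1)] (s - 1) \<and>
     1/24 = Y [(Fast, 0), (Slow, 0), (Slow, 1)] (s - 1) \<and>
     1/24 = Y [(Slow, 0), (Slow, 0), (Fast, 1)] (s - 1) \<and>
     1/24 = Y [(Slow, 0), (Fast, 0), (Slow, 1)] (s - 1)" (is "?ord \<longleftrightarrow> ?conds")
proof
  assume ord: ?ord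
  show ?conds
    using ipc_order_imp_rk_order[OF ord]
    by (simp add: ipc_order_imp_weights[OF ord, unfolded One_nat_def])
next
  assume ?conds
  then show ?ord
    by (intro weights_imp_ipc_order chain_conditions_reduce) simp_all
qed

lemma chain_SF_1: "e \<bullet> ((D * A) *\<^sub>v c + (1/2) \<cdot>\<^sub>v (T *\<^sub>v (c ^\<^sub>v 2))) = Y [(Slow, 0), (Fast, 1)] (s - 1)"
  and chain_SF_2: "e \<bullet> ((D * A) *\<^sub>v (c ^\<^sub>v 2) + (1/3) \<cdot>\<^sub>v (T *\<^sub>v (c ^\<^sub>v 3))) = Y [(Slow, 0), (Fast, 2)] (s - 1)"
  and chain_FS_1: "dc \<bullet> ((L * A + S zeta_weight) *\<^sub>v c) = Y [(Fast, 0), (Slow, 1)] (s - 1)"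
  using chain_SF[of 1] chain_SF[of 2] chain_FS[of 1] by (simp_all add: numeral_2_eq_2 numeral_3_eq_3)

end

theorem theorem3p6:
  fixes s :: nat and A :: "real mat" and b c :: "real vec" and \<gamma> \<psi> :: "real poly mat"
  assumes "slow_base_method s A b c"
    and "coupling_coeffs s \<gamma> \<psi>"
    and "internally_consistent s c \<gamma> \<psi>"
    and "self_consistent s A \<gamma> \<psi>"
  shows "ipc_order_at_least s A c \<gamma> \<psi> 4 \<longleftrightarrow>
    (let \<Gamma> = coeff_mat \<gamma>; \<Psi> = coeff_mat \<psi>;
         \<zeta> = (\<lambda>k. 1 / ((real k + 1) * (real k + 2)));
         \<omega> = (\<lambda>k. 1 / ((real k + 1) * (real k + 3)));
         \<xi> = (\<lambda>k. 1 / ((real k + 1) * (real k + 2) * (real k + 3)));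
         S = weighted_sum s;
         e = unit_vec s (s - 1); D = diag_part A; T = strict_lower_part A;
         L = lower_shift s; dc = delta c; dC = delta_mat c
     in rk_order_at_least s A b c 4 \<and>
        1/6 = dc \<bullet> ((L * A + S \<zeta> (\<lambda>k. \<Psi> k + \<Gamma> k)) *\<^sub>v c) \<and>
        1/6 = e \<bullet> ((D * A) *\<^sub>v c + (1/2) \<cdot>\<^sub>v (T *\<^sub>v (c ^\<^sub>v 2))) \<and>
        1/8 = (dc \<times>\<^sub>v (L *\<^sub>v c)) \<bullet> ((L * A + S \<zeta> (\<lambda>k. \<Psi> k + \<Gamma> k)) *\<^sub>v c)
            + (dc ^\<^sub>v 2) \<bullet> (((1/2) \<cdot>\<^sub>m (L * A) + S \<omega> (\<lambda>k. \<Psi> k + \<Gamma> k)) *\<^sub>v c) \<and>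
        1/8 = ((transpose_mat D *\<^sub>v e) \<times>\<^sub>v c) \<bullet> (A *\<^sub>v c)
            + 1/2 * (((transpose_mat T *\<^sub>v e) \<times>\<^sub>v c) \<bullet> (c ^\<^sub>v 2)) \<and>
        1/12 = dc \<bullet> ((L * A + S \<zeta> (\<lambda>k. \<Psi> k + \<Gamma> k)) *\<^sub>v (c ^\<^sub>v 2)) \<and>
        1/12 = e \<bullet> ((D * A) *\<^sub>v (c ^\<^sub>v 2) + (1/3) \<cdot>\<^sub>v (T *\<^sub>v (c ^\<^sub>v 3))) \<and>
        1/24 = dc \<bullet> ((L * dC * (L * A + S \<zeta> (\<lambda>k. \<Psi> k + \<Gamma> k))) *\<^sub>v c)
             + (dc ^\<^sub>v 2) \<bullet> (((1/2) \<cdot>\<^sub>m (L * A) + S \<xi> (\<lambda>k. \<Psi> k + \<Gamma> k)) *\<^sub>v c) \<and>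
        1/24 = dc \<bullet> (((L * D + S \<zeta> \<Psi>) * A) *\<^sub>v c)
             + 1/2 * (dc \<bullet> ((L * T + S \<zeta> \<Gamma>) *\<^sub>v (c ^\<^sub>v 2))) \<and>
        1/24 = dc \<bullet> (((L * A + S \<zeta> (\<lambda>k. \<Psi> k + \<Gamma> k)) * A) *\<^sub>v c) \<and>
        1/24 = e \<bullet> (A *\<^sub>v ((D * A) *\<^sub>v c + (1/2) \<cdot>\<^sub>v (T *\<^sub>v (c ^\<^sub>v 2)))) \<and>
        1/24 = e \<bullet> ((D * A * A) *\<^sub>v c)
             + e \<bullet> ((T * dC * (L * A + S \<zeta> (\<lambda>k. \<Psi> k + \<Gamma> k))) *\<^sub>v c))"
proof -
  interpret ipc_method s A b c \<gamma> \<psi> using assms by unfold_locales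
  show ?thesis
    unfolding Let_def zeta_weight_def[symmetric] omega_weight_def[symmetric] xi_weight_def[symmetric]
      chain_FS_1 chain_SF_1 chain_F1S chain_S1F chain_FS chain_SF_2 chain_FFS chain_FSF chain_FSS chain_SSF chain_SFS
    by (rule order_four_iff)
qed

end
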